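(* Let $f:S\to \mathbb{Q}_3$ and $\hat f:\hat S\to \mathbb{Q}_3$ be two isotropic curves of general type, with quartic differentials $\delta$, $\hat\delta$ and associated quadratic differentials $\mathfrak d(\delta)$, $\mathfrak d(\hat\delta)$ (each computed with the projective structure of the respective curve). Then $\hat f$ is dominated by $f$ if and only if there exists a holomorphic map $h:\hat S\to S$ such that $h^*(\delta)=\hat\delta$ and $h^*(\mathfrak d(\delta))=\mathfrak d(\hat\delta)$.
   Context: Domination: $\hat f$ is dominated by $f$ if there exist a holomorphic map $h:\hat S\to S$ and $X\in\mathrm{Sp}(2,\mathbb{C})$ such that $\hat f=X\cdot f\circ h$. Symplectic group. $(\mathbf e_1,\dots,\mathbf e_4)$ is the natural basis of $\mathbb{C}^4$, $\omega=dz^1\wedge dz^3+dz^2\wedge dz^4$, $\mathrm{Sp}(2,\mathbb{C})$ is the group of linear automorphisms of $(\mathbb{C}^4,\omega)$. For $A\in\mathrm{Sp}(2,\mathbb{C})$, $A_j=A\mathbf e_j$. $\varphi=(\varphi^i_j)=A^{-1}dA$ is the Maurer–Cartan form ($i$ = row, $j$ = column). $\mathbf a_r^s$ is the $2\times2$ matrix with $1$ in the $(r,s)$ place and $0$ elsewhere; $(\mathbf a_1,\mathbf a_2)$ is the natural basis of $\mathbb{C}^2$. Isotropic curves. $\mathbb{Q}_3$ is the complex 3-fold of Lagrangian 2-planes of $(\mathbb{C}^4,\omega)$; the plane spanned by $\mathbf x,\mathbf y$ is written $[\mathbf x\wedge\mathbf y]$. Its canonical conformal structure is represented, for a local holomorphic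 section $A$ of $A\mapsto[A_1\wedge A_2]$, by $\varphi^3_1\varphi^4_2-(\varphi^4_1)^2$. An isotropic curve is a nonconstant holomorphic map $f:S\to\mathbb{Q}_3$ from a connected Riemann surface, null for this conformal structure and with image not contained in a null ray $\{P : [\xi]\subset P\}$, $[\xi]\in\mathbb{CP}^3$. If locally $f=[\mathbf u_1\wedge\mathbf u_2]$, the symmetric matrix $\dot{\mathbf m}=(\omega(\mathbf u_i,\mathbf u_j'))$ has zero determinant; the Legendre associate $f^\sharp:S\to\mathbb{CP}^3$ is the holomorphic map which, where $\dot{\mathbf m}\neq0$, is the line spanned by $x_1\mathbf u_1+x_2\mathbf u_2$ with $0\ne(x_1,x_2)\in\ker\dot{\mathbf m}$ (extended holomorphically). $|\Delta_f|,|\Delta_{f^\sharp}|$ are the sets of critical points of $f,f^\sharp$, and $S_\star=S\setminus(|\Delta_f|\cup|\Delta_{f^\sharp}|)$. Projective structures. $\mathrm{SL}(2,\mathbb{C})_1$ is the group of upper triangular unimodular $2\times2$ matrices. A projective structure on a Riemann surface is a holomorphic principal $\mathrm{SL}(2,\mathbb{C})_1$-bundle $P$ with a holomorphic $\mathfrak{sl}(2,\mathbb{C})$-valued Cartan connection $\eta$. A chart $(U,z)$ is adapted to $(P,\eta)$ if there is a section $\mathfrak p:U\to P$ with $\mathfrak p^*(\eta)=\mathbf a_2^1dz$; such charts form an atlas. A meromorphic projective structure on $S$ is a projective structure on $S\setminus D$, $D$ discrete, such that near each $p_0\in D$ there is a section over a punctured neighborhood pulling $\eta$ back to a form meromorphic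 at $p_0$. The operator $\mathfrak d$ from meromorphic quartic to meromorphic quadratic differentials is defined by $\mathfrak d(0)=0$ and, in any adapted chart, $$\mathfrak d(Z\,dz^4)=\Big(\tfrac12\tfrac{Z''}{Z}-\tfrac{9}{16}\tfrac{Z'^2}{Z^2}\Big)dz^2$$ (this does not depend on the adapted chart, and the result is meromorphic on all of $S$). Projective structure and quartic differential of an isotropic curve. Let $\mathtt F:\mathrm S^3(\mathbb{C}^2)\to\mathbb{C}^4$ be the linear isomorphism with $\mathtt F(\mathbf a_1^3)=\mathbf e_1$, $\mathtt F(\mathbf a_1^2\mathbf a_2)=-\sqrt[3]{2/9}\,\mathbf e_2$, $\mathtt F(\mathbf a_1\mathbf a_2^2)=\sqrt[3]{1/6}\,\mathbf e_4$, $\mathtt F(\mathbf a_2^3)=\mathbf e_3$ (symmetric products), $\mathtt S:\mathrm{SL}(2,\mathbb{C})\to\mathrm{Sp}(2,\mathbb{C})$ the representation on $\mathrm S^3(\mathbb{C}^2)$ conjugated by $\mathtt F$, and $\mathrm H_1=\mathtt S(\mathrm{SL}(2,\mathbb{C})_1)$. For an isotropic curve $f$ there is a unique reduction $\pi:\mathcal F\to S_\star$, with group $\mathrm H_1\cong \mathrm{SL}(2,\mathbb{C})_1$, of the bundle $\{(p,A)\in S_\star\times \mathrm{Sp}(2,\mathbb{C}): f(p)=[A_1\wedge A_2]\}$ on which $\varphi^3_1=\varphi^4_1=\varphi^2_1-\varphi^4_2=\varphi^1_1-3\varphi^2_2=4\varphi^1_2-3\varphi^2_4=\varphi^1_4=0$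 and $\varphi^4_2\neq0$. The quartic differential $\delta$ of $f$ is the meromorphic quartic differential on $S$ with $\pi^*(\delta)=\varphi^1_3(\varphi^4_2)^3$, and the projective structure of $f$ is the meromorphic projective structure $(\mathcal F,\eta)$ with $\eta=\varphi^2_2(\mathbf a_1^1-\mathbf a_2^2)-6^{-1/3}\varphi^4_2\mathbf a_2^1-(3/32)^{1/3}\varphi^2_4\mathbf a_1^2$. The curve $f$ is of general type if $\delta$ is not identically zero. *)

theory Defs
  imports "HOL-Complex_Analysis.Complex_Analysis"
begin

no_notation fps_nth (infixl "$" 75)

section \<open>Riemann surfaces\<close>

text \<open>
  A Riemann surface is a Hausdorff topological type together with a holomorphic atlas.
  A chart is a pair \<open>(U, z)\<close>; only the values of \<open>z\<close> on \<open>U\<close> matter. The atlas is not required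
  to be maximal: the charts of the maximal atlas are collected in \<open>charts\<close> below.
\<close>

type_synonym 's chart = "'s set \<times> ('s \<Rightarrow> complex)"

abbreviation param :: "'s chart \<Rightarrow> complex \<Rightarrow> 's" where
  "param c \<equiv> inv_into (fst c) (snd c)"

definition topological_chart :: "('s::t2_space) chart \<Rightarrow> bool" where
  "topological_chart c \<longleftrightarrow>
     open (fst c) \<and> open (snd c ` fst c) \<and> inj_on (snd c) (fst c) \<and>
     continuous_on (fst c) (snd c) \<and> continuous_on (snd c ` fst c) (param c)"

definition riemann_surface :: "('s::t2_space) chart set \<Rightarrow> bool" where
  "riemann_surface S \<longleftrightarrow>
     (\<forall>c\<in>S. topological_chart c) \<and> (\<Union>c\<in>S. fst c) = UNIV \<and>
     (\<forall>c\<in>S. \<forall>d\<in>S. (snd d \<circ> param c) holomorphic_on snd c ` (fst c \<inter> fst d))"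

text \<open>Compatibility in the other direction is automatic, as transition maps are injective.\<close>

definition charts :: "('s::t2_space) chart set \<Rightarrow> 's chart set" where
  "charts S = {c. topological_chart c \<and>
     (\<forall>d\<in>S. (snd c \<circ> param d) holomorphic_on snd d ` (fst c \<inter> fst d))}"

definition holomorphic_map ::
    "('t::t2_space) chart set \<Rightarrow> ('s::t2_space) chart set \<Rightarrow> ('t \<Rightarrow> 's) \<Rightarrow> bool" where
  "holomorphic_map T S h \<longleftrightarrow> continuous_on UNIV h \<and>
     (\<forall>c\<in>T. \<forall>d\<in>S. (snd d \<circ> h \<circ> param c) holomorphic_on snd c ` (fst c \<inter> h -` fst d))"

definition holomorphic_curve ::
    "('s::t2_space) chart set \<Rightarrow> complex set \<Rightarrow> (complex \<Rightarrow> 's) \<Rightarrow> bool" where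
  "holomorphic_curve S D \<gamma> \<longleftrightarrow> continuous_on D \<gamma> \<and>
     (\<forall>d\<in>S. (snd d \<circ> \<gamma>) holomorphic_on (D \<inter> \<gamma> -` fst d))"

definition surface_holomorphic_on ::
    "('s::t2_space) chart set \<Rightarrow> 's set \<Rightarrow> ('s \<Rightarrow> complex) \<Rightarrow> bool" where
  "surface_holomorphic_on S W g \<longleftrightarrow>
     (\<forall>c\<in>S. (g \<circ> param c) holomorphic_on snd c ` (fst c \<inter> W))"

definition holomorphic_vec_on ::
    "('s::t2_space) chart set \<Rightarrow> 's set \<Rightarrow> ('s \<Rightarrow> complex^'n) \<Rightarrow> bool" where
  "holomorphic_vec_on S W u \<longleftrightarrow> (\<forall>i. surface_holomorphic_on S W (\<lambda>p. u p $ i))"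

definition holomorphic_mat_on ::
    "('s::t2_space) chart set \<Rightarrow> 's set \<Rightarrow> ('s \<Rightarrow> complex^'n^'m) \<Rightarrow> bool" where
  "holomorphic_mat_on S W A \<longleftrightarrow> (\<forall>i j. surface_holomorphic_on S W (\<lambda>p. A p $ i $ j))"

definition vec_deriv :: "(complex \<Rightarrow> complex^'n) \<Rightarrow> complex \<Rightarrow> complex^'n" where
  "vec_deriv u t = (\<chi> i. deriv (\<lambda>s. u s $ i) t)"

definition mat_deriv :: "(complex \<Rightarrow> complex^'n^'m) \<Rightarrow> complex \<Rightarrow> complex^'n^'m" where
  "mat_deriv A t = (\<chi> i j. deriv (\<lambda>s. A s $ i $ j) t)"

text \<open>
  \<open>maurer_cartan A t\<close> is the coefficient of \<open>dt\<close> in \<open>A\<inverse> dA\<close>. For a map \<open>A\<close> on a surface and a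
  chart \<open>c = (U, z)\<close>, the coefficient of \<open>dz\<close> at \<open>p\<close> is \<open>maurer_cartan (A \<circ> param c) (z p)\<close>.
\<close>

definition maurer_cartan :: "(complex \<Rightarrow> complex^'n^'n) \<Rightarrow> complex \<Rightarrow> complex^'n^'n" where
  "maurer_cartan A t = matrix_inv (A t) ** mat_deriv A t"


section \<open>Meromorphic differentials\<close>

text \<open>
  A meromorphic differential of degree \<open>k\<close> assigns to every chart \<open>c = (U, z)\<close> of the maximal
  atlas its coefficient with respect to \<open>dz\<^sup>k\<close>. The coefficient takes the value \<open>0\<close> at poles
  and has no removable singularities, so that it is determined by the differential.
\<close>

type_synonym 's differential = "'s chart \<Rightarrow> 's \<Rightarrow> complex"

definition meromorphic_differential ::
    "('s::t2_space) chart set \<Rightarrow> nat \<Rightarrow> 's differential \<Rightarrow> bool" where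
  "meromorphic_differential S k \<delta> \<longleftrightarrow>
     (\<forall>c\<in>charts S. (\<delta> c \<circ> param c) nicely_meromorphic_on snd c ` fst c) \<and>
     (\<forall>c\<in>charts S. \<forall>d\<in>charts S. \<forall>p\<in>fst c \<inter> fst d.
        \<delta> c p = \<delta> d p * deriv (snd d \<circ> param c) (snd c p) ^ k)"

definition zero_differential :: "('s::t2_space) chart set \<Rightarrow> 's differential \<Rightarrow> bool" where
  "zero_differential S \<delta> \<longleftrightarrow> (\<forall>c\<in>charts S. \<forall>p\<in>fst c. \<delta> c p = 0)"

text \<open>
  \<open>pullback_eq T S k h \<delta> \<epsilon>\<close> says \<open>h\<^sup>*\<delta> = \<epsilon>\<close> as meromorphic differentials of degree \<open>k\<close>, that is,
  the coefficients agree near every point, possibly except at the point itself (where \<open>\<delta>\<close> may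
  have a pole at the image). For a constant map the pullback is zero when \<open>k > 0\<close>.
\<close>

definition pullback_eq ::
    "('t::t2_space) chart set \<Rightarrow> ('s::t2_space) chart set \<Rightarrow> nat \<Rightarrow> ('t \<Rightarrow> 's) \<Rightarrow>
     's differential \<Rightarrow> 't differential \<Rightarrow> bool" where
  "pullback_eq T S k h \<delta> \<epsilon> \<longleftrightarrow>
     (\<forall>c\<in>charts T. \<forall>d\<in>charts S. \<forall>p\<in>fst c \<inter> h -` fst d.
        \<forall>\<^sub>F q in at p. \<delta> d (h q) * deriv (snd d \<circ> h \<circ> param c) (snd c q) ^ k = \<epsilon> c q)"


section \<open>The symplectic group and maps into Grassmannians\<close>

definition omega :: "complex^4 \<Rightarrow> complex^4 \<Rightarrow> complex" where
  "omega x y = (x $ 1 * y $ 3 - x $ 3 * y $ 1) + (x $ 2 * y $ 4 - x $ 4 * y $ 2)"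

definition Sp4 :: "(complex^4^4) set" where
  "Sp4 = {A. \<forall>x y. omega (A *v x) (A *v y) = omega x y}"

definition lagrangian_planes :: "(complex^4) set set" where
  "lagrangian_planes =
     {P. vec.subspace P \<and> vec.dim P = 2 \<and> (\<forall>x\<in>P. \<forall>y\<in>P. omega x y = 0)}"

text \<open>
  A map into the Grassmannian of \<open>k\<close>-planes of \<open>\<complex>\<^sup>4\<close> is holomorphic if it is locally spanned by
  \<open>k\<close> holomorphic vector-valued functions; for \<open>k = 1\<close> this is holomorphy of a map into the
  projective space, described by its lines.
\<close>

definition holomorphic_subspace_map ::
    "('s::t2_space) chart set \<Rightarrow> nat \<Rightarrow> ('s \<Rightarrow> (complex^4) set) \<Rightarrow> bool" where
  "holomorphic_subspace_map S k G \<longleftrightarrow>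
     (\<forall>p. \<exists>W u. open W \<and> p \<in> W \<and> (\<forall>i<k. holomorphic_vec_on S W (u i)) \<and>
        (\<forall>q\<in>W. vec.dim (G q) = k \<and> G q = vec.span ((\<lambda>i. u i q) ` {..<k})))"

text \<open>
  The tangent space of the Grassmannian at \<open>P\<close> is \<open>Hom(P, \<complex>\<^sup>4/P)\<close>, and the differential of \<open>G\<close> at
  \<open>p\<close> sends \<open>v(p)\<close> to the class of \<open>v'(p)\<close> for every local holomorphic section \<open>v\<close> of \<open>G\<close>.
  Critical points are the zeros of the differential.
\<close>

definition critical_points ::
    "('s::t2_space) chart set \<Rightarrow> ('s \<Rightarrow> (complex^4) set) \<Rightarrow> 's set" where
  "critical_points S G =
     {p. \<forall>c\<in>charts S. \<forall>W v. p \<in> fst c \<and> open W \<and> p \<in> W \<and> holomorphic_vec_on S W v \<and>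
        (\<forall>q\<in>W. v q \<in> G q) \<longrightarrow> vec_deriv (v \<circ> param c) (snd c p) \<in> G p}"


section \<open>Isotropic curves\<close>

definition symplectic_lift ::
    "('s::t2_space) chart set \<Rightarrow> ('s \<Rightarrow> (complex^4) set) \<Rightarrow> 's set \<Rightarrow> ('s \<Rightarrow> complex^4^4) \<Rightarrow> bool"
  where
  "symplectic_lift S f W A \<longleftrightarrow> open W \<and> holomorphic_mat_on S W A \<and>
     (\<forall>q\<in>W. A q \<in> Sp4 \<and> f q = vec.span {column 1 (A q), column 2 (A q)})"

definition null_map :: "('s::t2_space) chart set \<Rightarrow> ('s \<Rightarrow> (complex^4) set) \<Rightarrow> bool" where
  "null_map S f \<longleftrightarrow>
     (\<forall>W A. symplectic_lift S f W A \<longrightarrow>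
        (\<forall>c\<in>charts S. \<forall>p\<in>W \<inter> fst c.
           let \<phi> = maurer_cartan (A \<circ> param c) (snd c p)
           in \<phi> $ 3 $ 1 * \<phi> $ 4 $ 2 - (\<phi> $ 4 $ 1)\<^sup>2 = 0))"

definition isotropic_curve :: "('s::t2_space) chart set \<Rightarrow> ('s \<Rightarrow> (complex^4) set) \<Rightarrow> bool" where
  "isotropic_curve S f \<longleftrightarrow>
     riemann_surface S \<and> connected (UNIV :: 's set) \<and>
     (\<forall>p. f p \<in> lagrangian_planes) \<and> holomorphic_subspace_map S 2 f \<and>
     \<not> (\<exists>P. \<forall>p. f p = P) \<and>
     null_map S f \<and>
     \<not> (\<exists>\<xi>. \<xi> \<noteq> 0 \<and> (\<forall>p. \<xi> \<in> f p))"

definition m_dot ::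
    "('s::t2_space) chart \<Rightarrow> (2 \<Rightarrow> 's \<Rightarrow> complex^4) \<Rightarrow> 's \<Rightarrow> complex^2^2" where
  "m_dot c u p = (\<chi> i j. omega (u i p) (vec_deriv (u j \<circ> param c) (snd c p)))"

definition legendre_associate ::
    "('s::t2_space) chart set \<Rightarrow> ('s \<Rightarrow> (complex^4) set) \<Rightarrow> ('s \<Rightarrow> (complex^4) set) \<Rightarrow> bool" where
  "legendre_associate S f g \<longleftrightarrow>
     holomorphic_subspace_map S 1 g \<and>
     (\<forall>W u. open W \<and> (\<forall>i. holomorphic_vec_on S W (u i)) \<and>
        (\<forall>q\<in>W. f q = vec.span {u 1 q, u 2 q}) \<longrightarrow>
        (\<forall>c\<in>charts S. \<forall>p\<in>W \<inter> fst c. m_dot c u p \<noteq> 0 \<longrightarrow>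
           (\<forall>x. x \<noteq> 0 \<and> m_dot c u p *v x = 0 \<longrightarrow>
              g p = vec.span {x $ 1 *s u 1 p + x $ 2 *s u 2 p})))"

definition S_star ::
    "('s::t2_space) chart set \<Rightarrow> ('s \<Rightarrow> (complex^4) set) \<Rightarrow> ('s \<Rightarrow> (complex^4) set) \<Rightarrow> 's set" where
  "S_star S f g = - (critical_points S f \<union> critical_points S g)"

definition dominated ::
    "('t::t2_space) chart set \<Rightarrow> ('t \<Rightarrow> (complex^4) set) \<Rightarrow>
     ('s::t2_space) chart set \<Rightarrow> ('s \<Rightarrow> (complex^4) set) \<Rightarrow> bool" where
  "dominated T g S f \<longleftrightarrow>
     (\<exists>h X. holomorphic_map T S h \<and> X \<in> Sp4 \<and> (\<forall>p. g p = (\<lambda>v. X *v v) ` f (h p)))"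


section \<open>The representation on the third symmetric power\<close>

definition SL2_1 :: "(complex^2^2) set" where
  "SL2_1 = {Y. det Y = 1 \<and> Y $ 2 $ 1 = 0}"

text \<open>
  Elements of the third symmetric power of \<open>\<complex>\<^sup>2\<close> are given by their coordinates with respect to
  the monomials \<open>a\<^sub>1\<^sup>3, a\<^sub>1\<^sup>2 a\<^sub>2, a\<^sub>1 a\<^sub>2\<^sup>2, a\<^sub>2\<^sup>3\<close>, and \<open>sym_prod u v w\<close> is the symmetric product.
\<close>

definition sym_prod :: "complex^2 \<Rightarrow> complex^2 \<Rightarrow> complex^2 \<Rightarrow> complex^4" where
  "sym_prod u v w = vector
     [u $ 1 * v $ 1 * w $ 1,
      u $ 1 * v $ 1 * w $ 2 + u $ 1 * v $ 2 * w $ 1 + u $ 2 * v $ 1 * w $ 1,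
      u $ 1 * v $ 2 * w $ 2 + u $ 2 * v $ 1 * w $ 2 + u $ 2 * v $ 2 * w $ 1,
      u $ 2 * v $ 2 * w $ 2]"

definition sym_power :: "complex^2^2 \<Rightarrow> complex^4 \<Rightarrow> complex^4" where
  "sym_power X m =
     (let x = X *v axis 1 1; y = X *v axis 2 1
      in m $ 1 *s sym_prod x x x + m $ 2 *s sym_prod x x y +
         m $ 3 *s sym_prod x y y + m $ 4 *s sym_prod y y y)"

text \<open>The monomial \<open>a\<^sub>1 a\<^sub>2\<^sup>2\<close> goes to a multiple of \<open>e\<^sub>4\<close> and \<open>a\<^sub>2\<^sup>3\<close> to \<open>e\<^sub>3\<close>.\<close>

definition F_iso :: "complex^4 \<Rightarrow> complex^4" where
  "F_iso m = vector
     [m $ 1, - complex_of_real (root 3 (2/9)) * m $ 2,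
      m $ 4, complex_of_real (root 3 (1/6)) * m $ 3]"

definition S_rep :: "complex^2^2 \<Rightarrow> complex^4^4" where
  "S_rep X = matrix (F_iso \<circ> sym_power X \<circ> inv F_iso)"


section \<open>Projective structures\<close>

text \<open>
  Holomorphic principal bundles with group \<open>SL2_1\<close> over an open set \<open>M\<close> of the surface are taken
  as subbundles of \<open>M \<times> GL(4, \<complex>)\<close> on which \<open>Y\<close> acts by right multiplication with \<open>S_rep Y\<close>, and
  Cartan connections are taken of the form \<open>\<eta>(A\<inverse> dA)\<close> with \<open>\<eta>\<close> linear; this is
  the form in which the bundles of isotropic curves arise.
\<close>

definition local_section ::
    "('s::t2_space) chart set \<Rightarrow> ('s \<times> (complex^4^4)) set \<Rightarrow> 's set \<Rightarrow> ('s \<Rightarrow> complex^4^4) \<Rightarrow> bool"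
  where
  "local_section S P W A \<longleftrightarrow> open W \<and> holomorphic_mat_on S W A \<and> (\<forall>q\<in>W. (q, A q) \<in> P)"

definition principal_bundle ::
    "('s::t2_space) chart set \<Rightarrow> 's set \<Rightarrow> ('s \<times> (complex^4^4)) set \<Rightarrow> bool" where
  "principal_bundle S M P \<longleftrightarrow>
     open M \<and> P \<subseteq> M \<times> {A. invertible A} \<and>
     (\<forall>p\<in>M. \<exists>W A. p \<in> W \<and> local_section S P W A) \<and>
     (\<forall>p A B. (p, A) \<in> P \<longrightarrow> ((p, B) \<in> P \<longleftrightarrow> (\<exists>Y\<in>SL2_1. B = A ** S_rep Y)))"

text \<open>
  Tangent vectors of \<open>P\<close> at a point \<open>x\<close> are the velocities of holomorphic curves in \<open>P\<close> through
  \<open>x\<close>; the component along the surface is expressed in the chart \<open>d\<close>. The Maurer-Cartan form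
  maps a tangent vector \<open>(v, V)\<close> at \<open>(p, A)\<close> to \<open>matrix_inv A ** V\<close>.
\<close>

definition tangent_vectors ::
    "('s::t2_space) chart set \<Rightarrow> ('s \<times> (complex^4^4)) set \<Rightarrow> 's chart \<Rightarrow> 's \<times> (complex^4^4) \<Rightarrow>
     (complex \<times> (complex^4^4)) set" where
  "tangent_vectors S P d x =
     {(v, V). \<exists>D \<gamma> A t. open D \<and> t \<in> D \<and> holomorphic_curve S D \<gamma> \<and>
        (\<forall>i j. (\<lambda>s. A s $ i $ j) holomorphic_on D) \<and> (\<forall>s\<in>D. (\<gamma> s, A s) \<in> P) \<and>
        (\<gamma> t, A t) = x \<and> v = deriv (snd d \<circ> \<gamma>) t \<and> V = mat_deriv A t}"

definition cartan_connection ::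
    "('s::t2_space) chart set \<Rightarrow> ('s \<times> (complex^4^4)) set \<Rightarrow> (complex^4^4 \<Rightarrow> complex^2^2) \<Rightarrow> bool" where
  "cartan_connection S P \<eta> \<longleftrightarrow>
     (\<forall>a b X Z. \<eta> (\<chi> i j. a * X $ i $ j + b * Z $ i $ j) =
        (\<chi> i j. a * \<eta> X $ i $ j + b * \<eta> Z $ i $ j)) \<and>
     (\<forall>d\<in>charts S. \<forall>p\<in>fst d. \<forall>A. (p, A) \<in> P \<longrightarrow>
        bij_betw (\<lambda>(v, V). \<eta> (matrix_inv A ** V)) (tangent_vectors S P d (p, A))
          {X. trace X = 0} \<and>
        (\<forall>(v, V) \<in> tangent_vectors S P d (p, A). \<forall>Y\<in>SL2_1.
           \<eta> (matrix_inv (A ** S_rep Y) ** (V ** S_rep Y)) =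
           matrix_inv Y ** \<eta> (matrix_inv A ** V) ** Y)) \<and>
     (\<forall>p A D Y t. (p, A) \<in> P \<and> open D \<and> t \<in> D \<and> (\<forall>s\<in>D. Y s \<in> SL2_1) \<and>
        (\<forall>i j. (\<lambda>s. Y s $ i $ j) holomorphic_on D) \<longrightarrow>
        \<eta> (maurer_cartan (\<lambda>s. A ** S_rep (Y s)) t) = maurer_cartan Y t)"

definition projective_structure ::
    "('s::t2_space) chart set \<Rightarrow> 's set \<Rightarrow> ('s \<times> (complex^4^4)) set \<Rightarrow>
     (complex^4^4 \<Rightarrow> complex^2^2) \<Rightarrow> bool" where
  "projective_structure S M P \<eta> \<longleftrightarrow> principal_bundle S M P \<and> cartan_connection S P \<eta>"

definition meromorphic_projective_structure ::
    "('s::t2_space) chart set \<Rightarrow> 's set \<Rightarrow> ('s \<times> (complex^4^4)) set \<Rightarrow>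
     (complex^4^4 \<Rightarrow> complex^2^2) \<Rightarrow> bool" where
  "meromorphic_projective_structure S D P \<eta> \<longleftrightarrow>
     (\<forall>p. \<not> p islimpt D) \<and> projective_structure S (- D) P \<eta> \<and>
     (\<forall>p\<in>D. \<exists>d\<in>charts S. \<exists>W A. p \<in> W \<and> open W \<and> W \<subseteq> fst d \<and> local_section S P (W - {p}) A \<and>
        (\<forall>i j. (\<lambda>x. \<eta> (maurer_cartan (A \<circ> param d) x) $ i $ j) meromorphic_on {snd d p}))"

definition adapted_chart ::
    "('s::t2_space) chart set \<Rightarrow> ('s \<times> (complex^4^4)) set \<Rightarrow> (complex^4^4 \<Rightarrow> complex^2^2) \<Rightarrow>
     's chart \<Rightarrow> bool" where
  "adapted_chart S P \<eta> c \<longleftrightarrow> c \<in> charts S \<and>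
     (\<exists>A. local_section S P (fst c) A \<and>
        (\<forall>p\<in>fst c. \<eta> (maurer_cartan (A \<circ> param c) (snd c p)) = vector [vector [0, 0], vector [1, 0]]))"

text \<open>
  \<open>frak_d S D P \<eta> \<delta> \<epsilon>\<close> says that \<open>\<epsilon>\<close> is the meromorphic quadratic differential assigned to the
  meromorphic quartic differential \<open>\<delta>\<close> by means of the projective structure \<open>(P, \<eta>)\<close> on
  \<open>- D\<close>. The formula is an identity of meromorphic functions, whence the exception of isolated
  points (zeros of \<open>Z\<close>).
\<close>

definition frak_d ::
    "('s::t2_space) chart set \<Rightarrow> 's set \<Rightarrow> ('s \<times> (complex^4^4)) set \<Rightarrow>
     (complex^4^4 \<Rightarrow> complex^2^2) \<Rightarrow> 's differential \<Rightarrow> 's differential \<Rightarrow> bool" where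
  "frak_d S D P \<eta> \<delta> \<epsilon> \<longleftrightarrow>
     meromorphic_projective_structure S D P \<eta> \<and>
     meromorphic_differential S 4 \<delta> \<and> meromorphic_differential S 2 \<epsilon> \<and>
     (zero_differential S \<delta> \<longrightarrow> zero_differential S \<epsilon>) \<and>
     (\<not> zero_differential S \<delta> \<longrightarrow>
        (\<forall>c. adapted_chart S P \<eta> c \<longrightarrow> (\<forall>p\<in>fst c. \<forall>\<^sub>F q in at p.
           let Z = \<delta> c \<circ> param c; x = snd c q
           in \<epsilon> c q = 1/2 * (deriv (deriv Z) x / Z x) - 9/16 * ((deriv Z x)\<^sup>2 / (Z x)\<^sup>2))))"


section \<open>Projective structure and quartic differential of an isotropic curve\<close>

definition canonical_reduction ::
    "('s::t2_space) chart set \<Rightarrow> ('s \<Rightarrow> (complex^4) set) \<Rightarrow> ('s \<Rightarrow> (complex^4) set) \<Rightarrow>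
     ('s \<times> (complex^4^4)) set \<Rightarrow> bool" where
  "canonical_reduction S f g F \<longleftrightarrow>
     principal_bundle S (S_star S f g) F \<and>
     (\<forall>(p, A) \<in> F. A \<in> Sp4 \<and> f p = vec.span {column 1 A, column 2 A}) \<and>
     (\<forall>d\<in>charts S. \<forall>(p, A) \<in> F. p \<in> fst d \<longrightarrow>
        (\<forall>(v, V) \<in> tangent_vectors S F d (p, A).
           let \<phi> = matrix_inv A ** V
           in \<phi> $ 3 $ 1 = 0 \<and> \<phi> $ 4 $ 1 = 0 \<and> \<phi> $ 2 $ 1 - \<phi> $ 4 $ 2 = 0 \<and>
              \<phi> $ 1 $ 1 - 3 * \<phi> $ 2 $ 2 = 0 \<and> 4 * \<phi> $ 1 $ 2 - 3 * \<phi> $ 2 $ 4 = 0 \<and>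
              \<phi> $ 1 $ 4 = 0) \<and>
        (\<exists>(v, V) \<in> tangent_vectors S F d (p, A). (matrix_inv A ** V) $ 4 $ 2 \<noteq> 0))"

definition quartic_differential ::
    "('s::t2_space) chart set \<Rightarrow> ('s \<times> (complex^4^4)) set \<Rightarrow> 's differential \<Rightarrow> bool" where
  "quartic_differential S F \<delta> \<longleftrightarrow>
     meromorphic_differential S 4 \<delta> \<and>
     (\<forall>d\<in>charts S. \<forall>(p, A) \<in> F. p \<in> fst d \<longrightarrow>
        (\<forall>(v, V) \<in> tangent_vectors S F d (p, A).
           let \<phi> = matrix_inv A ** V
           in \<delta> d p * v ^ 4 = \<phi> $ 1 $ 3 * (\<phi> $ 4 $ 2) ^ 3))"

definition curve_eta :: "complex^4^4 \<Rightarrow> complex^2^2" where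
  "curve_eta \<phi> = vector
     [vector [\<phi> $ 2 $ 2, - complex_of_real (root 3 (3/32)) * \<phi> $ 2 $ 4],
      vector [- complex_of_real (1 / root 3 6) * \<phi> $ 4 $ 2, - \<phi> $ 2 $ 2]]"

end

theory Submission
  imports Defs
begin

text \<open>
  In the normal form of the canonical reduction, the Maurer-Cartan form of a section is the image
  of the projective Cartan connection under the differential of \<^term>\<open>S_rep\<close>, plus a multiple of
  the elementary matrix with entry \<open>(1, 3)\<close> which carries the quartic differential. Two symplectic
  frames of the same curve in this normal form differ by \<^term>\<open>S_rep\<close> of an upper triangular
  matrix. Hence if \<open>g = X f \<circ> h\<close>, then \<open>X A \<circ> h\<close> is a section of the second reduction for every
  section \<open>A\<close> of the first one, charts adapted to \<open>f\<close> pull back to charts adapted to \<open>g\<close>, and all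
  invariants correspond.

  Conversely, let \<open>Z dz\<^sup>4\<close> and \<open>Y dx\<^sup>4\<close> represent the quartic differentials in adapted charts and let
  \<open>H\<close> represent \<open>h\<close>. If \<open>Y = (Z \<circ> H) H'\<^sup>4\<close>, then the two quadratic differentials differ by twice the
  Schwarzian derivative of \<open>H\<close>. So \<open>H\<close> is a Moebius transformation, and \<open>A \<circ> h\<close> can be changed by an
  upper triangular gauge so that it has the same Maurer-Cartan form as a section of the second
  reduction. The two frames then differ by a constant \<open>X\<close> near one point, and \<open>g = X f \<circ> h\<close> holds
  everywhere by analytic continuation.
\<close>

section \<open>Symplectic matrices and their derivatives\<close>

text \<open>Under \<open>S_rep\<close> the symplectic Lie algebra splits into sl(2) and a
  seven-dimensional irreducible part, and the elementary matrix with entry \<open>(1, 3)\<close> is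
  a highest weight vector of the latter. A gauge with diagonal \<open>r, 1 / r\<close> therefore
  multiplies the coefficient \<open>t\<close> of that matrix by \<open>r^(-6)\<close> and
  \<open>q\<close> by \<open>r^2\<close>, so that \<open>t * q^3\<close>, the quartic differential,
  is unchanged.

  In the converse the gauge has no freedom left: preserving \<open>q\<close> requires
  \<open>H' = r^(-2)\<close>, and keeping \<open>p = 0\<close> then fixes the corner. The only
  obstruction is \<open>s\<close>, which becomes a multiple of \<open>r'' / r\<close>, that is, of
  the Schwarzian derivative of \<open>H\<close>; the operator on quartic differentials is what
  detects it. A nonzero quartic differential serves twice, to exclude critical points of
  \<open>h\<close> and to divide by \<open>Z\<close>.

  All identities hold only off discrete sets of zeros, poles and exceptional points. One direction
  therefore moves the base point several times, and the other checks meromorphic identities on a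
  dense set.\<close>

lemma vector_4 [simp]:
  "(vector [a, b, c, d] :: 'a::zero^4) $ 1 = a"
  "(vector [a, b, c, d] :: 'a::zero^4) $ 2 = b"
  "(vector [a, b, c, d] :: 'a::zero^4) $ 3 = c"
  "(vector [a, b, c, d] :: 'a::zero^4) $ 4 = d"
  by (simp_all add: vector_def)

definition J_mat :: "complex^4^4" where
  "J_mat = vector [vector [0, 0, 1, 0], vector [0, 0, 0, 1], vector [-1, 0, 0, 0], vector [0, -1, 0, 0]]"

text \<open>On \<open>Sp4\<close> this is the inverse. Being linear in \<open>A\<close>, it can be
  differentiated without a quotient rule.\<close>

definition sp_inv :: "complex^4^4 \<Rightarrow> complex^4^4" where
  "sp_inv A = (- J_mat) ** transpose A ** J_mat"

lemma J_mat_square: "(- J_mat) ** J_mat = mat 1"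
  by (simp add: J_mat_def matrix_matrix_mult_def vec_eq_iff forall_4 sum_4 mat_def)

lemma omega_eq_entry: "omega (column i A) (column j B) = (transpose A ** J_mat ** B) $ i $ j"
  by (simp add: omega_def J_mat_def matrix_matrix_mult_def sum_4 transpose_def column_def algebra_simps)

lemma Sp4_iff: "A \<in> Sp4 \<longleftrightarrow> transpose A ** J_mat ** A = J_mat"
proof
  assume A: "A \<in> Sp4"
  have col: "column i A = A *v axis i 1" for i
    by (simp add: vec_eq_iff column_def matrix_vector_mult_def axis_def if_distrib sum_4 cong: if_cong)
       (metis (mono_tags) exhaust_4)
  have "(transpose A ** J_mat ** A) $ i $ j = J_mat $ i $ j" for i j
  proof -
    have "(transpose A ** J_mat ** A) $ i $ j = omega (axis i 1) (axis j 1)"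
      using A unfolding omega_eq_entry[symmetric] col Sp4_def by blast
    also have "\<dots> = J_mat $ i $ j"
      using exhaust_4[of i] exhaust_4[of j]
      by (elim disjE) (simp_all add: omega_def J_mat_def axis_def)
    finally show ?thesis .
  qed
  then show "transpose A ** J_mat ** A = J_mat"
    by (simp add: vec_eq_iff)
next
  assume A: "transpose A ** J_mat ** A = J_mat"
  have om: "omega x y = (\<Sum>i\<in>UNIV. \<Sum>j\<in>UNIV. x $ i * J_mat $ i $ j * y $ j)" for x y
    by (simp add: omega_def J_mat_def sum_4 algebra_simps)
  have "omega (A *v x) (A *v y) =
      (\<Sum>i\<in>UNIV. \<Sum>j\<in>UNIV. x $ i * (transpose A ** J_mat ** A) $ i $ j * y $ j)" for x y
    by (simp add: omega_def J_mat_def matrix_matrix_mult_def sum_4 transpose_def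
        matrix_vector_mult_def algebra_simps)
  then show "A \<in> Sp4"
    unfolding Sp4_def A om[symmetric] by simp
qed

lemma sp_inv_left: "A \<in> Sp4 \<Longrightarrow> sp_inv A ** A = mat 1"
  unfolding sp_inv_def Sp4_iff
  by (metis J_mat_square matrix_mul_assoc)

lemma sp_inv_right: "A \<in> Sp4 \<Longrightarrow> A ** sp_inv A = mat 1"
  using sp_inv_left matrix_left_right_inverse by blast

lemma matrix_inv_eqI:
  fixes A B :: "'a::field^'n^'n"
  assumes "A ** B = mat 1"
  shows "matrix_inv A = B"
proof -
  have B: "B ** A = mat 1" using assms matrix_left_right_inverse by blast
  have "C = B" if "A ** C = mat 1" for C
    using that B by (metis matrix_mul_assoc matrix_mul_lid matrix_mul_rid)
  note uniq = this
  show ?thesis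
    unfolding matrix_inv_def
  proof (rule some_equality)
    show "A ** B = mat 1 \<and> B ** A = mat 1" using assms B by simp
    fix C assume "A ** C = mat 1 \<and> C ** A = mat 1"
    then show "C = B" using uniq by blast
  qed
qed

lemma matrix_inv_Sp4: "A \<in> Sp4 \<Longrightarrow> matrix_inv A = sp_inv A"
  by (intro matrix_inv_eqI sp_inv_right)

lemma Sp4_mult: "A \<in> Sp4 \<Longrightarrow> B \<in> Sp4 \<Longrightarrow> A ** B \<in> Sp4"
  by (auto simp: Sp4_def matrix_vector_mul_assoc[symmetric])

lemma sp_inv_Sp4:
  assumes "A \<in> Sp4" shows "sp_inv A \<in> Sp4"
proof -
  have "omega (sp_inv A *v x) (sp_inv A *v y) = omega x y" for x y
  proof -
    have "omega (sp_inv A *v x) (sp_inv A *v y) = omega (A *v (sp_inv A *v x)) (A *v (sp_inv A *v y))"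
      using assms by (simp add: Sp4_def)
    then show ?thesis
      by (simp add: matrix_vector_mul_assoc sp_inv_right[OF assms])
  qed
  then show ?thesis by (simp add: Sp4_def)
qed

text \<open>The elements of the symplectic algebra satisfying the six equations of the canonical frame.\<close>

definition nf :: "complex \<Rightarrow> complex \<Rightarrow> complex \<Rightarrow> complex \<Rightarrow> complex^4^4" where
  "nf p q s t = vector
     [vector [3 * p, 3/4 * s, t, 0],
      vector [q, p, 0, s],
      vector [0, 0, - 3 * p, - q],
      vector [0, q, - 3/4 * s, - p]]"

text \<open>This is \<open>S_rep\<close> of the upper triangular matrix with diagonal
  \<open>r, 1 / r\<close> and corner \<open>- alp * n\<close>, as \<open>S_rep_upper\<close> shows.
  Scaling the corner by \<open>alp\<close> makes all coefficients rational.\<close>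

definition gauge :: "complex \<Rightarrow> complex \<Rightarrow> complex^4^4" where
  "gauge r n = vector
     [vector [r^3, r\<^sup>2 * n, - 2/9 * n^3, 2/3 * r * n\<^sup>2],
      vector [0, r, - 2/3 * n\<^sup>2 / r, 4/3 * n],
      vector [0, 0, 1 / r^3, 0],
      vector [0, 0, - n / r\<^sup>2, 1 / r]]"

section \<open>Upper triangular matrices in the third symmetric power representation\<close>

definition alp :: complex where "alp = complex_of_real (root 3 (2/9))"
definition bet :: complex where "bet = complex_of_real (root 3 (1/6))"

text \<open>These relations replace the two cube roots in all later computations. The mixed ones
  come from \<open>2/9 * 1/6 = 1/27\<close>, combined with the cube of \<open>alp\<close>.\<close>

lemma alp_bet: "alp^3 = 2/9" "3 * alp\<^sup>2 = 2 * bet" "3 * alp * bet = 1" "alp \<noteq> 0" "bet \<noteq> 0"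
proof -
  have a: "root 3 (2/9)^3 = 2/9" "root 3 (1/6)^3 = 1/6"
    by (simp_all add: odd_real_root_pow)
  have "(3 * root 3 (2/9) * root 3 (1/6))^3 = 1"
    by (simp add: power_mult_distrib a)
  then have c: "3 * root 3 (2/9) * root 3 (1/6) = 1"
    using power_eq_iff_eq_base[of 3 "3 * root 3 (2/9) * root 3 (1/6)" 1] by simp
  have e: "root 3 (2/9) \<noteq> 0" "root 3 (1/6) \<noteq> 0" by auto
  have d: "3 * (root 3 (2/9))\<^sup>2 = 2 * root 3 (1/6)"
  proof -
    have "3 * (root 3 (2/9))\<^sup>2 = 3 * root 3 (2/9)^3 * (3 * root 3 (1/6))"
      using c e by (simp add: field_simps power2_eq_square power3_eq_cube)
    then show ?thesis using a by simp
  qed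
  define x where "x = root 3 (2/9)"
  define y where "y = root 3 (1/6)"
  note xy = a(1)[folded x_def] d[folded x_def y_def] c[folded x_def y_def] e[folded x_def y_def]
  have [simp]: "alp = of_real x" "bet = of_real y" by (simp_all add: x_def y_def alp_def bet_def)
  show "alp^3 = 2/9" using arg_cong[OF xy(1), of complex_of_real] by simp
  show "3 * alp\<^sup>2 = 2 * bet" using arg_cong[OF xy(2), of complex_of_real] by simp
  show "3 * alp * bet = 1" using arg_cong[OF xy(3), of complex_of_real] by simp
  show "alp \<noteq> 0" "bet \<noteq> 0" using xy(4,5) by simp_all
qed

lemma inv_F_iso: "inv F_iso m = vector [m $ 1, - m $ 2 / alp, m $ 4 / bet, m $ 3]"
proof -
  have "F_iso (vector [m $ 1, - m $ 2 / alp, m $ 4 / bet, m $ 3]) = m" for m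
    using alp_bet by (simp add: F_iso_def vec_eq_iff forall_4 flip: alp_def bet_def)
  moreover have "vector [F_iso m $ 1, - F_iso m $ 2 / alp, F_iso m $ 4 / bet, F_iso m $ 3] = m" for m
    using alp_bet by (simp add: F_iso_def vec_eq_iff forall_4 flip: alp_def bet_def)
  ultimately show ?thesis
    by (metis (no_types, lifting) injI inv_f_f)
qed

text \<open>Computed column by column: a monomial is sent to the product of the images of its
  factors, and \<open>F_iso\<close> only permutes and rescales coordinates. The relations of
  \<open>alp_bet\<close> then turn the cube roots into the coefficients of
  \<open>gauge\<close>.\<close>

lemma S_rep_upper:
  assumes "r \<noteq> 0" "Y $ 1 $ 1 = r" "Y $ 1 $ 2 = y" "Y $ 2 $ 1 = 0" "Y $ 2 $ 2 = 1 / r"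
  shows "S_rep Y = gauge r (- y / alp)"
proof -
  have x: "Y *v axis 1 1 = vector [r, 0]" "Y *v axis 2 1 = vector [y, 1 / r]"
    using assms by (simp_all add: vec_eq_iff forall_2 matrix_vector_mult_def sum_2 axis_def)
  note a = alp_bet
  have b: "bet = 3/2 * alp\<^sup>2" using a by simp
  have E: "S_rep Y $ i $ j = F_iso (sym_power Y (inv F_iso (axis j 1))) $ i" for i j
    by (simp add: S_rep_def matrix_def)
  define M where "M = inv F_iso"
  have M: "M (axis 1 1) = vector [1, 0, 0, 0]" "M (axis 2 1) = vector [0, - 1 / alp, 0, 0]"
    "M (axis 3 1) = vector [0, 0, 0, 1]" "M (axis 4 1) = vector [0, 0, 1 / bet, 0]"
    unfolding M_def inv_F_iso by (simp_all add: axis_def vec_eq_iff forall_4)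
  have P: "sym_power Y m = m $ 1 *s sym_prod (vector [r, 0]) (vector [r, 0]) (vector [r, 0])
      + m $ 2 *s sym_prod (vector [r, 0]) (vector [r, 0]) (vector [y, 1 / r])
      + m $ 3 *s sym_prod (vector [r, 0]) (vector [y, 1 / r]) (vector [y, 1 / r])
      + m $ 4 *s sym_prod (vector [y, 1 / r]) (vector [y, 1 / r]) (vector [y, 1 / r])" for m
    unfolding sym_power_def Let_def x ..
  have FI: "F_iso m = vector [m $ 1, - alp * m $ 2, m $ 4, bet * m $ 3]" for m
    by (simp add: F_iso_def alp_def bet_def)
  note simps = E[folded M_def] M P FI sym_prod_def
  have 1: "S_rep Y $ 1 $ 1 = r^3" "S_rep Y $ 2 $ 1 = 0" "S_rep Y $ 3 $ 1 = 0" "S_rep Y $ 4 $ 1 = 0"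
    by (simp_all add: simps power3_eq_cube)
  have 2: "S_rep Y $ 1 $ 2 = r\<^sup>2 * (- y / alp)" "S_rep Y $ 2 $ 2 = r" "S_rep Y $ 3 $ 2 = 0" "S_rep Y $ 4 $ 2 = 0"
    using assms(1) a(4) by (simp_all add: simps power2_eq_square)
  have 3: "S_rep Y $ 1 $ 3 = y^3" "S_rep Y $ 2 $ 3 = - alp * 3 * y\<^sup>2 / r" "S_rep Y $ 3 $ 3 = 1 / r^3"
     "S_rep Y $ 4 $ 3 = bet * 3 * y / r\<^sup>2"
    by (simp_all add: simps power2_eq_square power3_eq_cube)
  have 4: "S_rep Y $ 1 $ 4 = r * y\<^sup>2 / bet" "S_rep Y $ 2 $ 4 = - alp * 2 * y / bet" "S_rep Y $ 3 $ 4 = 0"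
     "S_rep Y $ 4 $ 4 = 1 / r"
    using assms(1) a(4,5)
    by (simp_all add: simps power2_eq_square)
  define n where "n = - y / alp"
  have n: "y = - alp * n" using a(4) by (simp add: n_def)
  have h: "alp\<^sup>2 = 2/3 * bet" "bet * alp = 1/3" using a(2,3) by (simp_all add: field_simps)
  have 5: "- 2/9 * n^3 = y^3"
    by (simp add: n power_mult_distrib a(1))
  have 6: "2/3 * r * n\<^sup>2 = r * y\<^sup>2 / bet"
    using a(5) by (simp add: n power_mult_distrib h)
  have 7: "- 2/3 * n\<^sup>2 / r = - alp * 3 * y\<^sup>2 / r"
  proof -
    have "- alp * 3 * y\<^sup>2 / r = - 3 * alp^3 * n\<^sup>2 / r"
      by (simp add: n power2_eq_square power3_eq_cube)
    then show ?thesis by (simp add: a(1))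
  qed
  have 8: "4/3 * n = - alp * 2 * y / bet"
  proof -
    have "- alp * 2 * y / bet = 2 * n * (alp\<^sup>2 / bet)" by (simp add: n power2_eq_square)
    also have "\<dots> = 4/3 * n" using a(5) by (simp add: h)
    finally show ?thesis by simp
  qed
  have 9: "- n / r\<^sup>2 = bet * 3 * y / r\<^sup>2"
  proof -
    have "bet * 3 * y / r\<^sup>2 = - n * (3 * (bet * alp)) / r\<^sup>2" by (simp add: n)
    also have "\<dots> = - n / r\<^sup>2" by (simp only: h(2)) simp
    finally show ?thesis by simp
  qed
  show ?thesis
    unfolding n_def[symmetric]
    by (simp only: vec_eq_iff forall_4 gauge_def vector_4 1 2[folded n_def] 3 4 5 6 7 8 9 simp_thms)
qed

lemma SL2_1_gauge:
  assumes "Y \<in> SL2_1"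
  shows "Y $ 1 $ 1 \<noteq> 0" "S_rep Y = gauge (Y $ 1 $ 1) (- Y $ 1 $ 2 / alp)"
proof -
  have d: "Y $ 1 $ 1 * Y $ 2 $ 2 = 1" "Y $ 2 $ 1 = 0"
    using assms by (auto simp: SL2_1_def det_2)
  then show r: "Y $ 1 $ 1 \<noteq> 0" by auto
  have "Y $ 2 $ 2 = 1 / Y $ 1 $ 1" using d r by (simp add: nonzero_eq_divide_eq mult.commute)
  from S_rep_upper[OF r refl refl d(2) this]
  show "S_rep Y = gauge (Y $ 1 $ 1) (- Y $ 1 $ 2 / alp)" .
qed

lemma gauge_in_image:
  assumes "r \<noteq> 0"
  shows "\<exists>Y\<in>SL2_1. gauge r n = S_rep Y"
proof
  let ?Y = "vector [vector [r, - alp * n], vector [0, 1 / r]] :: complex^2^2"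
  show "?Y \<in> SL2_1" using assms by (simp add: SL2_1_def det_2)
  have "- (- alp * n) / alp = n"
    using assms alp_bet(4) by simp
  with S_rep_upper[of r ?Y "- alp * n"] assms show "gauge r n = S_rep ?Y"
    by simp
qed

section \<open>Entrywise derivatives of matrix-valued functions\<close>

definition has_mat_deriv :: "(complex \<Rightarrow> complex^'n^'m) \<Rightarrow> complex^'n^'m \<Rightarrow> complex \<Rightarrow> bool" where
  "has_mat_deriv A D t \<longleftrightarrow> (\<forall>i j. ((\<lambda>s. A s $ i $ j) has_field_derivative D $ i $ j) (at t))"

lemma has_mat_deriv_imp_eq: "has_mat_deriv A D t \<Longrightarrow> mat_deriv A t = D"
  by (simp add: has_mat_deriv_def mat_deriv_def vec_eq_iff DERIV_imp_deriv)

lemma has_mat_deriv_unique: "has_mat_deriv A D t \<Longrightarrow> has_mat_deriv A E t \<Longrightarrow> D = E"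
  using has_mat_deriv_imp_eq by blast

lemma has_mat_deriv_holomorphic:
  assumes "\<And>i j. (\<lambda>s. A s $ i $ j) holomorphic_on V" "open V" "t \<in> V"
  shows "has_mat_deriv A (mat_deriv A t) t"
  using assms by (auto simp: has_mat_deriv_def mat_deriv_def intro!: holomorphic_derivI)

lemma has_mat_deriv_const: "has_mat_deriv (\<lambda>_. A) 0 t"
  by (simp add: has_mat_deriv_def)

lemma has_mat_deriv_mult:
  assumes "has_mat_deriv A D t" "has_mat_deriv B E t"
  shows "has_mat_deriv (\<lambda>s. A s ** B s) (D ** B t + A t ** E) t"
  using assms unfolding has_mat_deriv_def matrix_matrix_mult_def
  by (auto intro!: derivative_eq_intros simp: sum.distrib mult_ac)

lemma has_mat_deriv_cmult:
  assumes "has_mat_deriv A D t"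
  shows "has_mat_deriv (\<lambda>s. C ** A s) (C ** D) t"
  using has_mat_deriv_mult[OF has_mat_deriv_const assms, of C] by simp

lemma has_mat_deriv_transpose: "has_mat_deriv A D t \<Longrightarrow> has_mat_deriv (\<lambda>s. transpose (A s)) (transpose D) t"
  by (simp add: has_mat_deriv_def transpose_def)

lemma has_mat_deriv_sp_inv: "has_mat_deriv A D t \<Longrightarrow> has_mat_deriv (\<lambda>s. sp_inv (A s)) (sp_inv D) t"
  unfolding sp_inv_def
  using has_mat_deriv_mult[OF has_mat_deriv_cmult[OF has_mat_deriv_transpose] has_mat_deriv_const] by fastforce

lemma has_mat_deriv_chain:
  assumes "has_mat_deriv A D (g t)" "(g has_field_derivative g') (at t)"
  shows "has_mat_deriv (\<lambda>s. A (g s)) (\<chi> i j. g' * D $ i $ j) t"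
  unfolding has_mat_deriv_def
proof (intro allI)
  fix i j
  show "((\<lambda>s. A (g s) $ i $ j) has_field_derivative (\<chi> i j. g' * D $ i $ j) $ i $ j) (at t)"
    using DERIV_chain2[of "\<lambda>s. A s $ i $ j" "D $ i $ j" g t g' UNIV] assms
    by (simp add: has_mat_deriv_def mult.commute)
qed

lemma has_mat_deriv_cong:
  assumes "\<And>s. s \<in> V \<Longrightarrow> A s = B s" "open V" "t \<in> V"
  shows "has_mat_deriv A D t \<longleftrightarrow> has_mat_deriv B D t"
proof -
  have "\<forall>\<^sub>F s in nhds t. A s = B s"
    using assms eventually_nhds by blast
  then show ?thesis unfolding has_mat_deriv_def
    by (intro all_cong1 DERIV_cong_ev) (auto elim: eventually_mono)
qed

lemma nf_scale: "(\<chi> i j. a * nf p q s t $ i $ j) = nf (a * p) (a * q) (a * s) (a * t)"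
  by (simp add: nf_def vec_eq_iff forall_4)

lemma scale_mult: "(\<chi> i j. a * (A ** B) $ i $ j) = A ** (\<chi> i j. a * B $ i $ j)" for a :: complex
  by (simp add: matrix_matrix_mult_def vec_eq_iff sum_distrib_left mult_ac)

lemma nf_inject: "nf p q s t = nf p' q' s' t' \<longleftrightarrow> p = p' \<and> q = q' \<and> s = s' \<and> t = t'"
  by (auto simp: nf_def vec_eq_iff forall_4)

definition gauge_deriv :: "complex \<Rightarrow> complex \<Rightarrow> complex \<Rightarrow> complex \<Rightarrow> complex^4^4" where
  "gauge_deriv r n r' n' = vector
     [vector [3 * r\<^sup>2 * r', r\<^sup>2 * n' + 2 * r * r' * n, - 2/3 * n\<^sup>2 * n', 2/3 * (r' * n\<^sup>2 + 2 * r * n * n')],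
      vector [0, r', - 4/3 * n * n' / r + 2/3 * n\<^sup>2 * r' / r\<^sup>2, 4/3 * n'],
      vector [0, 0, - 3 * r' / r^4, 0],
      vector [0, 0, - n' / r\<^sup>2 + 2 * n * r' / r^3, - r' / r\<^sup>2]]"

lemma has_mat_deriv_gauge:
  assumes "(r has_field_derivative r') (at t)" "(n has_field_derivative n') (at t)" "r t \<noteq> 0"
  shows "has_mat_deriv (\<lambda>s. gauge (r s) (n s)) (gauge_deriv (r t) (n t) r' n') t"
  unfolding has_mat_deriv_def forall_4 gauge_def gauge_deriv_def vector_4
  using assms
  apply (intro conjI)
  apply (auto intro!: derivative_eq_intros)
  apply (auto simp: divide_simps)
  apply (auto simp: algebra_simps eval_nat_numeral)
  done

text \<open>The transformation rule of a Maurer-Cartan form under a change of frame by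
  \<open>K = gauge r n\<close>, multiplied by \<open>K\<close> so that no inverse occurs. The new
  coefficients can be read off: \<open>r\<close> and \<open>n\<close> offer two free functions for
  changing \<open>p\<close> and \<open>s\<close>, while \<open>q\<close> and \<open>t\<close> are
  only rescaled.\<close>

lemma gauge_eq:
  assumes "r \<noteq> 0" and "u * r = 1"
  shows "gauge r n ** nf (p + r' * u - r * n * q / 3) (r\<^sup>2 * q)
     (4/3 * n * u * (2 * p + r' * u - r * n * q / 3) + s * u\<^sup>2 + 4/3 * n' * u) (t * u^6)
   = nf p q s t ** gauge r n + gauge_deriv r n r' n'"
proof -
  \<comment> \<open>With \<open>u\<close> in place of \<open>1 / r\<close>, every entry is a
    polynomial identity modulo \<open>u * r = 1\<close>.\<close>
  have u: "1 / r = u" "\<And>x. x / r = x * u" "\<And>x. x / r\<^sup>2 = x * u\<^sup>2" "\<And>x. x / r^3 = x * u^3" "\<And>x. x / r^4 = x * u^4"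
    using assms by (simp_all add: field_simps eval_nat_numeral)
  show ?thesis
    unfolding vec_eq_iff forall_4 matrix_matrix_mult_def sum_4 gauge_def gauge_deriv_def nf_def vector_4 u
      plus_vec_def vec_lambda_beta
    using assms(2)
    apply (intro conjI)
    apply ((simp; fail) | algebra)+
    done
qed

section \<open>Second order linear equations\<close>

text \<open>Comparing coefficients gives a recursion whose right-hand side is a convolution divided
  by \<open>(n + 2) * (n + 1)\<close>. With geometric bounds on \<open>a\<close> and
  \<open>b\<close> the convolution has \<open>n + 1\<close> terms, each with a factor at most linear
  in \<open>n\<close>; the divisor absorbs both, so the solution again grows at most
  geometrically.\<close>

lemma ode2_fps:
  fixes a b :: "complex fps"
  assumes "fps_conv_radius a > 0" "fps_conv_radius b > 0"
  shows "\<exists>y. fps_conv_radius y > 0 \<and> fps_nth y 0 = 1 \<and> fps_deriv (fps_deriv y) = a * fps_deriv y + b * y"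
proof -
  have bound: "\<exists>C>0. \<forall>n. norm (fps_nth c n) \<le> C ^ Suc n" if pos: "fps_conv_radius c > 0" for c :: "complex fps"
  proof -
    obtain r where r: "0 < ereal r" "ereal r < fps_conv_radius c"
      using ereal_dense2[OF pos] by (auto simp: zero_ereal_def)
    then have r0: "r > 0" by simp
    have "summable (\<lambda>n. norm (fps_nth c n * of_real r ^ n))"
      using norm_summable_fps[of "of_real r" c] r r0 by simp
    then have "bounded (range (\<lambda>n. norm (fps_nth c n * of_real r ^ n)))"
      using summable_imp_bounded by blast
    then obtain B where "\<forall>n. norm (norm (fps_nth c n * of_real r ^ n)) \<le> B"
      by (auto simp: bounded_iff)
    then have B: "norm (fps_nth c n) * r ^ n \<le> B" for n
      using r0 by (simp add: norm_mult norm_power)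
    define C where "C = max (max B (1 / r)) 1"
    have C: "C \<ge> B" "C \<ge> 1 / r" "C \<ge> 1" by (auto simp: C_def)
    have "norm (fps_nth c n) \<le> C ^ Suc n" for n
    proof -
      have "norm (fps_nth c n) \<le> B * (1 / r) ^ n"
        using B[of n] r0 by (simp add: field_simps)
      also have "\<dots> \<le> C * C ^ n"
        using C r0 by (intro mult_mono power_mono) auto
      finally show ?thesis by simp
    qed
    then show ?thesis using C by (intro exI[of _ C]) auto
  qed
  obtain C where C: "C > 0" "\<And>n. norm (fps_nth a n) \<le> C ^ Suc n" using bound[OF assms(1)] by blast
  obtain D where D: "D > 0" "\<And>n. norm (fps_nth b n) \<le> D ^ Suc n" using bound[OF assms(2)] by blast
  define K where "K = 2 * max (max C D) 1"
  have K1: "K \<ge> 2" "C \<le> K / 2" "D \<le> K / 2" by (auto simp: K_def)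
  have half: "(K / 2) ^ Suc n \<le> K ^ Suc n / 2" for n
    using K1 by (simp add: power_divide field_simps mult_mono)
  have KA: "norm (fps_nth a n) \<le> K ^ Suc n / 2" for n
    using C(2)[of n] power_mono[of C "K/2" "Suc n"] half[of n] C(1) K1 by linarith
  \<comment> \<open>One more power of \<open>K\<close> than for \<open>a\<close>, because in the
    recursion \<open>b\<close> meets a coefficient of \<open>y\<close> whose index is lower by
    one.\<close>
  have KB: "norm (fps_nth b n) \<le> K ^ Suc (Suc n) / 2" for n
  proof -
    have "norm (fps_nth b n) \<le> K ^ Suc n / 2"
      using D(2)[of n] power_mono[of D "K/2" "Suc n"] half[of n] D(1) K1 by linarith
    also have "\<dots> \<le> K ^ Suc (Suc n) / 2"
      using K1 by (intro divide_right_mono power_increasing) auto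
    finally show ?thesis .
  qed
  define step where "step = (\<lambda>n (f :: nat \<Rightarrow> complex).
     (\<Sum>k=0..n. fps_nth a k * (of_nat (n - k + 1) * f (n - k + 1)) + fps_nth b k * f (n - k)) / (of_nat (n + 2) * of_nat (n + 1)))"
  \<comment> \<open>The recursion uses all earlier values, hence the well-founded recursor. The
    initial value \<open>1\<close> keeps the solution away from zero near the centre.\<close>
  define c where "c = wfrec less_than (\<lambda>f n. if n = 0 then 1 else if n = 1 then 0 else step (n - 2) f)"
  have c: "c n = (if n = 0 then 1 else if n = 1 then 0 else step (n - 2) c)" for n
  proof -
    have "c n = (if n = 0 then 1 else if n = 1 then 0 else step (n - 2) (cut c less_than n))"
      unfolding c_def by (subst wfrec) (auto simp: c_def)
    also have "n \<ge> 2 \<Longrightarrow> step (n - 2) (cut c less_than n) = step (n - 2) c"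
      unfolding step_def by (intro arg_cong2[where f = "(/)"] sum.cong refl) (auto simp: cut_def)
    then have "(if n = 0 then 1 else if n = 1 then 0 else step (n - 2) (cut c less_than n)) =
      (if n = 0 then 1 else if n = 1 then 0 else step (n - 2) c)" by auto
    finally show ?thesis .
  qed
  \<comment> \<open>The bounds on \<open>a\<close> and \<open>b\<close> are chosen such that \<open>K\<^sup>n\<close> is a majorant of the recursion.\<close>
  have cb: "norm (c n) \<le> K ^ n" for n
  proof (induction n rule: less_induct)
    case (less n)
    consider "n = 0" | "n = 1" | m where "n = m + 2"
      by (metis One_nat_def add_2_eq_Suc' not0_implies_Suc)
    then show ?case
    proof cases
      case 3
      have trm: "norm (fps_nth a k * (of_nat (m - k + 1) * c (m - k + 1)) + fps_nth b k * c (m - k))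
          \<le> K ^ n * (real (m - k) + 2) / 2" if "k \<le> m" for k
      proof -
        have cc: "norm (c (m - k + 1)) \<le> K ^ (m - k + 1)" "norm (c (m - k)) \<le> K ^ (m - k)"
          by (rule less.IH; use 3 in simp)+
        have 1: "norm (fps_nth a k * (of_nat (m - k + 1) * c (m - k + 1))) \<le> K ^ Suc k / 2 * (real (m - k + 1) * K ^ (m - k + 1))"
          unfolding norm_mult norm_of_nat using cc KA[of k] K1
          by (intro mult_mono) auto
        have 2: "norm (fps_nth b k * c (m - k)) \<le> K ^ Suc (Suc k) / 2 * K ^ (m - k)"
          unfolding norm_mult norm_of_nat using cc KB[of k] K1
          by (intro mult_mono) auto
        have e1: "K ^ Suc k * K ^ (m - k + 1) = K ^ n" using that 3
          by (subst power_add[symmetric]) (auto intro!: arg_cong[where f = "\<lambda>i. K ^ i"])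
        have e2: "K ^ Suc (Suc k) * K ^ (m - k) = K ^ n" using that 3
          by (subst power_add[symmetric]) (auto intro!: arg_cong[where f = "\<lambda>i. K ^ i"])
        have "norm (fps_nth a k * (of_nat (m - k + 1) * c (m - k + 1)) + fps_nth b k * c (m - k))
           \<le> K ^ Suc k / 2 * (real (m - k + 1) * K ^ (m - k + 1)) + K ^ Suc (Suc k) / 2 * K ^ (m - k)"
          using norm_triangle_mono[OF 1 2] .
        also have "\<dots> = (K ^ Suc k * K ^ (m - k + 1)) * real (m - k + 1) / 2 + (K ^ Suc (Suc k) * K ^ (m - k)) / 2"
          by (simp only: mult_ac times_divide_eq_left times_divide_eq_right)
        also have "\<dots> = K ^ n * real (m - k + 1) / 2 + K ^ n / 2" by (simp only: e1 e2)
        also have "\<dots> = K ^ n * (real (m - k) + 2) / 2"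
          by (simp add: algebra_simps add_divide_distrib)
        finally show ?thesis .
      qed
      have "norm (\<Sum>k=0..m. fps_nth a k * (of_nat (m - k + 1) * c (m - k + 1)) + fps_nth b k * c (m - k))
          \<le> (\<Sum>k=0..m. K ^ n * (real (m - k) + 2) / 2)"
        using trm by (intro sum_norm_le) auto
      also have "\<dots> \<le> (\<Sum>k=0..m. K ^ n * (real m + 2) / 2)"
        using K1 by (intro sum_mono divide_right_mono mult_left_mono) auto
      also have "\<dots> = K ^ n * ((real m + 1) * (real m + 2) / 2)"
        by simp
      also have "\<dots> \<le> K ^ n * ((real m + 1) * (real m + 2))"
        using K1 by (intro mult_left_mono) auto
      finally have *: "norm (\<Sum>k=0..m. fps_nth a k * (of_nat (m - k + 1) * c (m - k + 1)) + fps_nth b k * c (m - k))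
          \<le> K ^ n * (real (m + 2) * real (m + 1))" by (simp add: algebra_simps)
      have "c n = step m c" using c[of n] 3 by simp
      then have "norm (c n) = norm (\<Sum>k=0..m. fps_nth a k * (of_nat (m - k + 1) * c (m - k + 1)) + fps_nth b k * c (m - k))
          / (real (m + 2) * real (m + 1))"
        unfolding step_def by (simp only: norm_divide norm_mult norm_of_nat)
      also have "\<dots> \<le> K ^ n"
        using * by (subst pos_divide_le_eq) auto
      finally show ?thesis .
    qed (use K1 c[of n] in auto)
  qed
  define y where "y = Abs_fps c"
  have rad: "fps_conv_radius y > 0"
  proof -
    have "summable (\<lambda>n. c n * complex_of_real (1 / (2 * K)) ^ n)"
    proof (rule summable_comparison_test)
      show "summable (\<lambda>n. (1/2::real) ^ n)" by (rule summable_geometric) simp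
      have "norm (c n * complex_of_real (1 / (2 * K)) ^ n) \<le> (1/2) ^ n" for n
      proof -
        have "norm (complex_of_real (1 / (2 * K))) = 1 / (2 * K)" using K1 by (simp add: norm_divide)
        then have "norm (c n * complex_of_real (1 / (2 * K)) ^ n) \<le> K ^ n * (1 / (2 * K)) ^ n"
          unfolding norm_mult norm_power using cb[of n] K1 by (simp add: mult_right_mono)
        also have "\<dots> = (1/2) ^ n"
          unfolding power_mult_distrib[symmetric] using K1 by simp
        finally show ?thesis .
      qed
      then show "\<exists>N. \<forall>n\<ge>N. norm (c n * complex_of_real (1 / (2 * K)) ^ n) \<le> (1/2) ^ n" by blast
    qed
    from conv_radius_geI[OF this] have "conv_radius c \<ge> ereal (1 / (2 * K))"
      using K1 by (simp add: norm_divide)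
    moreover have "ereal (1 / (2 * K)) > 0" using K1 by simp
    ultimately show ?thesis
      unfolding y_def fps_conv_radius_def fps_nth_Abs_fps by (rule order_less_le_trans[rotated])
  qed
  have "fps_deriv (fps_deriv y) = a * fps_deriv y + b * y"
  proof (rule fps_ext)
    fix n
    have "c (n + 2) = step n c" using c[of "n + 2"] by simp
    then have "of_nat (n + 2) * of_nat (n + 1) * c (n + 2) =
        (\<Sum>k=0..n. fps_nth a k * (of_nat (n - k + 1) * c (n - k + 1)) + fps_nth b k * c (n - k))"
      unfolding step_def by (simp del: of_nat_add of_nat_Suc)
    then show "fps_nth (fps_deriv (fps_deriv y)) n = fps_nth (a * fps_deriv y + b * y) n"
      by (simp add: y_def fps_mult_nth sum.distrib mult_ac del: of_nat_Suc)
  qed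
  moreover have "fps_nth y 0 = 1" using c[of 0] by (simp add: y_def)
  ultimately show ?thesis using rad by blast
qed

lemma ode2_solution:
  fixes a b :: "complex \<Rightarrow> complex"
  assumes "a analytic_on {z0}" "b analytic_on {z0}"
  obtains \<rho> y y1 where "\<rho> > 0" "y z0 = 1"
    "\<And>z. z \<in> ball z0 \<rho> \<Longrightarrow> (y has_field_derivative y1 z) (at z)"
    "\<And>z. z \<in> ball z0 \<rho> \<Longrightarrow> (y1 has_field_derivative a z * y1 z + b z * y z) (at z)"
proof -
  define A where "A = fps_expansion a z0"
  define B where "B = fps_expansion b z0"
  have hA: "(\<lambda>x. a (z0 + x)) has_fps_expansion A" and hB: "(\<lambda>x. b (z0 + x)) has_fps_expansion B"
    using assms by (auto simp: A_def B_def intro: analytic_at_imp_has_fps_expansion)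
  obtain Y where Y: "fps_conv_radius Y > 0" "fps_nth Y 0 = 1"
      "fps_deriv (fps_deriv Y) = A * fps_deriv Y + B * Y"
    using ode2_fps[of A B] hA hB by (auto simp: has_fps_expansion_def)
  have evA: "\<forall>\<^sub>F x in nhds 0. eval_fps A x = a (z0 + x)" and evB: "\<forall>\<^sub>F x in nhds 0. eval_fps B x = b (z0 + x)"
    using hA hB by (auto simp: has_fps_expansion_def)
  have hY: "eval_fps Y has_fps_expansion Y" using Y(1) by (simp add: eval_fps_has_fps_expansion)
  have r: "fps_conv_radius A > 0" "fps_conv_radius B > 0"
    using hA hB by (auto simp: has_fps_expansion_def)
  define R where "R = Min {fps_conv_radius A, fps_conv_radius B, fps_conv_radius Y}"
  have R: "R > 0" "R \<le> fps_conv_radius A" "R \<le> fps_conv_radius B" "R \<le> fps_conv_radius Y"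
    using r Y(1) by (auto simp: R_def min.coboundedI2)
  obtain \<rho>1 where \<rho>1: "\<rho>1 > 0" "\<And>x. norm x < \<rho>1 \<Longrightarrow> eval_fps A x = a (z0 + x) \<and> eval_fps B x = b (z0 + x)"
    using eventually_conj[OF evA evB] unfolding eventually_nhds_metric by (auto simp: dist_norm)
  obtain \<rho>2 where \<rho>2: "0 < ereal \<rho>2" "ereal \<rho>2 < R" using ereal_dense2[OF R(1)] by (auto simp: zero_ereal_def)
  define \<rho> where "\<rho> = min \<rho>1 \<rho>2"
  have \<rho>: "\<rho> > 0" using \<rho>1 \<rho>2 by (auto simp: \<rho>_def)
  have inr: "ereal (norm x) < R" if "norm x < \<rho>" for x :: complex
    using that \<rho>2 by (metis \<rho>_def ereal_less(1) less_trans min_less_iff_conj less_ereal.simps(1))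
  define y where "y = (\<lambda>z. eval_fps Y (z - z0))"
  define y1 where "y1 = (\<lambda>z. eval_fps (fps_deriv Y) (z - z0))"
  show ?thesis
  proof (rule that[of \<rho> y y1])
    show "y z0 = 1" by (simp add: y_def eval_fps_at_0 Y)
  next
    fix z assume z: "z \<in> ball z0 \<rho>"
    then have n: "norm (z - z0) < \<rho>" by (simp add: dist_norm norm_minus_commute)
    have rd: "R \<le> fps_conv_radius (fps_deriv Y)"
      using R(4) fps_conv_radius_deriv[of Y] order_trans by blast
    have i: "ereal (norm (z - z0)) < R" using inr n .
    have sh: "((\<lambda>z. z - z0) has_field_derivative 1) (at z)" by (auto intro!: derivative_eq_intros)
    show "(y has_field_derivative y1 z) (at z)"
      unfolding y_def y1_def
      using DERIV_chain2[OF has_field_derivative_eval_fps[of "z - z0" Y UNIV] sh] i R(4)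
      by (simp add: order_less_le_trans)
    have "(y1 has_field_derivative eval_fps (fps_deriv (fps_deriv Y)) (z - z0)) (at z)"
      unfolding y1_def
      using DERIV_chain2[OF has_field_derivative_eval_fps[of "z - z0" "fps_deriv Y" UNIV] sh] i rd
      by (simp add: order_less_le_trans)
    also have "eval_fps (fps_deriv (fps_deriv Y)) (z - z0) = a z * y1 z + b z * y z"
    proof -
      have l: "ereal (norm (z - z0)) < fps_conv_radius A" "ereal (norm (z - z0)) < fps_conv_radius B"
         "ereal (norm (z - z0)) < fps_conv_radius Y" "ereal (norm (z - z0)) < fps_conv_radius (fps_deriv Y)"
        using i R rd order_less_le_trans by blast+
      have l2: "ereal (norm (z - z0)) < fps_conv_radius (A * fps_deriv Y)" "ereal (norm (z - z0)) < fps_conv_radius (B * Y)"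
        using l by (meson fps_conv_radius_mult min_less_iff_conj order_less_le_trans)+
      have "eval_fps A (z - z0) = a z" "eval_fps B (z - z0) = b z"
        using \<rho>1(2)[of "z - z0"] n by (auto simp: \<rho>_def)
      then show ?thesis
        using l l2 by (simp add: Y(3) eval_fps_add eval_fps_mult y_def y1_def)
    qed
    finally show "(y1 has_field_derivative a z * y1 z + b z * y z) (at z)" .
  qed (use \<rho> in auto)
qed

section \<open>Gauge transformations of the normal form\<close>

lemma sp_entries:
  assumes "K \<in> Sp4"
  shows "K$1$i * K$3$j + K$2$i * K$4$j - K$3$i * K$1$j - K$4$i * K$2$j = J_mat $ i $ j"
proof -
  have "omega (column i K) (column j K) = J_mat $ i $ j"
    using assms by (simp only: omega_eq_entry Sp4_iff)
  then show ?thesis by (simp add: omega_def column_def algebra_simps)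
qed

text \<open>\<open>K\<close> is the transition between two frames of one curve in normal form, and
  it must come from the upper triangular group. The entries of the gauge equation and the symplectic
  relations are solved in an order in which each unknown entry of \<open>K\<close> has a nonzero
  factor, mostly \<open>q\<close> times a power of \<open>r\<close>. The coefficients of the second
  frame are not known in advance: \<open>Q\<close> is determined on the way, \<open>P\<close> and
  \<open>S\<close> are eliminated.\<close>

lemma gauge_unique:
  fixes K :: "complex \<Rightarrow> complex^4^4"
  assumes V: "open V"
    and sp: "\<And>x. x \<in> V \<Longrightarrow> K x \<in> Sp4"
    and block: "\<And>x i j. x \<in> V \<Longrightarrow> i \<in> {3,4} \<Longrightarrow> j \<in> {1,2} \<Longrightarrow> K x $ i $ j = 0"
    and der: "\<And>x. x \<in> V \<Longrightarrow> has_mat_deriv K (D x) x"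
    and eq: "\<And>x. x \<in> V \<Longrightarrow> K x ** nf (P x) (Q x) (S x) (T x) = nf (p x) (q x) (s x) (t x) ** K x + D x"
    and nz: "\<And>x. x \<in> V \<Longrightarrow> q x \<noteq> 0"
  shows "\<forall>x\<in>V. \<exists>r n. r \<noteq> 0 \<and> K x = gauge r n"
proof -
  have d: "((\<lambda>x. K x $ i $ j) has_field_derivative D x $ i $ j) (at x)" if "x \<in> V" for i j x
    using der[OF that] by (simp add: has_mat_deriv_def)
  \<comment> \<open>An entry known on all of the open set \<open>V\<close> can be differentiated,
    which supplies the matching entry of \<open>D\<close> for later equations.\<close>
  have uniq: "D x $ i $ j = e" if "x \<in> V" "\<And>y. y \<in> V \<Longrightarrow> K y $ i $ j = g y" "(g has_field_derivative e) (at x)"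
    for g i j x e
  proof -
    have "(g has_field_derivative D x $ i $ j) (at x)"
      using has_field_derivative_transform_within_open[OF d[OF that(1)] V that(1)] that(2) by blast
    then show ?thesis using that(3) DERIV_unique by blast
  qed
  have zero: "D x $ i $ j = 0" if "x \<in> V" "\<And>y. y \<in> V \<Longrightarrow> K y $ i $ j = 0" for i j x
    using uniq[OF that] by simp
  have ent: "(\<Sum>l\<in>UNIV. K x $ i $ l * nf (P x) (Q x) (S x) (T x) $ l $ j) =
      (\<Sum>l\<in>UNIV. nf (p x) (q x) (s x) (t x) $ i $ l * K x $ l $ j) + D x $ i $ j" if "x \<in> V" for x i j
    using arg_cong[OF eq[OF that], of "\<lambda>M. M $ i $ j"] by (simp add: matrix_matrix_mult_def)
  note ent = ent[unfolded sum_4]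
  define r where "r = (\<lambda>x. K x $ 2 $ 2)"
  define n where "n = (\<lambda>x. K x $ 1 $ 2 / (r x)\<^sup>2)"
  have b: "K x $ 3 $ 1 = 0" "K x $ 3 $ 2 = 0" "K x $ 4 $ 1 = 0" "K x $ 4 $ 2 = 0" if "x \<in> V" for x
    using block[OF that] by auto
  \<comment> \<open>Entry \<open>(4, 1)\<close> of the gauge equation reads
    \<open>q * K21 = 0\<close>.\<close>
  have s1: "K x $ 2 $ 1 = 0" if "x \<in> V" for x
    using ent[of x 4 1] zero[of x 4 1] b that nz[OF that] by (auto simp: nf_def)
  have s2: "K x $ 1 $ 1 * K x $ 3 $ 3 = 1" "K x $ 2 $ 2 * K x $ 4 $ 4 = 1" "K x $ 3 $ 4 = 0"
    "K x $ 1 $ 2 * K x $ 3 $ 3 + K x $ 2 $ 2 * K x $ 4 $ 3 = 0"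
    "K x $ 1 $ 3 * K x $ 3 $ 4 + K x $ 2 $ 3 * K x $ 4 $ 4 - K x $ 3 $ 3 * K x $ 1 $ 4 - K x $ 4 $ 3 * K x $ 2 $ 4 = 0"
    if "x \<in> V" for x
  proof -
    note e = sp_entries[OF sp[OF that]]
    show 1: "K x $ 1 $ 1 * K x $ 3 $ 3 = 1" using e[of 1 3] b[OF that] s1[OF that] by (simp add: J_mat_def)
    show "K x $ 3 $ 4 = 0" using e[of 1 4] b[OF that] s1[OF that] 1 by (auto simp: J_mat_def)
    then show "K x $ 2 $ 2 * K x $ 4 $ 4 = 1" using e[of 2 4] b[OF that] s1[OF that] 1 by (auto simp: J_mat_def)
    show "K x $ 1 $ 2 * K x $ 3 $ 3 + K x $ 2 $ 2 * K x $ 4 $ 3 = 0"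
      using e[of 2 3] b[OF that] s1[OF that] by (auto simp: J_mat_def)
    show "K x $ 1 $ 3 * K x $ 3 $ 4 + K x $ 2 $ 3 * K x $ 4 $ 4 - K x $ 3 $ 3 * K x $ 1 $ 4 - K x $ 4 $ 3 * K x $ 2 $ 4 = 0"
      using e[of 3 4] by (simp add: J_mat_def)
  qed
  have k22: "K x $ 2 $ 2 = r x" for x by (simp add: r_def)
  have r0: "r x \<noteq> 0" if "x \<in> V" for x using s2(2)[OF that] by (auto simp: r_def)
  have k12: "K x $ 1 $ 2 = (r x)\<^sup>2 * n x" if "x \<in> V" for x using r0[OF that] by (simp add: n_def)
  have k44: "K x $ 4 $ 4 = 1 / r x" if "x \<in> V" for x
    using s2(2)[OF that] r0[OF that] by (simp add: r_def field_simps)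
  have Q: "Q x = (r x)\<^sup>2 * q x" if "x \<in> V" for x
    using ent[of x 4 2] zero[of x 4 2] b that r0[OF that]
    by (simp add: nf_def k44 s2 k22 field_simps power2_eq_square)
  have k11: "K x $ 1 $ 1 = (r x)^3" if "x \<in> V" for x
    using ent[of x 2 1] zero[of x 2 1] b that s1 nz[OF that]
    by (simp add: nf_def Q k22 power2_eq_square power3_eq_cube mult_ac)
  have k33: "K x $ 3 $ 3 = 1 / (r x)^3" if "x \<in> V" for x
    using s2(1)[OF that] r0[OF that] by (simp add: k11 that field_simps)
  have k43: "K x $ 4 $ 3 = - n x / (r x)\<^sup>2" if "x \<in> V" for x
  proof -
    have "(r x)\<^sup>2 * (n x + (r x)\<^sup>2 * K x $ 4 $ 3) = (r x)^3 * (K x $ 1 $ 2 * K x $ 3 $ 3 + K x $ 2 $ 2 * K x $ 4 $ 3)"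
      using r0[OF that] by (simp add: k12 k33 that k22 field_simps eval_nat_numeral)
    then have "n x + (r x)\<^sup>2 * K x $ 4 $ 3 = 0"
      using s2(4)[OF that] r0[OF that] by simp
    then have "(r x)\<^sup>2 * K x $ 4 $ 3 = - n x" by (simp add: add_eq_0_iff)
    then show ?thesis using r0[OF that] by (simp add: field_simps)
  qed
  define r' where "r' = (\<lambda>x. D x $ 2 $ 2)"
  have D22: "D x $ 2 $ 2 = r' x" for x by (simp add: r'_def)
  define n' where "n' = (\<lambda>x. (D x $ 1 $ 2 * (r x)\<^sup>2 - K x $ 1 $ 2 * (2 * r x * r' x)) / (r x)^4)"
  have dr: "(r has_field_derivative r' x) (at x)" if "x \<in> V" for x
    using d[OF that, of 2 2] by (simp add: r_def r'_def)
  have dn: "(n has_field_derivative n' x) (at x)" if "x \<in> V" for x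
    unfolding n_def n'_def using r0[OF that]
    by (auto intro!: derivative_eq_intros d[OF that] dr[OF that] simp: eval_nat_numeral mult_ac)
  have D11: "D x $ 1 $ 1 = 3 * (r x)\<^sup>2 * r' x" if "x \<in> V" for x
    using that k11 dr[OF that] by (intro uniq[OF that k11]) (auto intro!: derivative_eq_intros)
  have D12: "D x $ 1 $ 2 = (r x)\<^sup>2 * n' x + 2 * r x * r' x * n x" if "x \<in> V" for x
    using that dr[OF that] dn[OF that] by (intro uniq[OF that k12]) (auto intro!: derivative_eq_intros)
  have e11: "3 * r x * P x + (r x)\<^sup>2 * n x * q x = 3 * p x * r x + 3 * r' x" if "x \<in> V" for x
  proof -
    have "(r x)\<^sup>2 * (3 * r x * P x + (r x)\<^sup>2 * n x * q x) = (r x)\<^sup>2 * (3 * p x * r x + 3 * r' x)"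
      using ent[of x 1 1] that b[OF that] s1[OF that] D11[OF that] k11[OF that] k12[OF that] Q[OF that]
      by (simp add: nf_def) algebra
    then show ?thesis using r0[OF that] by simp
  qed
  \<comment> \<open>The diagonal entries \<open>(1, 1)\<close> and \<open>(2, 2)\<close> both
    contain \<open>P\<close>, \<open>p\<close> and \<open>r'\<close> in the same proportion;
    eliminating these leaves only \<open>3 * K24 - 4 * n\<close> with a nonzero factor.\<close>
  have k24: "K x $ 2 $ 4 = 4/3 * n x" if "x \<in> V" for x
  proof -
    have e22: "r x * P x + K x $ 2 $ 4 * ((r x)\<^sup>2 * q x) = q x * ((r x)\<^sup>2 * n x) + p x * r x + r' x"
      using ent[of x 2 2] that b[OF that] s1[OF that] k12[OF that] Q[OF that]
      by (simp add: nf_def k22 D22)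
    have "(r x)\<^sup>2 * q x * (3 * K x $ 2 $ 4 - 4 * n x) = 0"
      using e22 e11[OF that] by algebra
    then have "3 * K x $ 2 $ 4 - 4 * n x = 0" using r0[OF that] nz[OF that] by simp
    then show ?thesis by (simp add: field_simps)
  qed
  have D24: "D x $ 2 $ 4 = 4/3 * n' x" if "x \<in> V" for x
    using that dr[OF that] dn[OF that] by (intro uniq[OF that k24]) (auto intro!: derivative_eq_intros)
  have k23a: "K x $ 2 $ 3 = K x $ 1 $ 4 / (r x)\<^sup>2 - 4/3 * (n x)\<^sup>2 / r x" if "x \<in> V" for x
  proof -
    have "(r x)^3 * (K x $ 1 $ 3 * K x $ 3 $ 4 + K x $ 2 $ 3 * K x $ 4 $ 4 - K x $ 3 $ 3 * K x $ 1 $ 4 - K x $ 4 $ 3 * K x $ 2 $ 4)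
      = (r x)\<^sup>2 * K x $ 2 $ 3 - K x $ 1 $ 4 + 4/3 * (n x)\<^sup>2 * r x"
      using r0[OF that] by (simp add: s2(3) k44 k33 k43 k24 that field_simps eval_nat_numeral)
    then have "0 = (r x)\<^sup>2 * K x $ 2 $ 3 - K x $ 1 $ 4 + 4/3 * (n x)\<^sup>2 * r x"
      by (simp only: s2(5)[OF that] mult_zero_right)
    then have "(r x)\<^sup>2 * K x $ 2 $ 3 = K x $ 1 $ 4 - 4/3 * (n x)\<^sup>2 * r x"
      by (simp add: algebra_simps)
    then show ?thesis using r0[OF that] by (simp add: field_simps power2_eq_square)
  qed
  have e24: "4 * (r x * S x) - 4 * K x $ 2 $ 3 * ((r x)\<^sup>2 * q x) = 4 * q x * K x $ 1 $ 4 + 16/3 * (P x + p x) * n x + 4 * s x / r x + 16/3 * n' x"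
    if "x \<in> V" for x
    using ent[of x 2 4] that b[OF that] s1[OF that] Q[OF that]
    by (simp add: nf_def k44 k24 s2(3) D24 k22 D22 algebra_simps)
  \<comment> \<open>\<open>S\<close>, \<open>s\<close> and \<open>n'\<close> occur in the entries
    \<open>(1, 2)\<close> and \<open>(2, 4)\<close>; they are eliminated together, with
    \<open>e11\<close> taking care of \<open>P\<close>.\<close>
  have k14: "K x $ 1 $ 4 = 2/3 * r x * (n x)\<^sup>2" if "x \<in> V" for x
  proof -
    have e12: "(r x)^3 * (3/4 * S x) + (r x)\<^sup>2 * n x * P x + K x $ 1 $ 4 * ((r x)\<^sup>2 * q x) =
        3 * p x * ((r x)\<^sup>2 * n x) + 3/4 * s x * r x + (r x)\<^sup>2 * n' x + 2 * r x * r' x * n x"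
      using ent[of x 1 2] that b[OF that] k11[OF that] k12[OF that] Q[OF that]
      by (simp add: nf_def D12 k22 D22)
    have e24': "4 * (r x * S x) * r x - 4 * (K x $ 1 $ 4 * r x - 4/3 * (n x)\<^sup>2 * (r x)\<^sup>2) * q x
      = 4 * q x * K x $ 1 $ 4 * r x + 16/3 * (P x + p x) * n x * r x + 4 * s x + 16/3 * n' x * r x"
    proof -
      have "r x * (4 * (r x * S x) - 4 * K x $ 2 $ 3 * ((r x)\<^sup>2 * q x)) =
        4 * (r x * S x) * r x - 4 * (K x $ 1 $ 4 * r x - 4/3 * (n x)\<^sup>2 * (r x)\<^sup>2) * q x"
        using r0[OF that] by (simp add: k23a that field_simps power2_eq_square)
      moreover have "r x * (4 * q x * K x $ 1 $ 4 + 16/3 * (P x + p x) * n x + 4 * s x / r x + 16/3 * n' x)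
        = 4 * q x * K x $ 1 $ 4 * r x + 16/3 * (P x + p x) * n x * r x + 4 * s x + 16/3 * n' x * r x"
        using r0[OF that] by (simp add: field_simps)
      ultimately show ?thesis using e24[OF that] by simp
    qed
    have "(r x)\<^sup>2 * q x * (3 * K x $ 1 $ 4 - 2 * r x * (n x)\<^sup>2) = 0"
      using e12 e24' e11[OF that] by algebra
    then have "3 * K x $ 1 $ 4 - 2 * r x * (n x)\<^sup>2 = 0" using r0[OF that] nz[OF that] by simp
    then show ?thesis by (simp add: field_simps)
  qed
  have D14: "D x $ 1 $ 4 = 2/3 * (r' x * (n x)\<^sup>2 + 2 * r x * n x * n' x)" if "x \<in> V" for x
    using that dr[OF that] dn[OF that] by (intro uniq[OF that k14]) (auto intro!: derivative_eq_intros simp: algebra_simps)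
  have k23: "K x $ 2 $ 3 = - 2/3 * (n x)\<^sup>2 / r x" if "x \<in> V" for x
    using r0[OF that] by (simp add: k23a k14 that field_simps power2_eq_square)
  \<comment> \<open>The last entry comes from \<open>(1, 4)\<close>, where \<open>S\<close> is
    removed by means of \<open>(2, 4)\<close> once more.\<close>
  have k13: "K x $ 1 $ 3 = - 2/9 * (n x)^3" if "x \<in> V" for x
  proof -
    have e14: "(r x)\<^sup>2 * n x * S x - K x $ 1 $ 3 * ((r x)\<^sup>2 * q x) - 2/3 * r x * (n x)\<^sup>2 * P x =
      3 * p x * (2/3 * r x * (n x)\<^sup>2) + s x * n x + 2/3 * (r' x * (n x)\<^sup>2 + 2 * r x * n x * n' x)"
      using ent[of x 1 4] that b[OF that] k12[OF that] k14[OF that] k24[OF that] D14[OF that] s2(3)[OF that] Q[OF that]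
      by (simp add: nf_def algebra_simps)
    have e24'': "r x * r x * S x = r x * (4/3 * (P x + p x) * n x + 4/3 * n' x) + s x"
      using e24[OF that] r0[OF that] by (simp add: k23 k14 that field_simps power2_eq_square) algebra
    have "9 * ((r x)\<^sup>2 * q x) * (9 * K x $ 1 $ 3 + 2 * (n x)^3) = 0"
      using e14 e24'' e11[OF that] by algebra
    then have "9 * K x $ 1 $ 3 + 2 * (n x)^3 = 0" using r0[OF that] nz[OF that] by simp
    then show ?thesis by (simp add: field_simps add_eq_0_iff)
  qed
  have "K x = gauge (r x) (n x)" if "x \<in> V" for x
    unfolding gauge_def vec_eq_iff forall_4 vector_4
    using that b[OF that] s1[OF that] by (simp add: k11 k12 k13 k14 k23 k24 k33 k43 k44 k22 s2(3))
  then show ?thesis using r0 by blast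
qed

section \<open>Charts and holomorphic functions\<close>

lemma holomorphic_on_localI:
  assumes "\<And>x. x \<in> A \<Longrightarrow> \<exists>V. open V \<and> x \<in> V \<and> f holomorphic_on V"
  shows "f holomorphic_on A"
proof -
  have "f field_differentiable (at x within A)" if "x \<in> A" for x
    using assms[OF that] by (meson field_differentiable_at_within holomorphic_on_imp_differentiable_at)
  then show ?thesis by (simp add: holomorphic_on_def)
qed

lemma topological_chartD:
  assumes "topological_chart c"
  shows "open (fst c)" "open (snd c ` fst c)" "inj_on (snd c) (fst c)"
    "p \<in> fst c \<Longrightarrow> param c (snd c p) = p"
    "x \<in> snd c ` fst c \<Longrightarrow> param c x \<in> fst c"
    "x \<in> snd c ` fst c \<Longrightarrow> snd c (param c x) = x"
    "continuous_on (fst c) (snd c)" "continuous_on (snd c ` fst c) (param c)"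
  using assms by (auto simp: topological_chart_def inv_into_into f_inv_into_f)

lemma chart_image_open:
  assumes "topological_chart c" "open W"
  shows "open (snd c ` (fst c \<inter> W))"
proof -
  have "snd c ` (fst c \<inter> W) = snd c ` fst c \<inter> param c -` W"
    using topological_chartD[OF assms(1)] by force
  then show ?thesis
    using continuous_open_preimage topological_chartD[OF assms(1)] assms(2) by metis
qed

lemma chart_preimage_open:
  assumes "topological_chart c" "open V"
  shows "open (fst c \<inter> snd c -` V)"
  using continuous_open_preimage topological_chartD[OF assms(1)] assms(2) by blast

lemma chartsD: "c \<in> charts S \<Longrightarrow> topological_chart c"
  by (simp add: charts_def)

lemma atlas_subset_charts: "riemann_surface S \<Longrightarrow> c \<in> S \<Longrightarrow> c \<in> charts S"
  by (simp add: riemann_surface_def charts_def Int_commute)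

lemma atlas_covers:
  assumes "riemann_surface S" obtains e where "e \<in> S" "p \<in> fst e"
  using assms unfolding riemann_surface_def by blast

lemma transition_inverse:
  assumes "topological_chart c" "topological_chart e" "open N" "N \<subseteq> fst c \<inter> fst e"
    "(snd c \<circ> param e) holomorphic_on snd e ` N"
  shows "(snd e \<circ> param c) holomorphic_on snd c ` N"
proof -
  note C = topological_chartD[OF assms(1)] and E = topological_chartD[OF assms(2)]
  have op: "open (snd e ` N)"
    using chart_image_open[OF assms(2,3)] assms(4) by (simp add: Int_absorb1)
  have "inj_on (snd c \<circ> param e) (snd e ` N)"
    using C(3) E(4) assms(4) by (auto simp: inj_on_def subset_iff)
  then obtain g where g: "g holomorphic_on (snd c \<circ> param e) ` (snd e ` N)"
      "\<And>z. z \<in> snd e ` N \<Longrightarrow> g ((snd c \<circ> param e) z) = z"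
    using holomorphic_has_inverse[OF assms(5) op] by metis
  have im: "(snd c \<circ> param e) ` (snd e ` N) = snd c ` N"
    using E(4) assms(4) by (auto simp: image_image subset_iff intro!: image_cong)
  have "(snd e \<circ> param c) z = g z" if "z \<in> snd c ` N" for z
    using that C(4) E(4) assms(4) g(2)[of "snd e (param c z)"] by (auto simp: subset_iff)
  then show ?thesis
    using g(1) im holomorphic_cong by metis
qed

lemma charts_transition_atlas:
  assumes "c \<in> charts S" "e \<in> S" "riemann_surface S"
  shows "(snd c \<circ> param e) holomorphic_on snd e ` (fst c \<inter> fst e)"
    "(snd e \<circ> param c) holomorphic_on snd c ` (fst c \<inter> fst e)"
proof -
  show *: "(snd c \<circ> param e) holomorphic_on snd e ` (fst c \<inter> fst e)"
    using assms by (simp add: charts_def)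
  show "(snd e \<circ> param c) holomorphic_on snd c ` (fst c \<inter> fst e)"
    using topological_chartD(1)[OF chartsD[OF assms(1)]] topological_chartD(1)[OF chartsD[OF atlas_subset_charts[OF assms(3,2)]]]
    by (intro transition_inverse[OF chartsD[OF assms(1)] chartsD[OF atlas_subset_charts[OF assms(3,2)]] _ subset_refl *] open_Int)
qed

text \<open>Holomorphy is local, and near each point the transition factors through a chart of the
  given atlas. The same detour is used below for functions and maps.\<close>

lemma transition_holomorphic:
  assumes S: "riemann_surface S" and c: "c \<in> charts S" and d: "d \<in> charts S"
  shows "(snd d \<circ> param c) holomorphic_on snd c ` (fst c \<inter> fst d)"
proof (rule holomorphic_on_localI)
  fix x assume "x \<in> snd c ` (fst c \<inter> fst d)"
  then obtain p where p: "p \<in> fst c" "p \<in> fst d" "x = snd c p" by auto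
  obtain e where e: "e \<in> S" "p \<in> fst e" using atlas_covers[OF S] .
  note C = topological_chartD[OF chartsD[OF c]] and E = topological_chartD[OF chartsD[OF atlas_subset_charts[OF S e(1)]]]
    and D = topological_chartD[OF chartsD[OF d]]
  define N where "N = fst c \<inter> fst d \<inter> fst e"
  have N: "open N" "p \<in> N" using C D E p e by (auto simp: N_def)
  have 1: "(snd e \<circ> param c) holomorphic_on snd c ` N"
    using charts_transition_atlas(2)[OF c e(1) S] by (rule holomorphic_on_subset) (auto simp: N_def)
  have 2: "(snd d \<circ> param e) holomorphic_on snd e ` N"
    using charts_transition_atlas(1)[OF d e(1) S] by (rule holomorphic_on_subset) (auto simp: N_def)
  have im: "(snd e \<circ> param c) ` (snd c ` N) = snd e ` N"
    using C by (auto simp: image_image N_def intro!: image_cong)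
  have "(snd d \<circ> param e) \<circ> (snd e \<circ> param c) holomorphic_on snd c ` N"
    by (rule holomorphic_on_compose[OF 1]) (simp only: im 2)
  then have "(snd d \<circ> param c) holomorphic_on snd c ` N"
    by (rule holomorphic_transform) (use C E in \<open>auto simp: N_def\<close>)
  moreover have "open (snd c ` N)"
    using chart_image_open[OF chartsD[OF c] N(1)] by (simp add: N_def Int_absorb1 inf_assoc)
  ultimately show "\<exists>V. open V \<and> x \<in> V \<and> (snd d \<circ> param c) holomorphic_on V"
    using p N by blast
qed

lemma surface_holomorphic_on_chart:
  assumes S: "riemann_surface S" and c: "c \<in> charts S" and g: "surface_holomorphic_on S W g" and W: "open W"
  shows "(g \<circ> param c) holomorphic_on snd c ` (fst c \<inter> W)"
proof (rule holomorphic_on_localI)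
  fix x assume "x \<in> snd c ` (fst c \<inter> W)"
  then obtain p where p: "p \<in> fst c" "p \<in> W" "x = snd c p" by auto
  obtain e where e: "e \<in> S" "p \<in> fst e" using atlas_covers[OF S] .
  note C = topological_chartD[OF chartsD[OF c]] and E = topological_chartD[OF chartsD[OF atlas_subset_charts[OF S e(1)]]]
  define N where "N = fst c \<inter> W \<inter> fst e"
  have N: "open N" "p \<in> N" using C E p e W by (auto simp: N_def)
  have 1: "(snd e \<circ> param c) holomorphic_on snd c ` N"
    using charts_transition_atlas(2)[OF c e(1) S] by (rule holomorphic_on_subset) (auto simp: N_def)
  have "(g \<circ> param e) holomorphic_on snd e ` (fst e \<inter> W)"
    using g e by (simp add: surface_holomorphic_on_def)
  then have 2: "(g \<circ> param e) holomorphic_on snd e ` N"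
    by (rule holomorphic_on_subset) (auto simp: N_def)
  have im: "(snd e \<circ> param c) ` (snd c ` N) = snd e ` N"
    using C by (auto simp: image_image N_def intro!: image_cong)
  have "(g \<circ> param e) \<circ> (snd e \<circ> param c) holomorphic_on snd c ` N"
    by (rule holomorphic_on_compose[OF 1]) (simp only: im 2)
  then have "(g \<circ> param c) holomorphic_on snd c ` N"
    by (rule holomorphic_transform) (use C E in \<open>auto simp: N_def\<close>)
  moreover have "open (snd c ` N)"
    using chart_image_open[OF chartsD[OF c] N(1)] by (simp add: N_def Int_absorb1 inf_assoc)
  ultimately show "\<exists>V. open V \<and> x \<in> V \<and> (g \<circ> param c) holomorphic_on V"
    using p N by blast
qed

lemma surface_holomorphic_onI:
  assumes S: "riemann_surface S" and W: "open W"
    and ex: "\<And>p. p \<in> W \<Longrightarrow> \<exists>c\<in>charts S. p \<in> fst c \<and> (g \<circ> param c) holomorphic_on snd c ` (fst c \<inter> W)"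
  shows "surface_holomorphic_on S W g"
  unfolding surface_holomorphic_on_def
proof
  fix e assume e: "e \<in> S"
  show "(g \<circ> param e) holomorphic_on snd e ` (fst e \<inter> W)"
  proof (rule holomorphic_on_localI)
    fix x assume "x \<in> snd e ` (fst e \<inter> W)"
    then obtain p where p: "p \<in> fst e" "p \<in> W" "x = snd e p" by auto
    obtain c where c: "c \<in> charts S" "p \<in> fst c" "(g \<circ> param c) holomorphic_on snd c ` (fst c \<inter> W)"
      using ex[OF p(2)] by blast
    note C = topological_chartD[OF chartsD[OF c(1)]] and E = topological_chartD[OF chartsD[OF atlas_subset_charts[OF S e(1)]]]
    define N where "N = fst e \<inter> W \<inter> fst c"
    have N: "open N" "p \<in> N" using C E p c W by (auto simp: N_def)
    have 1: "(snd c \<circ> param e) holomorphic_on snd e ` N"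
      using charts_transition_atlas(1)[OF c(1) e(1) S] by (rule holomorphic_on_subset) (auto simp: N_def)
    have 2: "(g \<circ> param c) holomorphic_on snd c ` N"
      using c(3) by (rule holomorphic_on_subset) (auto simp: N_def)
    have im: "(snd c \<circ> param e) ` (snd e ` N) = snd c ` N"
      using E by (auto simp: image_image N_def intro!: image_cong)
    have "(g \<circ> param c) \<circ> (snd c \<circ> param e) holomorphic_on snd e ` N"
      by (rule holomorphic_on_compose[OF 1]) (simp only: im 2)
    then have "(g \<circ> param e) holomorphic_on snd e ` N"
      by (rule holomorphic_transform) (use C E in \<open>auto simp: N_def\<close>)
    moreover have "open (snd e ` N)"
      using chart_image_open[OF chartsD[OF atlas_subset_charts[OF S e]] N(1)] by (simp add: N_def Int_absorb1 inf_assoc)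
    ultimately show "\<exists>V. open V \<and> x \<in> V \<and> (g \<circ> param e) holomorphic_on V"
      using p N by blast
  qed
qed

lemma holomorphic_map_chart:
  assumes T: "riemann_surface T" and S: "riemann_surface S" and h: "holomorphic_map T S h"
    and c: "c \<in> charts T" and d: "d \<in> charts S"
  shows "(snd d \<circ> h \<circ> param c) holomorphic_on snd c ` (fst c \<inter> h -` fst d)"
proof (rule holomorphic_on_localI)
  fix x assume "x \<in> snd c ` (fst c \<inter> h -` fst d)"
  then obtain p where p: "p \<in> fst c" "h p \<in> fst d" "x = snd c p" by auto
  obtain e where e: "e \<in> T" "p \<in> fst e" using atlas_covers[OF T] .
  obtain k where k: "k \<in> S" "h p \<in> fst k" using atlas_covers[OF S] .
  note C = topological_chartD[OF chartsD[OF c]] and E = topological_chartD[OF chartsD[OF atlas_subset_charts[OF T e(1)]]]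
    and D = topological_chartD[OF chartsD[OF d]] and K = topological_chartD[OF chartsD[OF atlas_subset_charts[OF S k(1)]]]
  have cont: "continuous_on UNIV h" using h by (simp add: holomorphic_map_def)
  define N where "N = fst c \<inter> fst e \<inter> h -` (fst d \<inter> fst k)"
  have "open N" unfolding N_def by (intro open_Int C(1) E(1) open_vimage[OF _ cont] D(1) K(1))
  moreover have "p \<in> N" using p e k by (simp add: N_def)
  ultimately have N: "open N" "p \<in> N" .
  have 1: "(snd e \<circ> param c) holomorphic_on snd c ` N"
    using charts_transition_atlas(2)[OF c e(1) T] by (rule holomorphic_on_subset) (auto simp: N_def)
  have "(snd k \<circ> h \<circ> param e) holomorphic_on snd e ` (fst e \<inter> h -` fst k)"
    using h e k by (simp add: holomorphic_map_def)
  then have 2: "(snd k \<circ> h \<circ> param e) holomorphic_on snd e ` N"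
    by (rule holomorphic_on_subset) (auto simp: N_def)
  have 3: "(snd d \<circ> param k) holomorphic_on snd k ` (h ` N)"
    using charts_transition_atlas(1)[OF d k(1) S] by (rule holomorphic_on_subset) (auto simp: N_def)
  have im: "(snd e \<circ> param c) ` (snd c ` N) = snd e ` N"
    using C by (auto simp: image_image N_def intro!: image_cong)
  have im2: "(snd k \<circ> h \<circ> param e) ` (snd e ` N) = snd k ` (h ` N)"
    using E by (auto simp: image_image N_def intro!: image_cong)
  have 12: "(snd k \<circ> h \<circ> param e) \<circ> (snd e \<circ> param c) holomorphic_on snd c ` N"
    by (rule holomorphic_on_compose[OF 1]) (simp only: im 2)
  have im3: "((snd k \<circ> h \<circ> param e) \<circ> (snd e \<circ> param c)) ` (snd c ` N) = snd k ` (h ` N)"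
    using im im2 image_comp by metis
  have "(snd d \<circ> param k) \<circ> ((snd k \<circ> h \<circ> param e) \<circ> (snd e \<circ> param c)) holomorphic_on snd c ` N"
    by (rule holomorphic_on_compose[OF 12]) (simp only: im3 3)
  then have "(snd d \<circ> h \<circ> param c) holomorphic_on snd c ` N"
    by (rule holomorphic_transform) (use C E K in \<open>auto simp: N_def\<close>)
  moreover have "open (snd c ` N)"
    using chart_image_open[OF chartsD[OF c] N(1)] by (simp add: N_def Int_absorb1 inf_assoc)
  ultimately show "\<exists>V. open V \<and> x \<in> V \<and> (snd d \<circ> h \<circ> param c) holomorphic_on V"
    using p N by blast
qed

text \<open>The source of all new charts: coordinates that normalize a frame, and coordinates pulled
  back along \<open>h\<close> where it is injective. The parametrization is continuous because a
  holomorphic injection has a holomorphic inverse.\<close>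

lemma chartI:
  assumes T: "riemann_surface T" and c: "c \<in> charts T" and U: "open U" "U \<subseteq> fst c"
    and hol: "(z \<circ> param c) holomorphic_on snd c ` U" and inj: "inj_on z U"
  shows "(U, z) \<in> charts T"
proof -
  note C = topological_chartD[OF chartsD[OF c]]
  let ?\<zeta> = "z \<circ> param c"
  have op: "open (snd c ` U)"
    using chart_image_open[OF chartsD[OF c] U(1)] U(2) by (simp add: Int_absorb1)
  have inj': "inj_on ?\<zeta> (snd c ` U)"
    using inj C(4) U(2) by (auto simp: inj_on_def subset_iff)
  have im: "?\<zeta> ` (snd c ` U) = z ` U"
    using C(4) U(2) by (auto simp: image_image subset_iff intro!: image_cong)
  obtain g where g: "g holomorphic_on ?\<zeta> ` (snd c ` U)" "\<And>w. w \<in> snd c ` U \<Longrightarrow> g (?\<zeta> w) = w"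
    using holomorphic_has_inverse[OF hol op inj'] by metis
  have par: "inv_into U z x = param c (g x)" if x: "x \<in> z ` U" for x
  proof -
    obtain p where p: "p \<in> U" "x = z p" using x by auto
    have "g (?\<zeta> (snd c p)) = snd c p" using g(2) p by blast
    then show ?thesis using p U(2) C(4) inj by (auto simp: subset_iff)
  qed
  have gim: "g ` (z ` U) \<subseteq> snd c ` fst c"
    using g(2) U(2) unfolding im[symmetric] by auto
  have "topological_chart (U, z)"
    unfolding topological_chart_def fst_conv snd_conv
  proof (intro conjI)
    show "open (z ` U)" using open_mapping_thm3[OF hol op inj'] im by simp
    have "continuous_on U (?\<zeta> \<circ> snd c)"
      using U(2) hol C(7) by (intro continuous_on_compose holomorphic_on_imp_continuous_on)
        (auto intro: continuous_on_subset)
    then show "continuous_on U z"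
      using C(4) U(2) by (subst continuous_on_cong[OF refl]) (auto simp: subset_iff)
    have "continuous_on (z ` U) (param c \<circ> g)"
      using g(1) C(8) gim im by (intro continuous_on_compose holomorphic_on_imp_continuous_on)
        (auto intro: continuous_on_subset)
    then show "continuous_on (z ` U) (inv_into U z)"
      using par by (subst continuous_on_cong[OF refl]) auto
  qed (use U inj in auto)
  moreover have "(z \<circ> param d) holomorphic_on snd d ` (U \<inter> fst d)" if d: "d \<in> T" for d
  proof -
    note D = topological_chartD[OF chartsD[OF atlas_subset_charts[OF T d]]]
    have 1: "(snd c \<circ> param d) holomorphic_on snd d ` (U \<inter> fst d)"
      using charts_transition_atlas(1)[OF c d T] by (rule holomorphic_on_subset) (use U in auto)
    have "?\<zeta> \<circ> (snd c \<circ> param d) holomorphic_on snd d ` (U \<inter> fst d)"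
      by (intro holomorphic_on_compose 1 holomorphic_on_subset[OF hol]) (use D in auto)
    then show ?thesis
      by (rule holomorphic_transform) (use D C U in \<open>auto simp: subset_iff\<close>)
  qed
  ultimately show ?thesis by (simp add: charts_def)
qed

lemma surface_holomorphic_on_compose:
  assumes T: "riemann_surface T" and S: "riemann_surface S" and h: "holomorphic_map T S h"
    and g: "surface_holomorphic_on S W g" and W: "open W"
  shows "surface_holomorphic_on T (h -` W) (g \<circ> h)"
  unfolding surface_holomorphic_on_def
proof
  fix e assume e: "e \<in> T"
  have cont: "continuous_on UNIV h" using h by (simp add: holomorphic_map_def)
  show "(g \<circ> h \<circ> param e) holomorphic_on snd e ` (fst e \<inter> h -` W)"
  proof (rule holomorphic_on_localI)
    fix x assume "x \<in> snd e ` (fst e \<inter> h -` W)"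
    then obtain p where p: "p \<in> fst e" "h p \<in> W" "x = snd e p" by auto
    obtain k where k: "k \<in> S" "h p \<in> fst k" using atlas_covers[OF S] .
    note E = topological_chartD[OF chartsD[OF atlas_subset_charts[OF T e(1)]]]
      and K = topological_chartD[OF chartsD[OF atlas_subset_charts[OF S k(1)]]]
    define N where "N = fst e \<inter> h -` (W \<inter> fst k)"
    have "open N" unfolding N_def by (intro open_Int E(1) open_vimage[OF _ cont] W K(1))
    moreover have "p \<in> N" using p k by (simp add: N_def)
    ultimately have N: "open N" "p \<in> N" .
    have "(snd k \<circ> h \<circ> param e) holomorphic_on snd e ` (fst e \<inter> h -` fst k)"
      using h e k by (simp add: holomorphic_map_def)
    then have 2: "(snd k \<circ> h \<circ> param e) holomorphic_on snd e ` N"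
      by (rule holomorphic_on_subset) (auto simp: N_def)
    have "(g \<circ> param k) holomorphic_on snd k ` (fst k \<inter> W)"
      using g k by (simp add: surface_holomorphic_on_def)
    then have 3: "(g \<circ> param k) holomorphic_on snd k ` (h ` N)"
      by (rule holomorphic_on_subset) (auto simp: N_def)
    have im2: "(snd k \<circ> h \<circ> param e) ` (snd e ` N) = snd k ` (h ` N)"
      using E by (auto simp: image_image N_def intro!: image_cong)
    have "(g \<circ> param k) \<circ> (snd k \<circ> h \<circ> param e) holomorphic_on snd e ` N"
      by (rule holomorphic_on_compose[OF 2]) (simp only: im2 3)
    then have "(g \<circ> h \<circ> param e) holomorphic_on snd e ` N"
      by (rule holomorphic_transform) (use E K in \<open>auto simp: N_def\<close>)
    moreover have "open (snd e ` N)"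
      using chart_image_open[OF chartsD[OF atlas_subset_charts[OF T e]] N(1)] by (simp add: N_def Int_absorb1 inf_assoc)
    ultimately show "\<exists>V. open V \<and> x \<in> V \<and> (g \<circ> h \<circ> param e) holomorphic_on V"
      using p N by blast
  qed
qed

section \<open>Frames in normal form\<close>

lemma gauge_Sp4:
  assumes "r \<noteq> 0" shows "gauge r n \<in> Sp4"
proof -
  define u where "u = 1 / r"
  have ur: "u * r = 1" using assms by (simp add: u_def)
  have u: "1 / r = u" "\<And>x. x / r = x * u" "\<And>x. x / r\<^sup>2 = x * u\<^sup>2" "\<And>x. x / r^3 = x * u^3"
    using assms by (simp_all add: u_def field_simps eval_nat_numeral)
  show ?thesis
    unfolding Sp4_iff
    unfolding vec_eq_iff forall_4 matrix_matrix_mult_def sum_4 gauge_def J_mat_def vector_4 u transpose_def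
       vec_lambda_beta
    using ur
    apply (intro conjI)
    apply ((simp; fail) | algebra)+
    done
qed

lemma gauge_1_0: "gauge 1 0 = mat 1"
  by (simp add: gauge_def vec_eq_iff forall_4 mat_def)

lemma span_pair: "x \<in> vec.span {u, v} \<longleftrightarrow> (\<exists>a b. x = a *s u + b *s v)" for x :: "complex^'n"
  unfolding vec.span_insert vec.span_empty by (auto simp: algebra_simps eq_diff_eq diff_eq_eq)

lemma omega_bilinear:
  "omega (a *s x + b *s y) z = a * omega x z + b * omega y z"
  "omega z (a *s x + b *s y) = a * omega z x + b * omega z y"
  by (simp_all add: omega_def algebra_simps)

lemma omega_columns:
  assumes "A \<in> Sp4" "i \<in> {1, 2}" "j \<in> {1, 2}"
  shows "omega (column i A) (column j A) = 0"
  using assms by (auto simp: omega_eq_entry Sp4_iff J_mat_def)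

lemma matrix_add_rdistrib: "(A + B) ** C = A ** C + B ** C" for A B :: "'a::semiring_1^'n^'m"
  by (simp add: matrix_matrix_mult_def vec_eq_iff sum.distrib distrib_right)

text \<open>The Maurer-Cartan condition is written as \<open>a' = a ** nf\<close>, which needs no
  inverse and fits the product rule. The condition on \<open>q\<close> records that
  \<open>\<phi>\<^sup>4\<^sub>2\<close> has no zeros.\<close>

definition frame_on :: "complex set \<Rightarrow> (complex \<Rightarrow> complex^4^4) \<Rightarrow> (complex \<Rightarrow> complex) \<Rightarrow>
    (complex \<Rightarrow> complex) \<Rightarrow> (complex \<Rightarrow> complex) \<Rightarrow> (complex \<Rightarrow> complex) \<Rightarrow> bool" where
  "frame_on V a p q s t \<longleftrightarrow> open V \<and>
     (\<forall>x\<in>V. a x \<in> Sp4 \<and> q x \<noteq> 0 \<and> has_mat_deriv a (a x ** nf (p x) (q x) (s x) (t x)) x)"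

lemma Sp4_cancel:
  fixes B C :: "complex^4^4"
  assumes "A \<in> Sp4" "A ** B = A ** C" shows "B = C"
  by (metis assms matrix_mul_assoc matrix_mul_lid sp_inv_left)

lemma maurer_cartan_eqI:
  assumes "a x \<in> Sp4" "has_mat_deriv a (a x ** \<Phi>) x"
  shows "maurer_cartan a x = \<Phi>"
  unfolding maurer_cartan_def matrix_inv_Sp4[OF assms(1)] has_mat_deriv_imp_eq[OF assms(2)]
  by (simp add: matrix_mul_assoc sp_inv_left[OF assms(1)])

lemma frame_on_subset: "frame_on V a p q s t \<Longrightarrow> U \<subseteq> V \<Longrightarrow> open U \<Longrightarrow> frame_on U a p q s t"
  by (auto simp: frame_on_def)

text \<open>Put \<open>K = sp_inv a ** b\<close>. Differentiating \<open>b = a ** K\<close> in two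
  ways produces the gauge equation to which \<open>gauge_unique\<close> applies.\<close>

lemma frames_gauge:
  assumes a: "frame_on V a p q s t" and b: "frame_on V b P Q S T"
    and span: "\<And>x. x \<in> V \<Longrightarrow> vec.span {column 1 (b x), column 2 (b x)} = vec.span {column 1 (a x), column 2 (a x)}"
  shows "\<forall>x\<in>V. \<exists>r n. r \<noteq> 0 \<and> b x = a x ** gauge r n"
proof -
  define K where "K = (\<lambda>x. sp_inv (a x) ** b x)"
  define D where "D = (\<lambda>x. sp_inv (a x ** nf (p x) (q x) (s x) (t x)) ** b x
      + sp_inv (a x) ** (b x ** nf (P x) (Q x) (S x) (T x)))"
  have V: "open V" using a by (simp add: frame_on_def)
  have A: "a x \<in> Sp4" "has_mat_deriv a (a x ** nf (p x) (q x) (s x) (t x)) x" "q x \<noteq> 0"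
    and B: "b x \<in> Sp4" "has_mat_deriv b (b x ** nf (P x) (Q x) (S x) (T x)) x" if "x \<in> V" for x
    using a b that by (auto simp: frame_on_def)
  have aK: "a x ** K x = b x" if "x \<in> V" for x
    by (simp add: K_def matrix_mul_assoc sp_inv_right[OF A(1)[OF that]])
  have dK: "has_mat_deriv K (D x) x" if "x \<in> V" for x
    unfolding K_def D_def
    by (intro has_mat_deriv_mult has_mat_deriv_sp_inv A B that)
  have "\<forall>x\<in>V. \<exists>r n. r \<noteq> 0 \<and> K x = gauge r n"
  proof (rule gauge_unique[OF V])
    show "K x \<in> Sp4" if "x \<in> V" for x
      unfolding K_def by (intro Sp4_mult sp_inv_Sp4 A B that)
    show "has_mat_deriv K (D x) x" if "x \<in> V" for x using dK[OF that] .
    show "q x \<noteq> 0" if "x \<in> V" for x using A(3)[OF that] .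
    show "K x ** nf (P x) (Q x) (S x) (T x) = nf (p x) (q x) (s x) (t x) ** K x + D x" if x: "x \<in> V" for x
    proof -
      have "has_mat_deriv b (a x ** nf (p x) (q x) (s x) (t x) ** K x + a x ** D x) x"
        using has_mat_deriv_mult[OF A(2)[OF x] dK[OF x]] has_mat_deriv_cong[of V "\<lambda>s. a s ** K s" b, OF aK V x] by blast
      from has_mat_deriv_unique[OF B(2)[OF x] this]
      have "a x ** (K x ** nf (P x) (Q x) (S x) (T x)) = a x ** (nf (p x) (q x) (s x) (t x) ** K x + D x)"
        using aK[OF x] by (simp add: matrix_mul_assoc matrix_add_ldistrib)
      then show ?thesis using Sp4_cancel A(1)[OF x] by blast
    qed
    show "K x $ i $ j = 0" if x: "x \<in> V" and ij: "i \<in> {3, 4}" "j \<in> {1, 2}" for x i j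
    proof -
      \<comment> \<open>Up to sign, the lower left block of \<open>K\<close> consists of values of
        \<open>omega\<close> between columns of the two frames, and these columns lie in a common
        Lagrangian plane.\<close>
      have om: "omega (column k (a x)) (column j (b x)) = 0" if "k \<in> {1, 2}" for k
      proof -
        have "column j (b x) \<in> vec.span {column 1 (a x), column 2 (a x)}"
          using ij(2) span[OF x, symmetric] by (auto intro: vec.span_base)
        then show ?thesis
          using omega_columns[OF A(1)[OF x] that] by (auto simp: span_pair omega_bilinear)
      qed
      have "K x = (- J_mat) ** (transpose (a x) ** J_mat ** b x)"
        by (simp add: K_def sp_inv_def matrix_mul_assoc)
      then have "K x $ i $ j = (\<Sum>l\<in>UNIV. (- J_mat) $ i $ l * omega (column l (a x)) (column j (b x)))"
        by (simp only: omega_eq_entry) (simp add: matrix_matrix_mult_def)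
      then show ?thesis using om ij by (auto simp: sum_4 J_mat_def)
    qed
  qed
  then show ?thesis using aK by metis
qed

lemma frame_gauge:
  assumes a: "a x \<in> Sp4" "has_mat_deriv a (a x ** nf p q s t) x"
    and r: "(r has_field_derivative r') (at x)" "r x \<noteq> 0" and n: "(n has_field_derivative n') (at x)"
  shows "has_mat_deriv (\<lambda>x. a x ** gauge (r x) (n x)) (a x ** gauge (r x) (n x) **
     nf (p + r' * (1 / r x) - r x * n x * q / 3) ((r x)\<^sup>2 * q)
     (4/3 * n x * (1 / r x) * (2 * p + r' * (1 / r x) - r x * n x * q / 3) + s * (1 / r x)\<^sup>2 + 4/3 * n' * (1 / r x))
     (t * (1 / r x)^6)) x"
proof -
  have "1 / r x * r x = 1" using r by simp
  note g = gauge_eq[OF r(2) this, of "n x" p r' q s n' t]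
  show ?thesis
    using has_mat_deriv_mult[OF a(2) has_mat_deriv_gauge[OF r(1) n r(2)]]
    by (simp only: matrix_mul_assoc[symmetric] g matrix_add_ldistrib)
qed

lemma frame_chain:
  assumes "has_mat_deriv a (a (H x) ** nf p q s t) (H x)" "(H has_field_derivative H') (at x)"
  shows "has_mat_deriv (\<lambda>x. a (H x)) (a (H x) ** nf (H' * p) (H' * q) (H' * s) (H' * t)) x"
  using has_mat_deriv_chain[OF assms] by (simp add: scale_mult nf_scale)

text \<open>The derivative of \<open>b ** sp_inv a\<close> contains the factor
  \<open>N ** (- J_mat) + (- J_mat) ** transpose N\<close> for the common normal form
  \<open>N\<close>. It vanishes because \<open>N\<close> lies in the symplectic Lie algebra, and
  connectedness makes the quotient constant.\<close>

lemma frames_equal: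
  assumes a: "frame_on V a p q s t" and b: "frame_on V b p q s t" and V: "connected V" "x0 \<in> V"
  shows "\<exists>X\<in>Sp4. \<forall>x\<in>V. b x = X ** a x"
proof -
  have op: "open V" using a by (simp add: frame_on_def)
  have A: "a x \<in> Sp4" "has_mat_deriv a (a x ** nf (p x) (q x) (s x) (t x)) x"
    and B: "b x \<in> Sp4" "has_mat_deriv b (b x ** nf (p x) (q x) (s x) (t x)) x" if "x \<in> V" for x
    using a b that by (auto simp: frame_on_def)
  define M where "M = (\<lambda>x. b x ** sp_inv (a x))"
  have d: "has_mat_deriv M 0 x" if "x \<in> V" for x
  proof -
    let ?N = "nf (p x) (q x) (s x) (t x)"
    have "b x ** ?N ** sp_inv (a x) + b x ** sp_inv (a x ** ?N)
      = b x ** (?N ** (- J_mat) + (- J_mat) ** transpose ?N) ** transpose (a x) ** J_mat"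
      by (simp add: sp_inv_def matrix_add_ldistrib matrix_add_rdistrib matrix_mul_assoc matrix_transpose_mul)
    also have "?N ** (- J_mat) + (- J_mat) ** transpose ?N = 0"
      by (simp add: nf_def J_mat_def vec_eq_iff forall_4 matrix_matrix_mult_def sum_4 transpose_def)
    finally have "b x ** ?N ** sp_inv (a x) + b x ** sp_inv (a x ** ?N) = 0" by simp
    then show ?thesis
      using has_mat_deriv_mult[OF B(2)[OF that] has_mat_deriv_sp_inv[OF A(2)[OF that]]]
      by (simp add: M_def)
  qed
  have "M x $ i $ j = M x0 $ i $ j" if x: "x \<in> V" for x i j
  proof (rule DERIV_zero_connected_constant[OF V(1) op, where K = "{}"])
    show "continuous_on V (\<lambda>x. M x $ i $ j)"
      using d by (intro continuous_at_imp_continuous_on ballI) (auto simp: has_mat_deriv_def intro: DERIV_isCont)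
    show "\<forall>x\<in>V - {}. ((\<lambda>x. M x $ i $ j) has_field_derivative 0) (at x)"
      using d by (auto simp: has_mat_deriv_def)
  qed (use x V in auto)
  then have "M x = M x0" if "x \<in> V" for x using that by (simp add: vec_eq_iff)
  moreover have "b x = M x ** a x" if "x \<in> V" for x
    by (simp add: M_def matrix_mul_assoc[symmetric] sp_inv_left A that)
  moreover have "M x0 \<in> Sp4"
    unfolding M_def by (intro Sp4_mult sp_inv_Sp4 A B V)
  ultimately show ?thesis by metis
qed

section \<open>The canonical reduction and adapted charts\<close>

text \<open>The conditions on a reduction speak of tangent vectors; this turns them into conditions
  on the derivative of a section. The component \<open>1\<close> expresses that the section is
  parametrized by the coordinate of \<open>c\<close>.\<close>

lemma section_tangent:
  assumes S: "riemann_surface S" and A: "local_section S P W A" and c: "c \<in> charts S" and p: "p \<in> fst c \<inter> W"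
  shows "(1, mat_deriv (A \<circ> param c) (snd c p)) \<in> tangent_vectors S P c (p, A p)"
proof -
  note C = topological_chartD[OF chartsD[OF c]]
  define D where "D = snd c ` (fst c \<inter> W)"
  have W: "open W" "holomorphic_mat_on S W A" "\<And>q. q \<in> W \<Longrightarrow> (q, A q) \<in> P"
    using A by (auto simp: local_section_def)
  have D: "open D" unfolding D_def by (rule chart_image_open[OF chartsD[OF c] W(1)])
  have curve: "holomorphic_curve S D (param c)"
    unfolding holomorphic_curve_def
  proof (intro conjI ballI)
    show "continuous_on D (param c)" using C(8) by (rule continuous_on_subset) (auto simp: D_def)
    fix d assume d: "d \<in> S"
    show "(snd d \<circ> param c) holomorphic_on D \<inter> param c -` fst d"
      using transition_holomorphic[OF S c atlas_subset_charts[OF S d]]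
      by (rule holomorphic_on_subset) (auto simp: D_def C(4))
  qed
  have hol: "(\<lambda>s. (A \<circ> param c) s $ i $ j) holomorphic_on D" for i j
    using surface_holomorphic_on_chart[OF S c _ W(1), of "\<lambda>p. A p $ i $ j"] W(2)
    by (simp add: holomorphic_mat_on_def D_def comp_def)
  have der: "deriv (snd c \<circ> param c) (snd c p) = 1"
  proof -
    have "((\<lambda>z. z) has_field_derivative 1) (at (snd c p))" by (rule DERIV_ident)
    then have "((snd c \<circ> param c) has_field_derivative 1) (at (snd c p))"
      by (rule has_field_derivative_transform_within_open[OF _ D]) (use p C in \<open>auto simp: D_def\<close>)
    then show ?thesis by (rule DERIV_imp_deriv)
  qed
  show ?thesis
    unfolding tangent_vectors_def
    using D curve hol der p C(4) W(3)
    by (auto simp: D_def intro!: exI[of _ D] exI[of _ "param c"] exI[of _ "A \<circ> param c"] exI[of _ "snd c p"])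
qed

text \<open>The value of \<open>\<phi>\<^sup>4\<^sub>2\<close> for which \<^const>\<open>curve_eta\<close> has lower left entry \<open>1\<close>.\<close>

definition kap :: complex where "kap = - complex_of_real (root 3 6)"

lemma kap: "kap \<noteq> 0" "- complex_of_real (1 / root 3 6) * kap = 1"
  by (simp_all add: kap_def)

locale canonical_data =
  fixes S :: "('s::t2_space) chart set" and f g :: "'s \<Rightarrow> (complex^4) set"
    and F :: "('s \<times> (complex^4^4)) set" and \<delta> :: "'s differential"
  assumes surf: "riemann_surface S"
    and red: "canonical_reduction S f g F"
    and cart: "cartan_connection S F curve_eta"
    and quart: "quartic_differential S F \<delta>"
begin

lemma principal: "principal_bundle S (S_star S f g) F"
  using red by (simp add: canonical_reduction_def)

lemma in_F:
  assumes "(p, A) \<in> F"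
  shows "A \<in> Sp4" "f p = vec.span {column 1 A, column 2 A}" "p \<in> S_star S f g"
  using red principal assms by (auto simp: canonical_reduction_def principal_bundle_def)

lemma in_F_gauge:
  assumes "(p, A) \<in> F" "r \<noteq> 0" shows "(p, A ** gauge r n) \<in> F"
proof -
  have "\<forall>p A B. (p, A) \<in> F \<longrightarrow> ((p, B) \<in> F \<longleftrightarrow> (\<exists>Y\<in>SL2_1. B = A ** S_rep Y))"
    using principal by (simp add: principal_bundle_def)
  moreover obtain Y where "Y \<in> SL2_1" "gauge r n = S_rep Y" using gauge_in_image[OF assms(2)] by blast
  ultimately show ?thesis using assms(1) by auto
qed

lemma six_equations:
  assumes "d \<in> charts S" "(p, A) \<in> F" "p \<in> fst d" "(v, V) \<in> tangent_vectors S F d (p, A)"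
  defines "\<phi> \<equiv> matrix_inv A ** V"
  shows "\<phi> $ 3 $ 1 = 0" "\<phi> $ 4 $ 1 = 0" "\<phi> $ 2 $ 1 = \<phi> $ 4 $ 2"
    "\<phi> $ 1 $ 1 = 3 * \<phi> $ 2 $ 2" "\<phi> $ 1 $ 2 = 3/4 * \<phi> $ 2 $ 4" "\<phi> $ 1 $ 4 = 0"
proof -
  have "let \<phi> = matrix_inv A ** V in \<phi> $ 3 $ 1 = 0 \<and> \<phi> $ 4 $ 1 = 0 \<and> \<phi> $ 2 $ 1 - \<phi> $ 4 $ 2 = 0 \<and>
              \<phi> $ 1 $ 1 - 3 * \<phi> $ 2 $ 2 = 0 \<and> 4 * \<phi> $ 1 $ 2 - 3 * \<phi> $ 2 $ 4 = 0 \<and>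
              \<phi> $ 1 $ 4 = 0"
    using red assms unfolding canonical_reduction_def by fast
  then show "\<phi> $ 3 $ 1 = 0" "\<phi> $ 4 $ 1 = 0" "\<phi> $ 2 $ 1 = \<phi> $ 4 $ 2"
    "\<phi> $ 1 $ 1 = 3 * \<phi> $ 2 $ 2" "\<phi> $ 1 $ 2 = 3/4 * \<phi> $ 2 $ 4" "\<phi> $ 1 $ 4 = 0"
    by (auto simp: \<phi>_def Let_def field_simps)
qed

text \<open>Inside a fibre the connection reproduces the Maurer-Cartan form of the group, so every
  upper triangular value with trace zero is attained by a vector whose surface component is
  \<open>0\<close>. Injectivity of the connection then keeps such values away from tangent vectors
  of sections.\<close>

lemma vertical_tangent:
  assumes pA: "(p, A) \<in> F"
  shows "\<exists>V. (0, V) \<in> tangent_vectors S F d (p, A) \<and>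
    curve_eta (matrix_inv A ** V) = vector [vector [k, b], vector [0, - k]]"
proof -
  \<comment> \<open>Only the velocity at \<open>0\<close> matters, so the corner may simply be
    linear; the exponentials keep the determinant equal to \<open>1\<close>.\<close>
  define Y where "Y = (\<lambda>s. vector [vector [exp (k * s), b * s], vector [0, exp (- k * s)]] :: complex^2^2)"
  have Y: "Y s \<in> SL2_1" for s
    by (simp add: Y_def SL2_1_def det_2 exp_minus)
  have Y0: "Y 0 = mat 1" by (simp add: Y_def vec_eq_iff forall_2 mat_def)
  have rep: "S_rep (Y s) = gauge (exp (k * s)) (- (b * s) / alp)" for s
    using SL2_1_gauge(2)[OF Y] by (simp add: Y_def)
  have rep0: "S_rep (Y 0) = mat 1" by (simp add: rep gauge_1_0)
  have hY: "(\<lambda>s. Y s $ i $ j) holomorphic_on UNIV" for i j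
    using exhaust_2[of i] exhaust_2[of j] by (auto simp: Y_def intro!: holomorphic_intros)
  have "(\<lambda>s. gauge (exp (k * s)) (- (b * s) / alp) $ i $ j) holomorphic_on UNIV" for i j
    using exhaust_4[of i] exhaust_4[of j] alp_bet(4)
    by (elim disjE) (auto simp: gauge_def intro!: holomorphic_intros)
  then have hA: "(\<lambda>s. (A ** S_rep (Y s)) $ i $ j) holomorphic_on UNIV" for i j
    unfolding rep matrix_matrix_mult_def by (simp add: holomorphic_intros)
  define V where "V = mat_deriv (\<lambda>s. A ** S_rep (Y s)) 0"
  have inF: "(p, A ** S_rep (Y s)) \<in> F" for s
    unfolding rep by (intro in_F_gauge pA) simp
  have "(0, V) \<in> tangent_vectors S F d (p, A)"
    unfolding tangent_vectors_def mem_Collect_eq prod.case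
  proof (intro exI conjI)
    show "open (UNIV :: complex set)" "0 \<in> (UNIV :: complex set)" by auto
    show "holomorphic_curve S UNIV (\<lambda>_. p)"
      by (simp add: holomorphic_curve_def comp_def)
    show "\<forall>i j. (\<lambda>s. (A ** S_rep (Y s)) $ i $ j) holomorphic_on UNIV" using hA by blast
    show "\<forall>s\<in>UNIV. (p, A ** S_rep (Y s)) \<in> F" using inF by blast
    show "(p, A ** S_rep (Y 0)) = (p, A)" by (simp add: rep0)
    show "0 = deriv (snd d \<circ> (\<lambda>_. p)) 0" by (simp add: comp_def)
    show "V = mat_deriv (\<lambda>s. A ** S_rep (Y s)) 0" by (simp add: V_def)
  qed
  moreover have "curve_eta (matrix_inv A ** V) = vector [vector [k, b], vector [0, - k]]"
  proof -
    have "curve_eta (maurer_cartan (\<lambda>s. A ** S_rep (Y s)) 0) = maurer_cartan Y 0"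
    proof -
      have "\<forall>p A D Y t. (p, A) \<in> F \<and> open D \<and> t \<in> D \<and> (\<forall>s\<in>D. Y s \<in> SL2_1) \<and>
        (\<forall>i j. (\<lambda>s. Y s $ i $ j) holomorphic_on D) \<longrightarrow>
        curve_eta (maurer_cartan (\<lambda>s. A ** S_rep (Y s)) t) = maurer_cartan Y t"
        using cart unfolding cartan_connection_def by (elim conjE)
      from this[rule_format, of p A UNIV 0 Y] show ?thesis using pA Y hY by simp
    qed
    moreover have "maurer_cartan (\<lambda>s. A ** S_rep (Y s)) 0 = matrix_inv A ** V"
      by (simp add: maurer_cartan_def rep0 V_def)
    moreover have "has_mat_deriv Y (vector [vector [k, b], vector [0, - k]]) 0"
      unfolding has_mat_deriv_def forall_2 Y_def by (auto intro!: derivative_eq_intros)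
    then have "maurer_cartan Y 0 = vector [vector [k, b], vector [0, - k]]"
      by (simp add: maurer_cartan_def Y0 has_mat_deriv_imp_eq matrix_inv_eqI[of "mat 1" "mat 1"])
    ultimately show ?thesis by simp
  qed
  ultimately show ?thesis by blast
qed

text \<open>The six equations together with the symplectic Lie algebra leave four free entries,
  which are \<open>p\<close>, \<open>q\<close>, \<open>s\<close> and \<open>t\<close>. The formula
  for \<open>\<delta>\<close> is its defining identity at the tangent vector of the section, whose
  surface component is \<open>1\<close>.\<close>

lemma section_frame:
  assumes A: "local_section S F W A" and c: "c \<in> charts S"
  obtains p q s t where "frame_on (snd c ` (fst c \<inter> W)) (A \<circ> param c) p q s t"
    "p holomorphic_on snd c ` (fst c \<inter> W)" "q holomorphic_on snd c ` (fst c \<inter> W)"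
    "s holomorphic_on snd c ` (fst c \<inter> W)" "t holomorphic_on snd c ` (fst c \<inter> W)"
    "\<And>y. y \<in> fst c \<inter> W \<Longrightarrow> \<delta> c y = t (snd c y) * q (snd c y) ^ 3"
proof -
  note C = topological_chartD[OF chartsD[OF c]]
  have W: "open W" "holomorphic_mat_on S W A" "\<And>q. q \<in> W \<Longrightarrow> (q, A q) \<in> F"
    using A by (auto simp: local_section_def)
  define V where "V = snd c ` (fst c \<inter> W)"
  define a where "a = A \<circ> param c"
  define \<Phi> where "\<Phi> = (\<lambda>x. sp_inv (a x) ** mat_deriv a x)"
  have V: "open V" unfolding V_def by (rule chart_image_open[OF chartsD[OF c] W(1)])
  have hol: "(\<lambda>s. a s $ i $ j) holomorphic_on V" for i j
    using surface_holomorphic_on_chart[OF surf c _ W(1), of "\<lambda>p. A p $ i $ j"] W(2)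
    by (simp add: holomorphic_mat_on_def V_def a_def comp_def)
  have da: "has_mat_deriv a (mat_deriv a x) x" if "x \<in> V" for x
    using has_mat_deriv_holomorphic[OF hol V that] .
  have sp: "a x \<in> Sp4" if "x \<in> V" for x
  proof -
    have "param c x \<in> W" using that C(4) by (auto simp: V_def)
    then show ?thesis using in_F(1)[OF W(3)] by (simp add: a_def)
  qed
  have hol': "(\<lambda>x. deriv (\<lambda>s. a s $ i $ j) x) holomorphic_on V" for i j
    using hol V by (rule holomorphic_deriv)
  have holPhi: "(\<lambda>x. \<Phi> x $ i $ j) holomorphic_on V" for i j
    unfolding \<Phi>_def sp_inv_def matrix_matrix_mult_def transpose_def mat_deriv_def vec_lambda_beta
    by (intro holomorphic_intros hol hol')
  have eqs: "\<Phi> x $ 3 $ 1 = 0" "\<Phi> x $ 4 $ 1 = 0" "\<Phi> x $ 2 $ 1 = \<Phi> x $ 4 $ 2"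
    "\<Phi> x $ 1 $ 1 = 3 * \<Phi> x $ 2 $ 2" "\<Phi> x $ 1 $ 2 = 3/4 * \<Phi> x $ 2 $ 4" "\<Phi> x $ 1 $ 4 = 0"
    and quartic: "\<delta> c (param c x) = \<Phi> x $ 1 $ 3 * \<Phi> x $ 4 $ 2 ^ 3"
    and inj: "\<Phi> x $ 4 $ 2 \<noteq> 0"
    if "x \<in> V" for x
  proof -
    define y where "y = param c x"
    have y: "y \<in> fst c \<inter> W" "snd c y = x" "a x = A y" using that C by (auto simp: V_def y_def a_def)
    have yF: "(y, A y) \<in> F" using W(3) y by blast
    have tv: "(1, mat_deriv a x) \<in> tangent_vectors S F c (y, A y)"
      using section_tangent[OF surf A c y(1)] y(2) by (simp add: a_def)
    have eq: "matrix_inv (A y) ** mat_deriv a x = \<Phi> x"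
      using sp[OF that] y(3) by (simp add: \<Phi>_def matrix_inv_Sp4)
    show "\<Phi> x $ 3 $ 1 = 0" "\<Phi> x $ 4 $ 1 = 0" "\<Phi> x $ 2 $ 1 = \<Phi> x $ 4 $ 2"
      "\<Phi> x $ 1 $ 1 = 3 * \<Phi> x $ 2 $ 2" "\<Phi> x $ 1 $ 2 = 3/4 * \<Phi> x $ 2 $ 4" "\<Phi> x $ 1 $ 4 = 0"
      using six_equations[OF c yF _ tv] y(1) unfolding eq by auto
    have "let \<phi> = matrix_inv (A y) ** mat_deriv a x in \<delta> c y * 1 ^ 4 = \<phi> $ 1 $ 3 * (\<phi> $ 4 $ 2) ^ 3"
      using quart c yF y(1) tv unfolding quartic_differential_def by fast
    then show "\<delta> c (param c x) = \<Phi> x $ 1 $ 3 * \<Phi> x $ 4 $ 2 ^ 3"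
      unfolding eq by (simp add: Let_def y_def)
    \<comment> \<open>Vertical vectors already realize all upper triangular values of the connection.\<close>
    show "\<Phi> x $ 4 $ 2 \<noteq> 0"
    proof
      assume 0: "\<Phi> x $ 4 $ 2 = 0"
      obtain V' where V': "(0, V') \<in> tangent_vectors S F c (y, A y)"
        "curve_eta (matrix_inv (A y) ** V') = curve_eta (matrix_inv (A y) ** mat_deriv a x)"
        using vertical_tangent[OF yF, of c "\<Phi> x $ 2 $ 2" "- complex_of_real (root 3 (3/32)) * \<Phi> x $ 2 $ 4"]
        unfolding eq by (auto simp: curve_eta_def 0)
      have "inj_on (\<lambda>(v, V). curve_eta (matrix_inv (A y) ** V)) (tangent_vectors S F c (y, A y))"
      proof -
        have "\<forall>d\<in>charts S. \<forall>p\<in>fst d. \<forall>A. (p, A) \<in> F \<longrightarrow>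
          bij_betw (\<lambda>(v, V). curve_eta (matrix_inv A ** V)) (tangent_vectors S F d (p, A))
          {X. trace X = 0} \<and>
          (\<forall>(v, V) \<in> tangent_vectors S F d (p, A). \<forall>Y\<in>SL2_1.
           curve_eta (matrix_inv (A ** S_rep Y) ** (V ** S_rep Y)) =
           matrix_inv Y ** curve_eta (matrix_inv A ** V) ** Y)"
          using cart unfolding cartan_connection_def by (elim conjE)
        then have "bij_betw (\<lambda>(v, V). curve_eta (matrix_inv (A y) ** V)) (tangent_vectors S F c (y, A y)) {X. trace X = 0}"
          using c y(1) yF by simp
        then show ?thesis by (rule bij_betw_imp_inj_on)
      qed
      from inj_onD[OF this, of "(0, V')" "(1, mat_deriv a x)"] show False using V' tv by simp
    qed
  qed
  \<comment> \<open>Differentiating \<open>transpose A ** J_mat ** A = J_mat\<close> puts the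
    Maurer-Cartan form into the symplectic Lie algebra.\<close>
  have spalg: "transpose (\<Phi> x) ** J_mat + J_mat ** \<Phi> x = 0" if x: "x \<in> V" for x
  proof -
    have "has_mat_deriv (\<lambda>x. transpose (a x) ** J_mat ** a x) 0 x"
    proof (subst has_mat_deriv_cong[OF _ V x])
      show "transpose (a s) ** J_mat ** a s = J_mat" if "s \<in> V" for s
        using sp[OF that] by (simp add: Sp4_iff)
    qed (rule has_mat_deriv_const)
    moreover have "has_mat_deriv (\<lambda>x. transpose (a x) ** J_mat ** a x)
      (transpose (mat_deriv a x) ** J_mat ** a x + transpose (a x) ** J_mat ** mat_deriv a x) x"
      using has_mat_deriv_mult[OF has_mat_deriv_mult[OF has_mat_deriv_transpose[OF da[OF x]] has_mat_deriv_const] da[OF x]]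
      by simp
    ultimately have z: "transpose (mat_deriv a x) ** J_mat ** a x + transpose (a x) ** J_mat ** mat_deriv a x = 0"
      by (rule has_mat_deriv_unique[rotated])
    have aP: "a x ** \<Phi> x = mat_deriv a x"
      by (simp add: \<Phi>_def matrix_mul_assoc sp_inv_right[OF sp[OF x]])
    have "transpose (\<Phi> x) ** (transpose (a x) ** J_mat ** a x) + (transpose (a x) ** J_mat ** a x) ** \<Phi> x = 0"
      using z unfolding aP[symmetric] by (simp add: matrix_transpose_mul matrix_mul_assoc)
    then show ?thesis using sp[OF x] by (simp add: Sp4_iff)
  qed
  have nf: "\<Phi> x = nf (\<Phi> x $ 2 $ 2) (\<Phi> x $ 4 $ 2) (\<Phi> x $ 2 $ 4) (\<Phi> x $ 1 $ 3)" if x: "x \<in> V" for x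
  proof -
    note z = spalg[OF x, unfolded vec_eq_iff forall_4 matrix_matrix_mult_def sum_4 transpose_def J_mat_def]
    show ?thesis
      unfolding vec_eq_iff forall_4 nf_def vector_4
      using eqs[OF x] z by (simp add: add_eq_0_iff)
  qed
  have fr: "frame_on V a (\<lambda>x. \<Phi> x $ 2 $ 2) (\<lambda>x. \<Phi> x $ 4 $ 2) (\<lambda>x. \<Phi> x $ 2 $ 4) (\<lambda>x. \<Phi> x $ 1 $ 3)"
    unfolding frame_on_def
  proof (intro conjI ballI V)
    fix x assume x: "x \<in> V"
    show "a x \<in> Sp4" "\<Phi> x $ 4 $ 2 \<noteq> 0" using sp inj x by auto
    have "a x ** \<Phi> x = mat_deriv a x"
      by (simp add: \<Phi>_def matrix_mul_assoc sp_inv_right[OF sp[OF x]])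
    then show "has_mat_deriv a (a x ** nf (\<Phi> x $ 2 $ 2) (\<Phi> x $ 4 $ 2) (\<Phi> x $ 2 $ 4) (\<Phi> x $ 1 $ 3)) x"
      using da[OF x] nf[OF x] by simp
  qed
  show ?thesis
  proof (rule that)
    show "frame_on (snd c ` (fst c \<inter> W)) (A \<circ> param c)
       (\<lambda>x. \<Phi> x $ 2 $ 2) (\<lambda>x. \<Phi> x $ 4 $ 2) (\<lambda>x. \<Phi> x $ 2 $ 4) (\<lambda>x. \<Phi> x $ 1 $ 3)"
      using fr by (simp add: V_def a_def)
    show "\<delta> c y = \<Phi> (snd c y) $ 1 $ 3 * \<Phi> (snd c y) $ 4 $ 2 ^ 3" if "y \<in> fst c \<inter> W" for y
      using quartic[of "snd c y"] that C(4) by (auto simp: V_def)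
  qed (use holPhi in \<open>auto simp: V_def\<close>)
qed


text \<open>The vanishing of \<open>p\<close> and \<open>s\<close> imposes two conditions on the two
  functions \<open>r\<close> and \<open>n\<close> of a gauge, and a change of coordinate then makes
  \<open>q\<close> constant. In the resulting chart the quartic differential is \<open>t\<close> up
  to a constant factor, so a frame with these coefficients carries no other invariant.\<close>

lemma adapted_section:
  assumes p0: "p0 \<in> S_star S f g"
  obtains c A t where "c \<in> charts S" "p0 \<in> fst c" "local_section S F (fst c) A"
    "frame_on (snd c ` fst c) (A \<circ> param c) (\<lambda>_. 0) (\<lambda>_. kap) (\<lambda>_. 0) t"
    "t holomorphic_on snd c ` fst c"
    "\<And>y. y \<in> fst c \<Longrightarrow> \<delta> c y = t (snd c y) * kap ^ 3"
proof -
  have "\<forall>p\<in>S_star S f g. \<exists>W A. p \<in> W \<and> local_section S F W A"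
    using principal by (simp add: principal_bundle_def)
  then obtain W A0 where W: "p0 \<in> W" "local_section S F W A0" using p0 by blast
  obtain c0 where c0': "c0 \<in> S" "p0 \<in> fst c0" using atlas_covers[OF surf] .
  have c0: "c0 \<in> charts S" using atlas_subset_charts[OF surf c0'(1)] .
  note C = topological_chartD[OF chartsD[OF c0]]
  define V where "V = snd c0 ` (fst c0 \<inter> W)"
  define a where "a = A0 \<circ> param c0"
  obtain p q s t where fr: "frame_on V a p q s t"
    and hol: "p holomorphic_on V" "q holomorphic_on V" "s holomorphic_on V" "t holomorphic_on V"
    using section_frame[OF W(2) c0] unfolding V_def a_def by metis
  have V: "open V" using fr by (simp add: frame_on_def)
  have q0: "q x \<noteq> 0" if "x \<in> V" for x using fr that by (simp add: frame_on_def)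
  define x0 where "x0 = snd c0 p0"
  have x0: "x0 \<in> V" using W c0' by (auto simp: x0_def V_def)
  \<comment> \<open>The gauge that removes \<open>p\<close> and \<open>s\<close> solves a nonlinear equation for \<open>r\<close>, which \<open>r = 1 / y\<close>
    turns into the linear equation \<open>y'' = \<alpha> y' + \<beta> y\<close>.\<close>
  define \<alpha> where "\<alpha> = (\<lambda>x. deriv q x / q x)"
  define \<beta> where "\<beta> = (\<lambda>x. (p x)\<^sup>2 + deriv p x + s x * q x / 4 - p x * deriv q x / q x)"
  have "\<alpha> analytic_on {x0}" "\<beta> analytic_on {x0}"
    unfolding \<alpha>_def \<beta>_def using x0 V q0
    by (auto intro!: holomorphic_on_imp_analytic_at[OF _ V] holomorphic_intros hol)
  then obtain \<rho> y y1 where ode: "\<rho> > 0" "y x0 = 1"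
    "\<And>z. z \<in> ball x0 \<rho> \<Longrightarrow> (y has_field_derivative y1 z) (at z)"
    "\<And>z. z \<in> ball x0 \<rho> \<Longrightarrow> (y1 has_field_derivative \<alpha> z * y1 z + \<beta> z * y z) (at z)"
    using ode2_solution by metis
  have "isCont y x0" using ode(3)[of x0] ode(1) by (simp add: DERIV_isCont)
  then have "\<forall>\<^sub>F x in nhds x0. y x \<noteq> 0"
    using continuous_at_avoid[of x0 y 0] ode(2) unfolding eventually_nhds_metric
    by (auto simp: dist_commute)
  moreover have "\<forall>\<^sub>F x in nhds x0. x \<in> V" "\<forall>\<^sub>F x in nhds x0. x \<in> ball x0 \<rho>"
    using V x0 ode(1) by (auto simp del: mem_ball intro!: eventually_nhds_in_open)
  ultimately have "\<forall>\<^sub>F x in nhds x0. y x \<noteq> 0 \<and> x \<in> V \<and> x \<in> ball x0 \<rho>"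
    by eventually_elim auto
  then obtain \<rho>1 where \<rho>1: "\<rho>1 > 0" "\<And>x. x \<in> ball x0 \<rho>1 \<Longrightarrow> y x \<noteq> 0 \<and> x \<in> V \<and> x \<in> ball x0 \<rho>"
    unfolding eventually_nhds_metric by (auto simp: dist_commute)
  have dy: "(y has_field_derivative y1 x) (at x)"
    and dy1: "(y1 has_field_derivative \<alpha> x * y1 x + \<beta> x * y x) (at x)" if "x \<in> ball x0 \<rho>1" for x
    using ode \<rho>1(2)[OF that] by blast+
  have hy: "y holomorphic_on ball x0 \<rho>1"
    unfolding holomorphic_on_open[OF open_ball] using dy by blast
  have hqy: "(\<lambda>x. q x / (kap * (y x)\<^sup>2)) holomorphic_on ball x0 \<rho>1"
    using hy \<rho>1(2) kap(1) by (auto intro!: holomorphic_intros holomorphic_on_subset[OF hol(2)])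
  \<comment> \<open>The gauge turns \<open>q\<close> into \<open>q / y\<^sup>2\<close>. Passing to a
    coordinate \<open>w\<close> divides by \<open>w'\<close>, which is chosen so that
    \<open>kap\<close> remains.\<close>
  have "\<exists>w. \<forall>x\<in>ball x0 \<rho>1. (w has_field_derivative q x / (kap * (y x)\<^sup>2)) (at x within ball x0 \<rho>1)"
  proof (rule holomorphic_convex_primitive'[OF convex_ball open_ball hqy])
    fix w assume *: "\<And>x. x \<in> ball x0 \<rho>1 \<Longrightarrow> (w has_field_derivative q x / (kap * (y x)\<^sup>2)) (at x within ball x0 \<rho>1)"
    show ?thesis
      by (rule exI[of _ w], rule ballI, rule *)
  qed
  then obtain w where w: "\<forall>x\<in>ball x0 \<rho>1. (w has_field_derivative q x / (kap * (y x)\<^sup>2)) (at x within ball x0 \<rho>1)" ..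
  have dw: "(w has_field_derivative q x / (kap * (y x)\<^sup>2)) (at x)" if "x \<in> ball x0 \<rho>1" for x
    using bspec[OF w that] at_within_open[OF that open_ball] by simp
  have hw: "w holomorphic_on ball x0 \<rho>1"
    unfolding holomorphic_on_open[OF open_ball] using dw by blast
  have x01: "x0 \<in> ball x0 \<rho>1" using \<rho>1(1) by simp
  have dw0: "deriv w x0 \<noteq> 0"
  proof -
    from DERIV_imp_deriv[OF dw[OF x01]] \<rho>1(2)[OF x01] q0[OF x0] kap(1) show ?thesis by simp
  qed
  obtain \<rho>2 where \<rho>2: "\<rho>2 > 0" "ball x0 \<rho>2 \<subseteq> ball x0 \<rho>1" "inj_on w (ball x0 \<rho>2)"
    by (rule has_complex_derivative_locally_injective[OF hw x01 open_ball dw0])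
  define B where "B = ball x0 \<rho>2"
  have B: "open B" "x0 \<in> B" "B \<subseteq> ball x0 \<rho>1" "B \<subseteq> V" "inj_on w B"
    using \<rho>2 \<rho>1(2) by (auto simp: B_def subset_iff)
  define U where "U = fst c0 \<inter> (W \<inter> (fst c0 \<inter> snd c0 -` B))"
  have Wop: "open W" using W(2) by (simp add: local_section_def)
  have U: "open U" "U \<subseteq> fst c0" "p0 \<in> U" "U \<subseteq> W"
    using chart_preimage_open[OF chartsD[OF c0] B(1)] C(1) Wop c0' W(1) B(2)
    by (auto simp: U_def x0_def)
  have imU: "snd c0 ` U = B"
  proof
    show "B \<subseteq> snd c0 ` U"
    proof
      fix x assume x: "x \<in> B"
      then obtain pp where "pp \<in> fst c0" "pp \<in> W" "x = snd c0 pp" using B(4) by (auto simp: V_def)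
      then show "x \<in> snd c0 ` U" using x by (auto simp: U_def)
    qed
  qed (auto simp: U_def)
  define c where "c = (U, w \<circ> snd c0)"
  have c: "c \<in> charts S"
    unfolding c_def
  proof (rule chartI[OF surf c0 U(1,2)])
    show "w \<circ> snd c0 \<circ> param c0 holomorphic_on snd c0 ` U"
      by (rule holomorphic_transform[of w]) (use holomorphic_on_subset[OF hw B(3)] imU C U(2) in auto)
    show "inj_on (w \<circ> snd c0) U"
      using B(5) imU inj_on_subset[OF C(3) U(2)] by (intro comp_inj_on) auto
  qed
  define r where "r = (\<lambda>x. 1 / y x)"
  \<comment> \<open>This is the corner for which \<open>gauge_eq\<close> gives a vanishing new
    \<open>p\<close> when \<open>r = 1 / y\<close>.\<close>
  define n where "n = (\<lambda>x. 3 * (p x * y x - y1 x) / q x)"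
  have r: "(r has_field_derivative - y1 x / (y x)\<^sup>2) (at x)" "r x \<noteq> 0" if "x \<in> B" for x
  proof -
    have x: "x \<in> ball x0 \<rho>1" using that B by auto
    show "(r has_field_derivative - y1 x / (y x)\<^sup>2) (at x)" "r x \<noteq> 0"
      unfolding r_def using dy[OF x] \<rho>1(2)[OF x]
      by (auto intro!: derivative_eq_intros simp: power2_eq_square)
  qed
  \<comment> \<open>With the new \<open>p\<close> equal to zero, this derivative of \<open>n\<close>
    is exactly the condition that the new \<open>s\<close> vanishes; the linear equation for
    \<open>y\<close> was set up to produce it.\<close>
  have dn: "(n has_field_derivative - n x * p x - 3/4 * s x * y x) (at x)" if "x \<in> B" for x
  proof -
    have x: "x \<in> ball x0 \<rho>1" "x \<in> V" using that B by auto
    note dd = dy[OF x(1)] dy1[OF x(1)] holomorphic_derivI[OF hol(1) V x(2)] holomorphic_derivI[OF hol(2) V x(2)]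
    show ?thesis
      unfolding n_def using q0[OF x(2)]
      apply (auto intro!: derivative_eq_intros dd)
      apply (simp add: \<alpha>_def \<beta>_def field_simps)
      apply (simp add: algebra_simps power2_eq_square)
      done
  qed
  define A where "A = (\<lambda>p. A0 p ** gauge (r (snd c0 p)) (n (snd c0 p)))"
  define b where "b = (\<lambda>x. a x ** gauge (r x) (n x))"
  have bA: "b x = A (param c0 x)" if "x \<in> B" for x
    using that imU C U(2) by (auto simp: b_def a_def A_def)
  have aB: "a x \<in> Sp4" "has_mat_deriv a (a x ** nf (p x) (q x) (s x) (t x)) x" if "x \<in> B" for x
    using fr that B(4) by (auto simp: frame_on_def)
  have fb: "\<exists>t'. has_mat_deriv b (b x ** nf 0 (q x / (y x)\<^sup>2) 0 t') x" if x: "x \<in> B" for x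
  proof -
    have x': "x \<in> V" "x \<in> ball x0 \<rho>1" using x B by auto
    have yq: "y x \<noteq> 0" "q x \<noteq> 0" using \<rho>1(2)[OF x'(2)] q0[OF x'(1)] by auto
    have 1: "p x + - y1 x / (y x)\<^sup>2 * (1 / r x) - r x * n x * q x / 3 = 0"
      using yq by (simp add: r_def n_def field_simps power2_eq_square)
    have 2: "(r x)\<^sup>2 * q x = q x / (y x)\<^sup>2"
      using yq by (simp add: r_def power_divide)
    have 3: "2 * p x + - y1 x / (y x)\<^sup>2 * (1 / r x) - r x * n x * q x / 3 = p x"
      using 1 by (simp add: algebra_simps)
    have 4: "4/3 * n x * (1 / r x) * p x + s x * (1 / r x)\<^sup>2 + 4/3 * (- n x * p x - 3/4 * s x * y x) * (1 / r x) = 0"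
      by (simp add: r_def algebra_simps power2_eq_square)
    show ?thesis
      using frame_gauge[of a x "p x" "q x" "s x" "t x" r _ n, OF aB[OF x] r[OF x] dn[OF x]]
      unfolding 1 2 3 4 b_def by blast
  qed
  have secA: "local_section S F U A"
    unfolding local_section_def
  proof (intro conjI ballI U)
    show "(pp, A pp) \<in> F" if "pp \<in> U" for pp
      unfolding A_def
    proof (rule in_F_gauge)
      show "(pp, A0 pp) \<in> F" using W(2) U(4) that by (auto simp: local_section_def)
      have "snd c0 pp \<in> B" using that imU by blast
      then show "r (snd c0 pp) \<noteq> 0" by (rule r)
    qed
    show "holomorphic_mat_on S U A"
      unfolding holomorphic_mat_on_def
    proof (intro allI surface_holomorphic_onI[OF surf U(1)] bexI[OF _ c0] conjI)
      fix i j pp assume pp: "pp \<in> U"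
      then show "pp \<in> fst c0" using U by auto
      have "(\<lambda>x. b x $ i $ j) holomorphic_on B"
        unfolding holomorphic_on_open[OF B(1)]
      proof
        fix x assume "x \<in> B"
        from fb[OF this] obtain E where "has_mat_deriv b E x" by blast
        then show "\<exists>e. ((\<lambda>x. b x $ i $ j) has_field_derivative e) (at x)"
          unfolding has_mat_deriv_def by blast
      qed
      then show "(\<lambda>p. A p $ i $ j) \<circ> param c0 holomorphic_on snd c0 ` (fst c0 \<inter> U)"
        unfolding Int_absorb1[OF U(2)] imU
        by (rule holomorphic_transform) (simp add: bA)
    qed
  qed
  \<comment> \<open>Feeding the new section back into \<open>section_frame\<close> yields
    holomorphic coefficients and the formula for \<open>\<delta>\<close> in the new chart.
    Comparison with the derivative of \<open>b\<close> in the old coordinate then identifies three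
    of the coefficients.\<close>
  obtain pc qc sc tc where fc: "frame_on (snd c ` fst c) (A \<circ> param c) pc qc sc tc"
    and tc: "tc holomorphic_on snd c ` fst c"
    and dc: "\<And>y. y \<in> fst c \<Longrightarrow> \<delta> c y = tc (snd c y) * qc (snd c y) ^ 3"
    proof -
    have "fst c \<inter> U = fst c" by (simp add: c_def)
    then show ?thesis using section_frame[OF secA c] that by metis
  qed
  note CC = topological_chartD[OF chartsD[OF c]]
  have pqs: "pc z = 0 \<and> qc z = kap \<and> sc z = 0" if z: "z \<in> snd c ` fst c" for z
  proof -
    obtain x where x: "x \<in> B" "z = w x" using z imU by (auto simp: c_def)
    let ?w' = "q x / (kap * (y x)\<^sup>2)"
    have x': "x \<in> V" "x \<in> ball x0 \<rho>1" using x B by auto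
    have yq: "y x \<noteq> 0" "q x \<noteq> 0" using \<rho>1(2)[OF x'(2)] q0[OF x'(1)] by auto
    have fz: "has_mat_deriv (A \<circ> param c) ((A \<circ> param c) z ** nf (pc z) (qc z) (sc z) (tc z)) z"
      using fc z unfolding frame_on_def by blast
    have eq: "(A \<circ> param c) (w x') = b x'" if x': "x' \<in> B" for x'
    proof -
      obtain pp where pp: "pp \<in> U" "x' = snd c0 pp" using x' imU by auto
      have "param c (w x') = pp" using CC(4)[of pp] pp by (simp add: c_def)
      then show ?thesis using bA[OF x'] pp C(4) U(2) by auto
    qed
    have "has_mat_deriv (\<lambda>x. (A \<circ> param c) (w x)) ((A \<circ> param c) (w x) ** nf (?w' * pc z) (?w' * qc z) (?w' * sc z) (?w' * tc z)) x"
      using frame_chain[OF _ dw[OF x'(2)]] fz x(2) by blast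
    then have 1: "has_mat_deriv b (b x ** nf (?w' * pc z) (?w' * qc z) (?w' * sc z) (?w' * tc z)) x"
      using has_mat_deriv_cong[of B "\<lambda>x. (A \<circ> param c) (w x)" b, OF eq B(1) x(1)] eq[OF x(1)] by simp
    obtain t' where 2: "has_mat_deriv b (b x ** nf 0 (q x / (y x)\<^sup>2) 0 t') x" using fb[OF x(1)] by blast
    have "b x \<in> Sp4" unfolding b_def by (intro Sp4_mult aB x gauge_Sp4 r)
    then have "nf (?w' * pc z) (?w' * qc z) (?w' * sc z) (?w' * tc z) = nf 0 (q x / (y x)\<^sup>2) 0 t'"
      using has_mat_deriv_unique[OF 1 2] Sp4_cancel by blast
    then show ?thesis
      unfolding nf_inject using yq kap(1) by (auto simp: field_simps)
  qed
  show ?thesis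
  proof (rule that[OF c])
    show "p0 \<in> fst c" "local_section S F (fst c) A" using U secA by (auto simp: c_def)
    show "frame_on (snd c ` fst c) (A \<circ> param c) (\<lambda>_. 0) (\<lambda>_. kap) (\<lambda>_. 0) tc"
      using fc pqs by (auto simp: frame_on_def)
    show "\<delta> c y = tc (snd c y) * kap ^ 3" if "y \<in> fst c" for y
      using dc[OF that] pqs that by auto
  qed (rule tc)
qed

lemma frame_adapted:
  assumes "c \<in> charts S" "local_section S F (fst c) A"
    "frame_on (snd c ` fst c) (A \<circ> param c) (\<lambda>_. 0) (\<lambda>_. kap) (\<lambda>_. 0) t"
  shows "adapted_chart S F curve_eta c"
  unfolding adapted_chart_def
proof (intro conjI exI ballI)
  fix p assume "p \<in> fst c"
  then have "maurer_cartan (A \<circ> param c) (snd c p) = nf 0 kap 0 (t (snd c p))"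
    using assms(3) by (intro maurer_cartan_eqI) (auto simp: frame_on_def)
  then show "curve_eta (maurer_cartan (A \<circ> param c) (snd c p)) = vector [vector [0, 0], vector [1, 0]]"
    using kap(2) by (simp add: curve_eta_def nf_def)
qed (use assms in auto)

end

section \<open>Continuation of Lagrangian planes\<close>

lemma eventually_at_chart:
  assumes c: "topological_chart c" and p: "p \<in> fst c"
  shows "(\<forall>\<^sub>F q in at p. P q) \<longleftrightarrow> (\<forall>\<^sub>F x in at (snd c p). P (param c x))"
proof
  note C = topological_chartD[OF c]
  show "\<forall>\<^sub>F x in at (snd c p). P (param c x)" if ev: "\<forall>\<^sub>F q in at p. P q"
  proof -
    obtain N where N: "open N" "p \<in> N" "\<forall>q\<in>N. q \<noteq> p \<longrightarrow> P q"
      using ev unfolding eventually_at_topological by blast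
    show ?thesis
      unfolding eventually_at_topological
      by (rule exI[of _ "snd c ` (fst c \<inter> N)"]) (use N p C chart_image_open[OF c N(1)] in auto)
  qed
  show "\<forall>\<^sub>F q in at p. P q" if ev: "\<forall>\<^sub>F x in at (snd c p). P (param c x)"
  proof -
    obtain V where V: "open V" "snd c p \<in> V" "\<forall>x\<in>V. x \<noteq> snd c p \<longrightarrow> P (param c x)"
      using ev unfolding eventually_at_topological by blast
    have "P q" if "q \<in> fst c \<inter> snd c -` V" "q \<noteq> p" for q
      using V(3)[rule_format, of "snd c q"] that C(3,4) p by (auto simp: inj_on_def)
    then show ?thesis
      unfolding eventually_at_topological
      using chart_preimage_open[OF c V(1)] V(2) p by blast
  qed
qed

text \<open>Charts have open images in the plane, so no point is isolated. This is what allows a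
  property holding near a point to be realized at some other point.\<close>

lemma surface_at_neq_bot:
  fixes T :: "('t::t2_space) chart set"
  assumes "riemann_surface T" shows "at (p::'t) \<noteq> bot"
proof -
  obtain e where e: "e \<in> T" "p \<in> fst e" using atlas_covers[OF assms] .
  show ?thesis
    using eventually_at_chart[OF chartsD[OF atlas_subset_charts[OF assms e(1)]] e(2), of "\<lambda>_. False"]
    by (simp add: eventually_False)
qed

text \<open>Three pairwise orthogonal vectors are dependent: up to sign, their four 3x3 minors are
  the coordinates of \<open>omega u v * y - omega u y * v + omega v y * u\<close>. Expanding a minor
  gives Cramer's rule for \<open>y\<close> in terms of \<open>u\<close> and
  \<open>v\<close>.\<close>

lemma minors_vanish:
  fixes u v y :: "complex^4"
  assumes "omega u v = 0" "omega u y = 0" "omega v y = 0"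
  shows "(u $ i * v $ j - u $ j * v $ i) * y $ k =
    (y $ i * v $ j - y $ j * v $ i) * u $ k + (u $ i * y $ j - u $ j * y $ i) * v $ k"
proof -
  define D where "D = (\<lambda>i j k. u $ i * (v $ j * y $ k - v $ k * y $ j) -
    u $ j * (v $ i * y $ k - v $ k * y $ i) + u $ k * (v $ i * y $ j - v $ j * y $ i))"
  note e = assms[unfolded omega_def]
  have perm: "D b a c = - D a b c \<and> D a c b = - D a b c \<and> D c b a = - D a b c \<and> D b c a = D a b c \<and> D c a b = D a b c"
    for a b c by (simp add: D_def algebra_simps)
  have rep: "D a a b = 0" "D a b a = 0" "D b a a = 0" for a b by (simp_all add: D_def algebra_simps)
  have base: "D 1 2 3 = 0" "D 1 2 4 = 0" "D 1 3 4 = 0" "D 2 3 4 = 0"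
    unfolding D_def using e by algebra+
  note ps = perm[of 2 1 3, unfolded base minus_zero] perm[of 2 1 4, unfolded base minus_zero]
      perm[of 3 1 4, unfolded base minus_zero] perm[of 3 2 4, unfolded base minus_zero]
  have "\<forall>i j k. D i j k = 0"
    unfolding forall_4 by (simp only: rep ps base simp_thms)
  then have "D i j k = 0" by blast
  moreover have "(u $ i * v $ j - u $ j * v $ i) * y $ k -
    ((y $ i * v $ j - y $ j * v $ i) * u $ k + (u $ i * y $ j - u $ j * y $ i) * v $ k) = D i j k"
    by (simp add: D_def algebra_simps)
  ultimately show ?thesis by simp
qed

text \<open>Some 2x2 minor of \<open>u\<close> and \<open>v\<close> is nonzero, as otherwise both
  would lie on one line. \<open>minors_vanish\<close> then yields the coefficients of
  \<open>y\<close>, with this minor as denominator.\<close>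

lemma lagrangian_perp:
  assumes dim: "vec.dim (vec.span {u, v}) = 2"
    and om: "omega u v = 0" "omega u y = 0" "omega v y = 0"
  shows "y \<in> vec.span {u, v}"
proof -
  have "\<exists>i j. u $ i * v $ j - u $ j * v $ i \<noteq> 0"
  proof (rule ccontr)
    assume "\<not> ?thesis"
    then have m: "u $ i * v $ j = u $ j * v $ i" for i j by auto
    have "\<exists>w. vec.span {u, v} \<subseteq> vec.span {w}"
    proof (cases "u = 0")
      case True
      then show ?thesis by (intro exI[of _ v]) (simp add: vec.span_insert_0)
    next
      case False
      then obtain i where i: "u $ i \<noteq> 0" by (auto simp: vec_eq_iff)
      have "v = (v $ i / u $ i) *s u"
        using m[of i] i by (simp add: vec_eq_iff field_simps)
      then have "v \<in> vec.span {u}" by (metis singletonI vec.span_base vec.span_scale)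
      then show ?thesis by (intro exI[of _ u] vec.span_minimal) (auto intro: vec.span_base)
    qed
    then obtain w where "vec.span {u, v} \<subseteq> vec.span {w}" by blast
    then have "vec.dim (vec.span {u, v}) \<le> card {w}" by (intro vec.dim_le_card) auto
    then show False using dim by simp
  qed
  then obtain i j where ij: "u $ i * v $ j - u $ j * v $ i \<noteq> 0" by blast
  let ?m = "u $ i * v $ j - u $ j * v $ i"
  have "y = ((y $ i * v $ j - y $ j * v $ i) / ?m) *s u + ((u $ i * y $ j - u $ j * y $ i) / ?m) *s v"
    unfolding vec_eq_iff
  proof
    fix k
    have "y $ k = (?m * y $ k) / ?m" using ij by simp
    also have "\<dots> = ((y $ i * v $ j - y $ j * v $ i) * u $ k + (u $ i * y $ j - u $ j * y $ i) * v $ k) / ?m"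
      by (simp only: minors_vanish[OF om])
    finally show "y $ k = (((y $ i * v $ j - y $ j * v $ i) / ?m) *s u + ((u $ i * y $ j - u $ j * y $ i) / ?m) *s v) $ k"
      by (simp add: add_divide_distrib)
  qed
  then show ?thesis unfolding span_pair by blast
qed

text \<open>A Lagrangian plane is its own orthogonal complement, so an equality of planes amounts to
  four scalar equations. These depend holomorphically on a point of the curve, which makes them
  accessible to analytic continuation.\<close>

lemma lagrangian_image_eq:
  assumes X: "X \<in> Sp4" and P: "vec.dim P = 2" "P = vec.span {u1, u2}" "\<forall>x\<in>P. \<forall>y\<in>P. omega x y = 0"
    and Q: "vec.dim Q = 2" "Q = vec.span {v1, v2}" "\<forall>x\<in>Q. \<forall>y\<in>Q. omega x y = 0"
  shows "P = (\<lambda>v. X *v v) ` Q \<longleftrightarrow>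
    omega (X *v v1) u1 = 0 \<and> omega (X *v v1) u2 = 0 \<and> omega (X *v v2) u1 = 0 \<and> omega (X *v v2) u2 = 0"
proof -
  have mem: "u1 \<in> P" "u2 \<in> P" "v1 \<in> Q" "v2 \<in> Q" using P(2) Q(2) by (auto intro: vec.span_base)
  have skew: "omega x y = - omega y x" for x y by (simp add: omega_def)
  have lin: "X *v (a *s x + b *s y) = a *s (X *v x) + b *s (X *v y)" for a b x y
    by (simp add: matrix_vector_right_distrib vector_scalar_commute)
  have Xi: "omega (X *v x) y = omega x (sp_inv X *v y)" for x y
  proof -
    have "omega (X *v x) y = omega (X *v x) (X *v (sp_inv X *v y))"
      by (simp add: matrix_vector_mul_assoc sp_inv_right[OF X])
    then show ?thesis using X by (simp add: Sp4_def)
  qed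
  show ?thesis
  proof
    assume "P = (\<lambda>v. X *v v) ` Q"
    then have "X *v v1 \<in> P" "X *v v2 \<in> P" using mem by auto
    then show "omega (X *v v1) u1 = 0 \<and> omega (X *v v1) u2 = 0 \<and> omega (X *v v2) u1 = 0 \<and> omega (X *v v2) u2 = 0"
      using P(3) mem by blast
  next
    assume *: "omega (X *v v1) u1 = 0 \<and> omega (X *v v1) u2 = 0 \<and> omega (X *v v2) u1 = 0 \<and> omega (X *v v2) u2 = 0"
    have z: "omega (X *v x) y = 0" if "x \<in> Q" "y \<in> P" for x y
      using that * unfolding P(2) Q(2) span_pair by (auto simp: lin omega_bilinear)
    show "P = (\<lambda>v. X *v v) ` Q"
    proof
      show "(\<lambda>v. X *v v) ` Q \<subseteq> P"
      proof
        fix x assume "x \<in> (\<lambda>v. X *v v) ` Q"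
        then obtain w where "w \<in> Q" "x = X *v w" by blast
        then have "omega x u1 = 0" "omega x u2 = 0" using z mem by simp_all
        then have "omega u1 x = 0" "omega u2 x = 0" using skew[of u1 x] skew[of u2 x] by simp_all
        moreover have "omega u1 u2 = 0" using P(3) mem by blast
        ultimately show "x \<in> P" using lagrangian_perp P(1) unfolding P(2) by blast
      qed
      show "P \<subseteq> (\<lambda>v. X *v v) ` Q"
      proof
        fix y assume "y \<in> P"
        then have "omega v1 (sp_inv X *v y) = 0" "omega v2 (sp_inv X *v y) = 0"
          using z[OF mem(3)] z[OF mem(4)] unfolding Xi by blast+
        moreover have "omega v1 v2 = 0" using Q(3) mem by blast
        ultimately have "sp_inv X *v y \<in> Q" using lagrangian_perp Q(1) unfolding Q(2) by blast
        moreover have "y = X *v (sp_inv X *v y)" by (simp add: matrix_vector_mul_assoc sp_inv_right[OF X])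
        ultimately show "y \<in> (\<lambda>v. X *v v) ` Q" by blast
      qed
    qed
  qed
qed

lemma holomorphic_subspace_map_2E:
  assumes "holomorphic_subspace_map S 2 G"
  obtains W u v where "open W" "p \<in> W" "holomorphic_vec_on S W u" "holomorphic_vec_on S W v"
    "\<forall>q\<in>W. vec.dim (G q) = 2" "\<forall>q\<in>W. G q = vec.span {u q, v q}"
proof -
  have im2: "(\<lambda>i. w i) ` {..<2::nat} = {w 0, w 1}" for w :: "nat \<Rightarrow> complex^4"
    by (auto simp: numeral_2_eq_2 lessThan_Suc)
  have "\<exists>W u. open W \<and> p \<in> W \<and> (\<forall>i<2. holomorphic_vec_on S W (u i)) \<and>
      (\<forall>q\<in>W. vec.dim (G q) = 2 \<and> G q = vec.span ((\<lambda>i. u i q) ` {..<2::nat}))"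
    using assms unfolding holomorphic_subspace_map_def by (rule spec)
  then show ?thesis
  proof (elim exE conjE)
    fix W u
    assume *: "open W" "p \<in> W" "\<forall>i<2. holomorphic_vec_on S W (u i)"
      "\<forall>q\<in>W. vec.dim (G q) = 2 \<and> G q = vec.span ((\<lambda>i. u i q) ` {..<2::nat})"
    show ?thesis
    proof (rule that[OF *(1,2)])
      show "holomorphic_vec_on S W (u 0)" "holomorphic_vec_on S W (u 1)" using *(3) by simp_all
      show "\<forall>q\<in>W. vec.dim (G q) = 2" using *(4) by blast
      show "\<forall>q\<in>W. G q = vec.span {u 0 q, u 1 q}"
      proof
        fix q assume "q \<in> W"
        with *(4) have "G q = vec.span ((\<lambda>i. u i q) ` {..<2::nat})" by blast
        then show "G q = vec.span {u 0 q, u 1 q}" unfolding im2 .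
      qed
    qed
  qed
qed

text \<open>The set of points near which the planes agree is open by its definition. It is closed
  because on a coordinate ball the agreement is the vanishing of four holomorphic functions, to
  which the identity theorem applies.\<close>

lemma planes_continuation:
  fixes T :: "('t::t2_space) chart set"
  assumes T: "riemann_surface T" and S: "riemann_surface S" and conn: "connected (UNIV :: 't set)"
    and g: "\<And>p. g p \<in> lagrangian_planes" "holomorphic_subspace_map T 2 g"
    and f: "\<And>p. f p \<in> lagrangian_planes" "holomorphic_subspace_map S 2 f"
    and h: "holomorphic_map T S h" and X: "X \<in> Sp4"
    and N0: "open N0" "N0 \<noteq> {}" "\<And>p. p \<in> N0 \<Longrightarrow> g p = (\<lambda>v. X *v v) ` f (h p)"
  shows "g (p::'t) = (\<lambda>v. X *v v) ` f (h p)"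
proof -
  let ?eq = "\<lambda>p. g p = (\<lambda>v. X *v v) ` f (h p)"
  define E where "E = {p. \<forall>\<^sub>F q in nhds p. ?eq q}"
  have loc: "\<exists>N. open N \<and> p \<in> N \<and> (N \<inter> E \<noteq> {} \<longrightarrow> (\<forall>q\<in>N. ?eq q))" for p
  proof -
    obtain W1 u0 u1 where u: "open W1" "p \<in> W1" "holomorphic_vec_on T W1 u0" "holomorphic_vec_on T W1 u1"
      "\<forall>q\<in>W1. vec.dim (g q) = 2" "\<forall>q\<in>W1. g q = vec.span {u0 q, u1 q}"
      by (rule holomorphic_subspace_map_2E[OF g(2)])
    obtain W2 v0 v1 where v: "open W2" "h p \<in> W2" "holomorphic_vec_on S W2 v0" "holomorphic_vec_on S W2 v1"
      "\<forall>q\<in>W2. vec.dim (f q) = 2" "\<forall>q\<in>W2. f q = vec.span {v0 q, v1 q}"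
      by (rule holomorphic_subspace_map_2E[OF f(2)])
    obtain e where e': "e \<in> T" "p \<in> fst e" using atlas_covers[OF T] .
    have e: "e \<in> charts T" using atlas_subset_charts[OF T e'(1)] .
    note E = topological_chartD[OF chartsD[OF e]]
    have cont: "continuous_on UNIV h" using h by (simp add: holomorphic_map_def)
    have W: "open (W1 \<inter> h -` W2)" using u v open_vimage[OF _ cont] by auto
    define V where "V = snd e ` (fst e \<inter> (W1 \<inter> h -` W2))"
    have V: "open V" "snd e p \<in> V" using chart_image_open[OF chartsD[OF e] W] u v e' by (auto simp: V_def)
    then obtain \<rho> where \<rho>: "\<rho> > 0" "ball (snd e p) \<rho> \<subseteq> V" using openE by blast
    define B where "B = ball (snd e p) \<rho>"
    define N where "N = fst e \<inter> snd e -` B"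
    have N: "open N" "p \<in> N" using chart_preimage_open[OF chartsD[OF e], of B] e' \<rho> by (auto simp: N_def B_def)
    have NW: "q \<in> W1" "h q \<in> W2" if "q \<in> N" for q
    proof -
      have "snd e q \<in> V" using that \<rho> by (auto simp: N_def B_def)
      then obtain q' where "q' \<in> fst e" "q' \<in> W1" "h q' \<in> W2" "snd e q = snd e q'" by (auto simp: V_def)
      then show "q \<in> W1" "h q \<in> W2" using E(3) that by (auto simp: N_def inj_on_def)
    qed
    have hu: "(\<lambda>x. u (param e x) $ k) holomorphic_on B" if "holomorphic_vec_on T W1 u" for u k
    proof -
      have "(\<lambda>q. u q $ k) \<circ> param e holomorphic_on snd e ` (fst e \<inter> W1)"
        using surface_holomorphic_on_chart[OF T e _ u(1)] that by (simp add: holomorphic_vec_on_def)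
      then show ?thesis unfolding comp_def
        by (rule holomorphic_on_subset) (use \<rho> in \<open>auto simp: B_def V_def\<close>)
    qed
    have hv: "(\<lambda>x. v (h (param e x)) $ k) holomorphic_on B" if "holomorphic_vec_on S W2 v" for v k
    proof -
      have "surface_holomorphic_on S W2 (\<lambda>q. v q $ k)" using that by (simp add: holomorphic_vec_on_def)
      from surface_holomorphic_on_chart[OF T e surface_holomorphic_on_compose[OF T S h this v(1)] open_vimage[OF v(1) cont]]
      have "((\<lambda>q. v q $ k) \<circ> h) \<circ> param e holomorphic_on snd e ` (fst e \<inter> h -` W2)" .
      then show ?thesis unfolding comp_def
        by (rule holomorphic_on_subset) (use \<rho> in \<open>auto simp: B_def V_def\<close>)
    qed
    \<comment> \<open>The common zeros of these functions are the points of the coordinate ball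
      where the planes agree.\<close>
    define \<Phi> where "\<Phi> = {\<lambda>x. omega (X *v v (h (param e x))) (u (param e x)) |u v. u \<in> {u0, u1} \<and> v \<in> {v0, v1}}"
    have hphi: "\<phi> holomorphic_on B" if "\<phi> \<in> \<Phi>" for \<phi>
    proof -
      obtain u' v' where uv: "u' \<in> {u0, u1}" "v' \<in> {v0, v1}"
        and \<phi>: "\<phi> = (\<lambda>x. omega (X *v v' (h (param e x))) (u' (param e x)))"
        using \<open>\<phi> \<in> \<Phi>\<close> by (auto simp: \<Phi>_def)
      have "holomorphic_vec_on T W1 u'" "holomorphic_vec_on S W2 v'" using uv u v by auto
      note hh = hu[OF this(1)] hv[OF this(2)]
      show ?thesis
        unfolding \<phi> omega_def matrix_vector_mult_def sum_4 vec_lambda_beta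
        by (intro holomorphic_intros hh)
    qed
    have equiv: "?eq q \<longleftrightarrow> (\<forall>\<phi>\<in>\<Phi>. \<phi> (snd e q) = 0)" if q: "q \<in> N" for q
    proof -
      have par: "param e (snd e q) = q" using E(4) q by (simp add: N_def)
      have 1: "vec.dim (g q) = 2" "g q = vec.span {u0 q, u1 q}" "\<forall>x\<in>g q. \<forall>y\<in>g q. omega x y = 0"
        using u(5,6) NW[OF q] g(1)[of q] by (auto simp: lagrangian_planes_def)
      have 2: "vec.dim (f (h q)) = 2" "f (h q) = vec.span {v0 (h q), v1 (h q)}" "\<forall>x\<in>f (h q). \<forall>y\<in>f (h q). omega x y = 0"
        using v(5,6) NW[OF q] f(1)[of "h q"] by (auto simp: lagrangian_planes_def)
      have "(\<forall>\<phi>\<in>\<Phi>. \<phi> (snd e q) = 0) \<longleftrightarrow> (\<forall>u\<in>{u0, u1}. \<forall>v\<in>{v0, v1}. omega (X *v v (h q)) (u q) = 0)"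
        unfolding \<Phi>_def using par by (auto; metis)
      then show ?thesis
        using lagrangian_image_eq[OF X 1 2] by auto
    qed
    have "\<forall>q\<in>N. ?eq q" if ne: "N \<inter> E \<noteq> {}"
    proof -
      obtain q0 where q0: "q0 \<in> N" "\<forall>\<^sub>F q in nhds q0. ?eq q" using ne by (auto simp: E_def)
      then obtain M where M: "open M" "q0 \<in> M" "\<forall>q\<in>M. ?eq q" unfolding eventually_nhds by blast
      define V' where "V' = snd e ` (fst e \<inter> (M \<inter> N))"
      have V': "open V'" "V' \<noteq> {}" "V' \<subseteq> B"
        using chart_image_open[OF chartsD[OF e], of "M \<inter> N"] M N q0 by (auto simp: V'_def N_def)
      have z: "\<phi> x = 0" if "x \<in> V'" "\<phi> \<in> \<Phi>" for x \<phi>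
        using that M(3) equiv by (auto simp: V'_def)
      have "\<phi> x = 0" if x: "x \<in> B" and \<phi>: "\<phi> \<in> \<Phi>" for \<phi> x
        by (rule analytic_continuation_open[OF V'(1) _ V'(2) _ V'(3) hphi[OF \<phi>] _ _ x, of "\<lambda>_. 0"])
          (use z \<phi> in \<open>auto simp: B_def\<close>)
      then show ?thesis using equiv by (auto simp: N_def)
    qed
    then show ?thesis using N by blast
  qed
  have "open E"
    unfolding open_subopen[of E]
  proof
    fix x assume "x \<in> E"
    then obtain M where "open M" "x \<in> M" "\<forall>q\<in>M. ?eq q" unfolding E_def eventually_nhds by blast
    then show "\<exists>T. open T \<and> x \<in> T \<and> T \<subseteq> E" unfolding E_def eventually_nhds by blast
  qed
  moreover have "open (- E)"
    unfolding open_subopen[of "- E"]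
  proof
    fix x assume x: "x \<in> - E"
    obtain N where N: "open N" "x \<in> N" "N \<inter> E \<noteq> {} \<longrightarrow> (\<forall>q\<in>N. ?eq q)" using loc by blast
    have "N \<inter> E = {}"
    proof (rule ccontr)
      assume "N \<inter> E \<noteq> {}"
      then have "x \<in> E" using N unfolding E_def eventually_nhds by blast
      then show False using x by simp
    qed
    then show "\<exists>T. open T \<and> x \<in> T \<and> T \<subseteq> - E" using N by blast
  qed
  moreover have "E \<noteq> {}" using N0 unfolding E_def eventually_nhds by blast
  ultimately have "E = UNIV"
    using connectedD[OF conn, of E "- E"] by auto
  then show ?thesis unfolding E_def eventually_nhds by blast
qed

section \<open>Pullbacks under holomorphic maps of surfaces\<close>

lemma eventually_at_open:
  assumes "\<forall>\<^sub>F q in at p. P q"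
  obtains N where "open N" "p \<in> N" "\<forall>q\<in>N. q \<noteq> p \<longrightarrow> P q"
  using assms unfolding eventually_at_topological by blast

lemma eventually_at_in_open': "open N \<Longrightarrow> p \<in> N \<Longrightarrow> \<forall>\<^sub>F q in at p. q \<in> N"
  unfolding eventually_at_topological by blast

text \<open>Used to move to another base point without losing a property that holds near the old
  one.\<close>

lemma eventually_at_eventually:
  assumes "\<forall>\<^sub>F q in at (p::'a::t1_space). P q"
  shows "\<forall>\<^sub>F q0 in at p. P q0 \<and> (\<forall>\<^sub>F q in at q0. P q)"
proof -
  obtain N where N: "open N" "p \<in> N" "\<forall>q\<in>N. q \<noteq> p \<longrightarrow> P q"
    by (rule eventually_at_open[OF assms])
  have "P q0 \<and> (\<forall>\<^sub>F q in at q0. P q)" if "q0 \<in> N" "q0 \<noteq> p" for q0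
  proof -
    have "\<forall>\<^sub>F q in at q0. q \<in> N - {p}"
      using N(1) that by (intro eventually_at_in_open') auto
    then have "\<forall>\<^sub>F q in at q0. P q" by eventually_elim (use N(3) in auto)
    then show ?thesis using N(3) that by blast
  qed
  then show ?thesis using N unfolding eventually_at_topological by blast
qed

lemma meromorphic_eventually_0_or_nonzero:
  assumes "f meromorphic_on {x}"
  shows "(\<forall>\<^sub>F z in at x. f z = 0) \<or> (\<forall>\<^sub>F z in at x. f z \<noteq> 0)"
  using not_essential_frequently_0_imp_eventually_0[of f x] assms
  unfolding meromorphic_at_iff frequently_def by blast

locale surface_map =
  fixes T :: "('t::t2_space) chart set" and S :: "('s::t2_space) chart set" and h :: "'t \<Rightarrow> 's"
  assumes T: "riemann_surface T" and S: "riemann_surface S" and h: "holomorphic_map T S h"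
begin

lemma continuous: "continuous_on UNIV h"
  using h by (simp add: holomorphic_map_def)

lemma open_preimage: "open N \<Longrightarrow> open (h -` N)"
  using open_vimage continuous by blast

lemma rep_holomorphic:
  assumes "c \<in> charts T" "d \<in> charts S"
  shows "(snd d \<circ> h \<circ> param c) holomorphic_on snd c ` (fst c \<inter> h -` fst d)"
    "open (snd c ` (fst c \<inter> h -` fst d))"
  using holomorphic_map_chart[OF T S h assms] chart_image_open[OF chartsD[OF assms(1)]]
    open_preimage[OF topological_chartD(1)[OF chartsD[OF assms(2)]]] by auto

lemma rep_has_derivative:
  assumes "c \<in> charts T" "d \<in> charts S" "q \<in> fst c" "h q \<in> fst d"
  shows "((snd d \<circ> h \<circ> param c) has_field_derivative deriv (snd d \<circ> h \<circ> param c) (snd c q)) (at (snd c q))"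
  using rep_holomorphic[OF assms(1,2)] assms(3,4) by (intro holomorphic_derivI) auto

lemma trans_has_derivative:
  assumes "riemann_surface R" "c \<in> charts R" "c' \<in> charts R" "q \<in> fst c" "q \<in> fst c'"
  shows "((snd c \<circ> param c') has_field_derivative deriv (snd c \<circ> param c') (snd c' q)) (at (snd c' q))"
  using transition_holomorphic[OF assms(1,3,2)] assms(4,5)
    chart_image_open[OF chartsD[OF assms(3)] topological_chartD(1)[OF chartsD[OF assms(2)]]]
  by (intro holomorphic_derivI) auto

lemma deriv_change:
  assumes c: "c \<in> charts T" "c' \<in> charts T" "q \<in> fst c" "q \<in> fst c'"
    and d: "d \<in> charts S" "d' \<in> charts S" "h q \<in> fst d" "h q \<in> fst d'"
  shows "deriv (snd d' \<circ> h \<circ> param c') (snd c' q) =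
    deriv (snd d' \<circ> param d) (snd d (h q)) * (deriv (snd d \<circ> h \<circ> param c) (snd c q) *
      deriv (snd c \<circ> param c') (snd c' q))"
proof (rule DERIV_imp_deriv)
  note C = topological_chartD[OF chartsD[OF c(1)]] and C' = topological_chartD[OF chartsD[OF c(2)]]
    and D = topological_chartD[OF chartsD[OF d(1)]] and D' = topological_chartD[OF chartsD[OF d(2)]]
  have 1: "((snd c \<circ> param c') has_field_derivative deriv (snd c \<circ> param c') (snd c' q)) (at (snd c' q))"
    by (rule trans_has_derivative[OF T c])
  have e1: "(snd c \<circ> param c') (snd c' q) = snd c q" using C'(4) c by simp
  have 2: "((snd d \<circ> h \<circ> param c) has_field_derivative deriv (snd d \<circ> h \<circ> param c) (snd c q)) (at ((snd c \<circ> param c') (snd c' q)))"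
    unfolding e1 by (rule rep_has_derivative[OF c(1) d(1) c(3) d(3)])
  note 3 = DERIV_chain[OF 2 1]
  have e2: "((snd d \<circ> h \<circ> param c) \<circ> (snd c \<circ> param c')) (snd c' q) = snd d (h q)"
    using C'(4) C(4) c by simp
  have 4: "((snd d' \<circ> param d) has_field_derivative deriv (snd d' \<circ> param d) (snd d (h q)))
      (at (((snd d \<circ> h \<circ> param c) \<circ> (snd c \<circ> param c')) (snd c' q)))"
    unfolding e2 by (rule trans_has_derivative[OF S d(2,1,4,3)])
  note 5 = DERIV_chain[OF 4 3]
  define N where "N = fst c' \<inter> (fst c \<inter> h -` (fst d \<inter> fst d'))"
  have op: "open (fst c \<inter> h -` (fst d \<inter> fst d'))"
    by (intro open_Int C(1) open_preimage D(1) D'(1))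
  show "((snd d' \<circ> h \<circ> param c') has_field_derivative deriv (snd d' \<circ> param d) (snd d (h q)) *
     (deriv (snd d \<circ> h \<circ> param c) (snd c q) * deriv (snd c \<circ> param c') (snd c' q))) (at (snd c' q))"
    by (rule has_field_derivative_transform_within_open[OF 5 chart_image_open[OF chartsD[OF c(2)] op]])
      (use c d C(4) C'(4) D(4) in auto)
qed

lemma pullback_change:
  assumes \<delta>: "meromorphic_differential S k \<delta>" and \<epsilon>: "meromorphic_differential T k \<epsilon>"
    and c: "c \<in> charts T" "c' \<in> charts T" "q \<in> fst c" "q \<in> fst c'"
    and d: "d \<in> charts S" "d' \<in> charts S" "h q \<in> fst d" "h q \<in> fst d'"
    and eq: "\<delta> d (h q) * deriv (snd d \<circ> h \<circ> param c) (snd c q) ^ k = \<epsilon> c q"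
  shows "\<delta> d' (h q) * deriv (snd d' \<circ> h \<circ> param c') (snd c' q) ^ k = \<epsilon> c' q"
proof -
  have "\<epsilon> c' q = \<epsilon> c q * deriv (snd c \<circ> param c') (snd c' q) ^ k"
    using \<epsilon> c unfolding meromorphic_differential_def by blast
  moreover have "\<delta> d (h q) = \<delta> d' (h q) * deriv (snd d' \<circ> param d) (snd d (h q)) ^ k"
    using \<delta> d unfolding meromorphic_differential_def by blast
  ultimately show ?thesis
    unfolding deriv_change[OF c d] eq[symmetric] by (simp add: power_mult_distrib mult_ac)
qed

text \<open>The difference of the two sides is meromorphic at \<open>p\<close>, so on a punctured
  neighbourhood it either vanishes or has no zeros. The second case is refuted by a single nearby
  point around which the equation holds in some charts, since \<open>pullback_change\<close> makes
  the equation independent of the charts.\<close>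

lemma pullback_eq_dense:
  assumes \<delta>: "meromorphic_differential S k \<delta>" and \<epsilon>: "meromorphic_differential T k \<epsilon>"
    and dense: "\<And>p. \<forall>\<^sub>F q0 in at p. \<exists>c\<in>charts T. \<exists>d\<in>charts S. q0 \<in> fst c \<and> h q0 \<in> fst d \<and>
      (\<forall>\<^sub>F q in at q0. \<delta> d (h q) * deriv (snd d \<circ> h \<circ> param c) (snd c q) ^ k = \<epsilon> c q)"
  shows "pullback_eq T S k h \<delta> \<epsilon>"
  unfolding pullback_eq_def
proof (intro ballI)
  fix c d p assume c: "c \<in> charts T" and d: "d \<in> charts S" and p: "p \<in> fst c \<inter> h -` fst d"
  note C = topological_chartD[OF chartsD[OF c]] and D = topological_chartD[OF chartsD[OF d]]
  define R where "R = (\<lambda>q. \<delta> d (h q) * deriv (snd d \<circ> h \<circ> param c) (snd c q) ^ k = \<epsilon> c q)"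
  define H where "H = snd d \<circ> h \<circ> param c"
  define V where "V = snd c ` (fst c \<inter> h -` fst d)"
  define x0 where "x0 = snd c p"
  have H: "H holomorphic_on V" "open V" "x0 \<in> V"
    using rep_holomorphic[OF c d] p by (auto simp: H_def V_def x0_def)
  define \<Psi> where "\<Psi> = (\<lambda>x. (\<delta> d \<circ> param d) (H x) * deriv H x ^ k - (\<epsilon> c \<circ> param c) x)"
  have \<Psi>: "\<Psi> (snd c q) = 0 \<longleftrightarrow> R q" if "q \<in> fst c \<inter> h -` fst d" for q
    using that C(4) D(4) by (simp add: \<Psi>_def R_def H_def)
  have N: "open (fst c \<inter> h -` fst d)" by (intro open_Int C(1) open_preimage D(1))
  have "H x0 \<in> snd d ` fst d" using p C(4) by (auto simp: H_def x0_def)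
  then have "(\<delta> d \<circ> param d) meromorphic_on {H x0}"
    using \<delta> d meromorphic_on_subset[of "\<delta> d \<circ> param d" "snd d ` fst d" "{H x0}"]
    by (auto simp: meromorphic_differential_def nicely_meromorphic_on_def)
  then have m1: "(\<lambda>x. (\<delta> d \<circ> param d) (H x)) meromorphic_on {x0}"
    by (rule meromorphic_on_compose) (use H in \<open>auto intro: holomorphic_on_imp_analytic_at\<close>)
  have m2: "deriv H meromorphic_on {x0}"
    using H by (intro analytic_on_imp_meromorphic_on holomorphic_on_imp_analytic_at holomorphic_deriv) auto
  have m3: "(\<epsilon> c \<circ> param c) meromorphic_on {x0}"
    using \<epsilon> c p meromorphic_on_subset[of "\<epsilon> c \<circ> param c" "snd c ` fst c" "{x0}"]
    by (auto simp: meromorphic_differential_def nicely_meromorphic_on_def x0_def)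
  have "\<Psi> meromorphic_on {x0}"
    unfolding \<Psi>_def by (intro meromorphic_intros m1 m2 m3)
  then have alt: "(\<forall>\<^sub>F x in at x0. \<Psi> x = 0) \<or> (\<forall>\<^sub>F x in at x0. \<Psi> x \<noteq> 0)"
    by (rule meromorphic_eventually_0_or_nonzero)
  have tr: "(\<forall>\<^sub>F q in at p. P (snd c q)) \<longleftrightarrow> (\<forall>\<^sub>F x in at x0. P x)" for P
  proof -
    have "(\<forall>\<^sub>F x in at x0. P (snd c (param c x))) \<longleftrightarrow> (\<forall>\<^sub>F x in at x0. P x)"
    proof (rule eventually_cong)
      show "\<forall>\<^sub>F x in at x0. x \<in> snd c ` fst c"
        using p C(2) by (intro eventually_at_in_open') (auto simp: x0_def)
    qed (use C(6) in auto)
    then show ?thesis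
      using eventually_at_chart[OF chartsD[OF c], of p "\<lambda>q. P (snd c q)"] p by (simp add: x0_def)
  qed
  have evN: "\<forall>\<^sub>F q in at p. q \<in> fst c \<inter> h -` fst d"
    using N p by (rule eventually_at_in_open')
  show "\<forall>\<^sub>F q in at p. R q"
  proof (cases "\<forall>\<^sub>F x in at x0. \<Psi> x = 0")
    case True
    then have "\<forall>\<^sub>F q in at p. \<Psi> (snd c q) = 0" using tr[of "\<lambda>x. \<Psi> x = 0"] by simp
    then show ?thesis using evN by eventually_elim (use \<Psi> in auto)
  next
    case False
    then have "\<forall>\<^sub>F q in at p. \<Psi> (snd c q) \<noteq> 0" using alt tr[of "\<lambda>x. \<Psi> x \<noteq> 0"] by simp
    then have "\<forall>\<^sub>F q in at p. \<not> R q \<and> q \<in> fst c \<inter> h -` fst d"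
      using evN by eventually_elim (use \<Psi> in auto)
    from eventually_conj[OF eventually_at_eventually[OF this] dense[of p]]
    obtain q0 where q0: "\<forall>\<^sub>F q in at q0. \<not> R q \<and> q \<in> fst c \<inter> h -` fst d"
      "\<exists>c\<in>charts T. \<exists>d\<in>charts S. q0 \<in> fst c \<and> h q0 \<in> fst d \<and>
      (\<forall>\<^sub>F q in at q0. \<delta> d (h q) * deriv (snd d \<circ> h \<circ> param c) (snd c q) ^ k = \<epsilon> c q)"
      using eventually_happens'[OF surface_at_neq_bot[OF T]] by blast
    then obtain c1 d1 where cd: "c1 \<in> charts T" "d1 \<in> charts S" "q0 \<in> fst c1" "h q0 \<in> fst d1"
      "\<forall>\<^sub>F q in at q0. \<delta> d1 (h q) * deriv (snd d1 \<circ> h \<circ> param c1) (snd c1 q) ^ k = \<epsilon> c1 q" by blast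
    have "open (fst c1 \<inter> h -` fst d1)"
      using cd by (intro open_Int open_preimage topological_chartD chartsD)
    then have "\<forall>\<^sub>F q in at q0. q \<in> fst c1 \<inter> h -` fst d1"
      using cd by (intro eventually_at_in_open') auto
    with q0(1) cd(5) have "\<forall>\<^sub>F q in at q0. False"
    proof eventually_elim
      case (elim q)
      then have "R q"
        unfolding R_def using pullback_change[OF \<delta> \<epsilon> cd(1) c _ _ cd(2) d, of q] by auto
      then show False using elim by blast
    qed
    then show ?thesis using surface_at_neq_bot[OF T] by (simp add: eventually_False)
  qed
qed

lemma regular_injective:
  assumes c: "c \<in> charts T" "q \<in> fst c" and d: "d \<in> charts S" "h q \<in> fst d"
    and nz: "deriv (snd d \<circ> h \<circ> param c) (snd c q) \<noteq> 0"
  obtains N where "open N" "q \<in> N" "N \<subseteq> fst c \<inter> h -` fst d" "inj_on (snd d \<circ> h) N"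
proof -
  note C = topological_chartD[OF chartsD[OF c(1)]]
  define V where "V = snd c ` (fst c \<inter> h -` fst d)"
  have V: "(snd d \<circ> h \<circ> param c) holomorphic_on V" "snd c q \<in> V" "open V"
    using rep_holomorphic[OF c(1) d(1)] c d by (auto simp: V_def)
  obtain \<rho> where \<rho>: "\<rho> > 0" "ball (snd c q) \<rho> \<subseteq> V" "inj_on (snd d \<circ> h \<circ> param c) (ball (snd c q) \<rho>)"
    by (rule has_complex_derivative_locally_injective[OF V nz])
  define N where "N = fst c \<inter> snd c -` ball (snd c q) \<rho>"
  show ?thesis
  proof (rule that)
    show "open N" unfolding N_def by (rule chart_preimage_open[OF chartsD[OF c(1)] open_ball])
    show "q \<in> N" using c \<rho> by (simp add: N_def)
    show "N \<subseteq> fst c \<inter> h -` fst d"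
    proof
      fix y assume y: "y \<in> N"
      then have "snd c y \<in> V" using \<rho> by (auto simp: N_def)
      then obtain y' where "y' \<in> fst c" "h y' \<in> fst d" "snd c y = snd c y'" by (auto simp: V_def)
      then show "y \<in> fst c \<inter> h -` fst d" using C(3) y by (auto simp: N_def inj_on_def)
    qed
    show "inj_on (snd d \<circ> h) N"
    proof (rule inj_onI)
      fix y z assume yz: "y \<in> N" "z \<in> N" "(snd d \<circ> h) y = (snd d \<circ> h) z"
      have "snd c y = snd c z"
        by (rule inj_onD[OF \<rho>(3)]) (use yz C(4) in \<open>auto simp: N_def\<close>)
      then show "y = z" using C(3) yz by (auto simp: N_def inj_on_def)
    qed
  qed
qed

text \<open>Meromorphic identities on the target hold only off the point itself. They pull back
  along \<open>h\<close> once \<open>h\<close> avoids the value \<open>h q\<close> near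
  \<open>q\<close>.\<close>

lemma filterlim_at_injective:
  assumes "open N" "q \<in> N" "inj_on h N"
  shows "filterlim h (at (h q)) (at q)"
  unfolding filterlim_at
proof (intro conjI)
  have "\<forall>\<^sub>F x in at q. x \<in> N - {q}"
    unfolding eventually_at_topological using assms by blast
  then show "\<forall>\<^sub>F x in at q. h x \<in> UNIV \<and> h x \<noteq> h q"
    by eventually_elim (use assms in \<open>auto dest: inj_onD\<close>)
  show "h \<midarrow>q\<rightarrow> h q"
    using continuous by (simp add: continuous_on_def)
qed

lemma regular_filterlim:
  assumes "c \<in> charts T" "q \<in> fst c" "d \<in> charts S" "h q \<in> fst d"
    "deriv (snd d \<circ> h \<circ> param c) (snd c q) \<noteq> 0"
  shows "filterlim h (at (h q)) (at q)"
proof -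
  obtain N where "open N" "q \<in> N" "N \<subseteq> fst c \<inter> h -` fst d" "inj_on (snd d \<circ> h) N"
    by (rule regular_injective[OF assms])
  then show ?thesis by (intro filterlim_at_injective[of N]) (auto dest: inj_on_imageI2)
qed

text \<open>The points where \<open>h\<close> is locally constant form an open and closed set, which
  is empty for a nonconstant map on a connected surface. At all other points the difference to the
  value and the derivative have isolated zeros in charts.\<close>

lemma eventually_regular:
  assumes conn: "connected (UNIV :: 't set)" and nonconst: "\<not> (\<exists>s. \<forall>q. h q = s)"
  shows "\<forall>\<^sub>F q in at p. h q \<noteq> h p \<and> (\<exists>c\<in>charts T. \<exists>d\<in>charts S. q \<in> fst c \<and> h q \<in> fst d \<and>
      deriv (snd d \<circ> h \<circ> param c) (snd c q) \<noteq> 0)"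
proof -
  define E where "E = {p. \<forall>\<^sub>F q in nhds p. h q = h p}"
  let ?R = "\<lambda>q. \<exists>c\<in>charts T. \<exists>d\<in>charts S. q \<in> fst c \<and> h q \<in> fst d \<and>
      deriv (snd d \<circ> h \<circ> param c) (snd c q) \<noteq> 0"
  have reg: "\<forall>\<^sub>F q in at p. h q \<noteq> h p \<and> ?R q" if p: "p \<notin> E" for p
  proof -
    obtain c where c': "c \<in> T" "p \<in> fst c" using atlas_covers[OF T] .
    obtain d where d': "d \<in> S" "h p \<in> fst d" using atlas_covers[OF S] .
    have c: "c \<in> charts T" and d: "d \<in> charts S" using atlas_subset_charts[OF T c'(1)] atlas_subset_charts[OF S d'(1)] by auto
    note C = topological_chartD[OF chartsD[OF c]] and D = topological_chartD[OF chartsD[OF d]]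
    define H where "H = snd d \<circ> h \<circ> param c"
    define V where "V = snd c ` (fst c \<inter> h -` fst d)"
    define x0 where "x0 = snd c p"
    have H: "H holomorphic_on V" "open V" "x0 \<in> V"
      using rep_holomorphic[OF c d] c' d' by (auto simp: H_def V_def x0_def)
    obtain \<rho> where \<rho>: "\<rho> > 0" "ball x0 \<rho> \<subseteq> V" using H openE by blast
    have notconst: False if const: "\<forall>\<^sub>F x in at x0. H x = H x0"
    proof -
      have "\<forall>\<^sub>F x in at x0. x \<in> V" using H by (intro eventually_at_in_open')
      with const have "\<forall>\<^sub>F x in at x0. h (param c x) = h p"
      proof eventually_elim
        case (elim x)
        then have "h (param c x) \<in> fst d" using C(4) by (auto simp: V_def)
        then show ?case using elim C(4) D(3) c' d' by (auto simp: H_def x0_def inj_on_def)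
      qed
      then have "\<forall>\<^sub>F q in at p. h q = h p"
        using eventually_at_chart[OF chartsD[OF c] c'(2)] by (simp add: x0_def)
      then have "\<forall>\<^sub>F q in nhds p. h q = h p" by (simp add: eventually_nhds_conv_at)
      then show False using p by (simp add: E_def)
    qed
    have 1: "\<forall>\<^sub>F x in at x0. H x \<noteq> H x0"
    proof -
      have "(\<lambda>x. H x - H x0) meromorphic_on {x0}"
        using H by (intro analytic_on_imp_meromorphic_on holomorphic_on_imp_analytic_at[of _ V] holomorphic_intros)
      from meromorphic_eventually_0_or_nonzero[OF this] show ?thesis using notconst by auto
    qed
    have 2: "\<forall>\<^sub>F x in at x0. deriv H x \<noteq> 0"
    proof -
      have "deriv H meromorphic_on {x0}"
        using H by (intro analytic_on_imp_meromorphic_on holomorphic_on_imp_analytic_at[of _ V] holomorphic_deriv)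
      moreover have False if z: "\<forall>\<^sub>F x in at x0. deriv H x = 0"
      proof -
        obtain \<rho>' where \<rho>': "\<rho>' > 0" "\<And>x. x \<noteq> x0 \<Longrightarrow> dist x x0 < \<rho>' \<Longrightarrow> deriv H x = 0"
          using z unfolding eventually_at by blast
        let ?B = "ball x0 (min \<rho> \<rho>')"
        have "H x = H x0" if "x \<in> ?B" for x
        proof (rule DERIV_zero_connected_constant[where K = "{x0}" and S = ?B])
          show "continuous_on ?B H"
            using \<rho> by (intro holomorphic_on_imp_continuous_on holomorphic_on_subset[OF H(1)]) auto
          show "\<forall>x\<in>?B - {x0}. (H has_field_derivative 0) (at x)"
          proof
            fix x assume x: "x \<in> ?B - {x0}"
            then have "x \<in> V" using \<rho> by auto
            from holomorphic_derivI[OF H(1,2) this, of UNIV] show "(H has_field_derivative 0) (at x)"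
              using \<rho>'(2)[of x] x by (simp add: dist_commute)
          qed
        qed (use that \<rho> \<rho>' in auto)
        then have "\<forall>x\<in>?B. x \<noteq> x0 \<longrightarrow> H x = H x0" by blast
        moreover have "x0 \<in> ?B" using \<rho>(1) \<rho>'(1) by simp
        ultimately have "\<forall>\<^sub>F x in at x0. H x = H x0"
          unfolding eventually_at_topological using open_ball by blast
        then show False by (rule notconst)
      qed
      ultimately show ?thesis using meromorphic_eventually_0_or_nonzero[of "deriv H" x0] by blast
    qed
    have "\<forall>\<^sub>F x in at x0. x \<in> V" using H by (intro eventually_at_in_open')
    with 1 2 have "\<forall>\<^sub>F x in at x0. h (param c x) \<noteq> h p \<and> ?R (param c x)"
    proof eventually_elim
      case (elim x)
      then obtain y where y: "y \<in> fst c" "h y \<in> fst d" "x = snd c y" by (auto simp: V_def)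
      then have "param c x = y" using C(4) by simp
      then show ?case using elim y c d C(4) c'(2) by (auto simp: H_def x0_def)
    qed
    then show ?thesis using eventually_at_chart[OF chartsD[OF c] c'(2), of "\<lambda>q. h q \<noteq> h p \<and> ?R q"]
      by (simp add: x0_def)
  qed
  \<comment> \<open>Regular points surround every point outside \<open>E\<close>, and they are
    themselves outside \<open>E\<close>; hence the complement of \<open>E\<close> is open.\<close>
  have regE: "q \<notin> E" if q: "?R q" for q
  proof
    assume "q \<in> E"
    then have 1: "\<forall>\<^sub>F y in at q. h y = h q" by (simp add: E_def eventually_nhds_conv_at)
    have "filterlim h (at (h q)) (at q)" using q regular_filterlim by blast
    then have "\<forall>\<^sub>F y in at q. h y \<noteq> h q" by (simp add: filterlim_at)
    with 1 have "\<forall>\<^sub>F y in at q. False" by eventually_elim simp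
    then show False using surface_at_neq_bot[OF T] by (simp add: eventually_False)
  qed
  have "open E"
    unfolding open_subopen[of E]
  proof
    fix x assume "x \<in> E"
    then obtain M where M: "open M" "x \<in> M" "\<forall>q\<in>M. h q = h x" unfolding E_def eventually_nhds by blast
    have "M \<subseteq> E"
    proof
      fix y assume "y \<in> M"
      then have "\<forall>q\<in>M. h q = h y" using M(3) by metis
      then show "y \<in> E" unfolding E_def eventually_nhds using M(1) \<open>y \<in> M\<close> by blast
    qed
    then show "\<exists>T. open T \<and> x \<in> T \<and> T \<subseteq> E" using M by blast
  qed
  moreover have "open (- E)"
    unfolding open_subopen[of "- E"]
  proof
    fix x assume x: "x \<in> - E"
    then have "x \<notin> E" by simp
    from reg[OF this] have "\<forall>\<^sub>F q in at x. q \<notin> E" by (rule eventually_mono) (use regE in blast)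
    then obtain N where N: "open N" "x \<in> N" "\<forall>q\<in>N. q \<noteq> x \<longrightarrow> q \<notin> E"
      by (rule eventually_at_open)
    have "N \<subseteq> - E"
    proof
      fix y assume "y \<in> N"
      then show "y \<in> - E" using N(3) x by (cases "y = x") auto
    qed
    then show "\<exists>T. open T \<and> x \<in> T \<and> T \<subseteq> - E" using N(1,2) by blast
  qed
  ultimately have "E = {} \<or> E = UNIV"
    using connectedD[OF conn, of E "- E"] by auto
  \<comment> \<open>If \<open>h\<close> were locally constant everywhere, its fibres would be open
    as well as closed.\<close>
  moreover have "E \<noteq> UNIV"
  proof
    assume E: "E = UNIV"
    fix p
    define A where "A = h -` {h p}"
    have "open A"
      unfolding open_subopen[of A]
    proof
      fix x assume x: "x \<in> A"
      have "x \<in> E" using E by simp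
      then obtain M where M: "open M" "x \<in> M" "\<forall>q\<in>M. h q = h x"
        unfolding E_def eventually_nhds by blast
      have "h x = h p" using x by (simp add: A_def)
      then have "M \<subseteq> A" using M(3) by (metis A_def insertI1 subsetI vimageI)
      then show "\<exists>T. open T \<and> x \<in> T \<and> T \<subseteq> A" using M by blast
    qed
    moreover have "- A = h -` (- {h p})" by (auto simp: A_def)
    then have "open (- A)" using open_preimage[OF open_Compl[OF closed_singleton], of "h p"] by metis
    ultimately have "A = UNIV"
      using connectedD[OF conn, of A "- A"] by (auto simp: A_def)
    then have "\<forall>q. h q = h p" by (auto simp: A_def)
    then show False using nonconst by blast
  qed
  ultimately show ?thesis using reg by blast
qed

end

section \<open>Curves related by a map\<close>

definition frak_op :: "(complex \<Rightarrow> complex) \<Rightarrow> complex \<Rightarrow> complex" where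
  "frak_op Z x = 1/2 * (deriv (deriv Z) x / Z x) - 9/16 * ((deriv Z x)\<^sup>2 / (Z x)\<^sup>2)"

lemma frak_op_cong:
  assumes "open V" "x \<in> V" "\<And>y. y \<in> V \<Longrightarrow> Z y = Y y"
  shows "frak_op Z x = frak_op Y x"
proof -
  have d: "deriv Z y = deriv Y y" if "y \<in> V" for y
    by (rule deriv_cong_ev[OF eventually_mono[OF eventually_nhds_in_open[OF assms(1) that]] refl]) (rule assms(3))
  moreover have "deriv (deriv Z) x = deriv (deriv Y) x"
    by (rule deriv_cong_ev[OF eventually_mono[OF eventually_nhds_in_open[OF assms(1,2)]] refl]) (rule d)
  ultimately show ?thesis using assms by (simp add: frak_op_def)
qed

lemma frak_dD:
  assumes "frak_d S D P \<eta> \<delta> \<epsilon>"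
  shows "cartan_connection S P \<eta>" "meromorphic_differential S 4 \<delta>" "meromorphic_differential S 2 \<epsilon>"
    "\<forall>\<^sub>F q in at p. q \<notin> D"
    "\<not> zero_differential S \<delta> \<Longrightarrow> adapted_chart S P \<eta> c \<Longrightarrow> p \<in> fst c \<Longrightarrow>
      \<forall>\<^sub>F q in at p. \<epsilon> c q = frak_op (\<delta> c \<circ> param c) (snd c q)"
proof -
  have m: "meromorphic_projective_structure S D P \<eta>"
    using assms by (simp add: frak_d_def)
  then show "cartan_connection S P \<eta>"
    by (simp add: meromorphic_projective_structure_def projective_structure_def)
  show "meromorphic_differential S 4 \<delta>" "meromorphic_differential S 2 \<epsilon>"
    using assms by (simp_all add: frak_d_def)
  have "\<not> p islimpt D" using m by (simp add: meromorphic_projective_structure_def)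
  then show "\<forall>\<^sub>F q in at p. q \<notin> D"
    by (simp add: islimpt_conv_frequently_at frequently_def)
  assume "\<not> zero_differential S \<delta>" "adapted_chart S P \<eta> c" "p \<in> fst c"
  then show "\<forall>\<^sub>F q in at p. \<epsilon> c q = frak_op (\<delta> c \<circ> param c) (snd c q)"
    using assms unfolding frak_d_def Let_def frak_op_def by blast
qed

lemma derivative_eq_on:
  fixes f g :: "complex \<Rightarrow> complex"
  assumes "open B" "x \<in> B" "\<And>y. y \<in> B \<Longrightarrow> f y = g y"
    "(f has_field_derivative f') (at x)" "(g has_field_derivative g') (at x)"
  shows "f' = g'"
  using has_field_derivative_transform_within_open[OF assms(4,1,2)] assms(3,5) DERIV_unique by blast

text \<open>With \<open>H' = r\<^sup>-\<^sup>2\<close>, the Schwarzian derivative of \<open>H\<close> is \<open>- 2 r'' / r\<close>.\<close>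

lemma schwarzian_vanishes:
  fixes Y Y1 Y2 Z Z1 Z2 H r r1 r2 :: "complex \<Rightarrow> complex"
  assumes B: "open B"
    and H: "\<And>x. x \<in> B \<Longrightarrow> (H has_field_derivative 1 / (r x)\<^sup>2) (at x)"
    and r: "\<And>x. x \<in> B \<Longrightarrow> (r has_field_derivative r1 x) (at x)" "\<And>x. x \<in> B \<Longrightarrow> (r1 has_field_derivative r2 x) (at x)"
      "\<And>x. x \<in> B \<Longrightarrow> r x \<noteq> 0"
    and Y: "\<And>x. x \<in> B \<Longrightarrow> (Y has_field_derivative Y1 x) (at x)" "\<And>x. x \<in> B \<Longrightarrow> (Y1 has_field_derivative Y2 x) (at x)"
      "\<And>x. x \<in> B \<Longrightarrow> Y x \<noteq> 0"
    and Z: "\<And>x. x \<in> B \<Longrightarrow> (Z has_field_derivative Z1 (H x)) (at (H x))"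
      "\<And>x. x \<in> B \<Longrightarrow> (Z1 has_field_derivative Z2 (H x)) (at (H x))"
    and quartic: "\<And>x. x \<in> B \<Longrightarrow> Z (H x) * (1 / (r x)\<^sup>2) ^ 4 = Y x"
    and quadratic: "\<And>x. x \<in> B \<Longrightarrow> (1/2 * (Z2 (H x) / Z (H x)) - 9/16 * ((Z1 (H x))\<^sup>2 / (Z (H x))\<^sup>2)) * (1 / (r x)\<^sup>2)\<^sup>2 =
      1/2 * (Y2 x / Y x) - 9/16 * ((Y1 x)\<^sup>2 / (Y x)\<^sup>2)"
    and x: "x \<in> B"
  shows "r2 x = 0"
proof -
  \<comment> \<open>\<open>Z\<close> and its derivatives along \<open>H\<close> are expressed by
    \<open>Y\<close> and \<open>r\<close>. Since \<open>H' = 1 / r\<^sup>2\<close>, every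
    differentiation of \<open>Z\<close> costs a factor \<open>r\<^sup>2\<close>.\<close>
  have e1: "Z (H x) = Y x * (r x)^8" if "x \<in> B" for x
    using quartic[OF that, symmetric] r(3)[OF that] by (simp add: power_divide)
  have e2: "Z1 (H x) = Y1 x * (r x)^10 + 8 * Y x * (r x)^9 * r1 x" if "x \<in> B" for x
  proof -
    have "Z1 (H x) * (1 / (r x)\<^sup>2) = Y1 x * (r x)^8 + 8 * (r x)^7 * r1 x * Y x"
    proof (rule derivative_eq_on[OF B that e1])
      show "((\<lambda>x. Z (H x)) has_field_derivative Z1 (H x) * (1 / (r x)\<^sup>2)) (at x)"
        by (rule DERIV_chain2[OF Z(1)[OF that] H[OF that]])
      show "((\<lambda>x. Y x * (r x)^8) has_field_derivative Y1 x * (r x)^8 + 8 * (r x)^7 * r1 x * Y x) (at x)"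
        by (auto intro!: derivative_eq_intros Y(1) r(1) that)
    qed
    then have "Z1 (H x) * (1 / (r x)\<^sup>2) * (r x)\<^sup>2 = (Y1 x * (r x)^8 + 8 * (r x)^7 * r1 x * Y x) * (r x)\<^sup>2" by simp
    then show ?thesis using r(3)[OF that] by (simp add: algebra_simps eval_nat_numeral)
  qed
  have e3: "Z2 (H x) = Y2 x * (r x)^12 + 18 * Y1 x * (r x)^11 * r1 x + 72 * Y x * (r x)^10 * (r1 x)\<^sup>2 + 8 * Y x * (r x)^11 * r2 x"
    if "x \<in> B" for x
  proof -
    have "Z2 (H x) * (1 / (r x)\<^sup>2) = Y2 x * (r x)^10 + 10 * (r x)^9 * r1 x * Y1 x +
        (8 * Y1 x * (r x)^9 * r1 x + 72 * Y x * (r x)^8 * (r1 x)\<^sup>2 + 8 * Y x * (r x)^9 * r2 x)"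
    proof (rule derivative_eq_on[OF B that e2])
      show "((\<lambda>x. Z1 (H x)) has_field_derivative Z2 (H x) * (1 / (r x)\<^sup>2)) (at x)"
        by (rule DERIV_chain2[OF Z(2)[OF that] H[OF that]])
      show "((\<lambda>x. Y1 x * (r x)^10 + 8 * Y x * (r x)^9 * r1 x) has_field_derivative Y2 x * (r x)^10 + 10 * (r x)^9 * r1 x * Y1 x +
        (8 * Y1 x * (r x)^9 * r1 x + 72 * Y x * (r x)^8 * (r1 x)\<^sup>2 + 8 * Y x * (r x)^9 * r2 x)) (at x)"
        by (auto intro!: derivative_eq_intros Y r that simp: algebra_simps power2_eq_square)
    qed
    then have "Z2 (H x) * (1 / (r x)\<^sup>2) * (r x)\<^sup>2 = (Y2 x * (r x)^10 + 10 * (r x)^9 * r1 x * Y1 x +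
        (8 * Y1 x * (r x)^9 * r1 x + 72 * Y x * (r x)^8 * (r1 x)\<^sup>2 + 8 * Y x * (r x)^9 * r2 x)) * (r x)\<^sup>2" by simp
    then show ?thesis using r(3)[OF that] by (simp add: algebra_simps eval_nat_numeral)
  qed
  define y y1 y2 z1 z2 \<rho> \<rho>1 where "y = Y x" and "y1 = Y1 x" and "y2 = Y2 x" and "z1 = Z1 (H x)" and "z2 = Z2 (H x)"
    and "\<rho> = r x" and "\<rho>1 = r1 x"
  have nz: "y \<noteq> 0" "\<rho> \<noteq> 0" using Y(3) r(3) x by (auto simp: y_def \<rho>_def)
  have q: "(1/2 * (z2 / (y * \<rho>^8)) - 9/16 * (z1\<^sup>2 / (y * \<rho>^8)\<^sup>2)) * (1 / \<rho>\<^sup>2)\<^sup>2 = 1/2 * (y2 / y) - 9/16 * (y1\<^sup>2 / y\<^sup>2)"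
    using quadratic[OF x] e1[OF x] by (simp add: y_def y1_def y2_def z1_def z2_def \<rho>_def)
  have "16 * y\<^sup>2 * \<rho>^20 * ((1/2 * (z2 / (y * \<rho>^8)) - 9/16 * (z1\<^sup>2 / (y * \<rho>^8)\<^sup>2)) * (1 / \<rho>\<^sup>2)\<^sup>2) = 8 * z2 * y * \<rho>^8 - 9 * z1\<^sup>2"
    using nz by (simp add: field_simps eval_nat_numeral)
  moreover have "16 * y\<^sup>2 * \<rho>^20 * (1/2 * (y2 / y) - 9/16 * (y1\<^sup>2 / y\<^sup>2)) = 8 * y2 * y * \<rho>^20 - 9 * y1\<^sup>2 * \<rho>^20"
    using nz by (simp add: field_simps eval_nat_numeral)
  ultimately have E: "8 * z2 * y * \<rho>^8 - 9 * z1\<^sup>2 = 8 * y2 * y * \<rho>^20 - 9 * y1\<^sup>2 * \<rho>^20"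
    using q by simp
  have z1: "z1 = y1 * \<rho>^10 + 8 * y * \<rho>^9 * \<rho>1"
    and z2: "z2 = y2 * \<rho>^12 + 18 * y1 * \<rho>^11 * \<rho>1 + 72 * y * \<rho>^10 * \<rho>1\<^sup>2 + 8 * y * \<rho>^11 * r2 x"
    using e2[OF x] e3[OF x] by (auto simp: y_def y1_def y2_def z1_def z2_def \<rho>_def \<rho>1_def)
  \<comment> \<open>The coefficients \<open>1/2\<close> and \<open>9/16\<close> are tuned for this
    cancellation: all terms containing \<open>\<rho>1\<close> or its square drop out and only the
    one with \<open>r2\<close> survives.\<close>
  have "64 * (y\<^sup>2 * \<rho>^19 * r2 x) = (8 * z2 * y * \<rho>^8 - 9 * z1\<^sup>2) - (8 * y2 * y * \<rho>^20 - 9 * y1\<^sup>2 * \<rho>^20)"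
    unfolding z1 z2 by (simp add: algebra_simps power2_eq_square flip: power_add power_Suc)
  then have "y\<^sup>2 * \<rho>^19 * r2 x = 0" using E by simp
  then show ?thesis using nz by simp
qed

lemma frame_left_mult:
  assumes "frame_on V a p q s t" "X \<in> Sp4"
  shows "frame_on V (\<lambda>x. X ** a x) p q s t"
  using assms has_mat_deriv_cmult[of a _ _ X]
  by (auto simp: frame_on_def Sp4_mult matrix_mul_assoc[symmetric])

lemma frame_on_cong:
  assumes "frame_on V a p q s t" "\<And>x. x \<in> V \<Longrightarrow> b x = a x"
  shows "frame_on V b p q s t"
  using assms has_mat_deriv_cong[of V b a] unfolding frame_on_def by auto

lemma span_columns_mult:
  "vec.span {column 1 (X ** A), column 2 (X ** A)} = (\<lambda>v. X *v v) ` vec.span {column 1 A, column 2 A}"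
  for X A :: "complex^4^4"
proof -
  have c: "column j (X ** A) = X *v column j A" for j
    by (simp add: column_def matrix_matrix_mult_def matrix_vector_mult_def vec_eq_iff)
  have lin: "X *v (a *s x + b *s y) = a *s (X *v x) + b *s (X *v y)" for a b x y
    by (simp add: matrix_vector_right_distrib vector_scalar_commute)
  show ?thesis
    unfolding c
  proof (rule set_eqI)
    fix x
    have "x \<in> vec.span {X *v column 1 A, X *v column 2 A} \<longleftrightarrow>
        (\<exists>a b. x = X *v (a *s column 1 A + b *s column 2 A))"
      unfolding span_pair lin ..
    also have "\<dots> \<longleftrightarrow> (\<exists>v. v \<in> vec.span {column 1 A, column 2 A} \<and> x = X *v v)"
      unfolding span_pair by blast
    finally show "x \<in> vec.span {X *v column 1 A, X *v column 2 A} \<longleftrightarrow>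
        x \<in> (\<lambda>v. X *v v) ` vec.span {column 1 A, column 2 A}"
      by blast
  qed
qed

section \<open>The two implications for a pair of curves\<close>

locale curve_pair =
  fixes S :: "('s::t2_space) chart set" and T :: "('t::t2_space) chart set"
    and f f_sharp :: "'s \<Rightarrow> (complex^4) set" and g g_sharp :: "'t \<Rightarrow> (complex^4) set"
    and F :: "('s \<times> (complex^4^4)) set" and G :: "('t \<times> (complex^4^4)) set"
    and \<delta> d\<delta> :: "'s differential" and \<epsilon> d\<epsilon> :: "'t differential"
  assumes iso_f: "isotropic_curve S f" and iso_g: "isotropic_curve T g"
    and red_F: "canonical_reduction S f f_sharp F" and red_G: "canonical_reduction T g g_sharp G"
    and quart_\<delta>: "quartic_differential S F \<delta>" and quart_\<epsilon>: "quartic_differential T G \<epsilon>"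
    and gen_\<delta>: "\<not> zero_differential S \<delta>" and gen_\<epsilon>: "\<not> zero_differential T \<epsilon>"
    and frak_\<delta>: "frak_d S (- S_star S f f_sharp) F curve_eta \<delta> d\<delta>"
    and frak_\<epsilon>: "frak_d T (- S_star T g g_sharp) G curve_eta \<epsilon> d\<epsilon>"
begin

lemma surfaces: "riemann_surface S" "riemann_surface T" "connected (UNIV :: 't set)"
  using iso_f iso_g by (auto simp: isotropic_curve_def)

sublocale DS: canonical_data S f f_sharp F \<delta>
  by unfold_locales (use surfaces red_F quart_\<delta> frak_dD(1)[OF frak_\<delta>] in auto)

sublocale DT: canonical_data T g g_sharp G \<epsilon>
  by unfold_locales (use surfaces red_G quart_\<epsilon> frak_dD(1)[OF frak_\<epsilon>] in auto)

abbreviation "S_st \<equiv> S_star S f f_sharp"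
abbreviation "T_st \<equiv> S_star T g g_sharp"

lemma ev_star: "\<forall>\<^sub>F q in at p. q \<in> S_st" "\<forall>\<^sub>F q in at p'. q \<in> T_st"
  using frak_dD(4)[OF frak_\<delta>, of p] frak_dD(4)[OF frak_\<epsilon>, of p'] by simp_all

text \<open>The chart \<open>c\<close> is the adapted chart \<open>d\<close> pulled back along
  \<open>h\<close>, so \<open>h\<close> is the identity in these coordinates and both pullback
  equations become equalities of coefficients. They hold because \<open>X ** A (h q)\<close> has the
  same normal form as \<open>A\<close> and is a section of \<open>G\<close>, which also makes
  \<open>c\<close> adapted.\<close>

lemma pullback_local:
  assumes h: "holomorphic_map T S h" and X: "X \<in> Sp4" and eq: "\<And>p. g p = (\<lambda>v. X *v v) ` f (h p)"
    and q0: "q0 \<in> T_st" "h q0 \<in> S_st"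
    and c0: "c0 \<in> charts T" "q0 \<in> fst c0" and d0: "d0 \<in> charts S" "h q0 \<in> fst d0"
    and reg: "deriv (snd d0 \<circ> h \<circ> param c0) (snd c0 q0) \<noteq> 0"
  obtains c d where "c \<in> charts T" "d \<in> charts S" "q0 \<in> fst c" "h q0 \<in> fst d"
    "\<forall>\<^sub>F q in at q0. \<delta> d (h q) * deriv (snd d \<circ> h \<circ> param c) (snd c q) ^ 4 = \<epsilon> c q"
    "\<forall>\<^sub>F q in at q0. d\<delta> d (h q) * deriv (snd d \<circ> h \<circ> param c) (snd c q) ^ 2 = d\<epsilon> c q"
proof -
  interpret surface_map T S h using surfaces h by unfold_locales
  obtain N where N: "open N" "q0 \<in> N" "N \<subseteq> fst c0 \<inter> h -` fst d0" "inj_on (snd d0 \<circ> h) N"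
    by (rule regular_injective[OF c0 d0 reg])
  have injN: "inj_on h N" using N(4) by (rule inj_on_imageI2)
  obtain d A t where d: "d \<in> charts S" "h q0 \<in> fst d" and A: "local_section S F (fst d) A"
    and fA: "frame_on (snd d ` fst d) (A \<circ> param d) (\<lambda>_. 0) (\<lambda>_. kap) (\<lambda>_. 0) t"
    and t: "t holomorphic_on snd d ` fst d"
    and \<delta>d: "\<And>y. y \<in> fst d \<Longrightarrow> \<delta> d y = t (snd d y) * kap ^ 3"
    using DS.adapted_section[OF q0(2)] by metis
  note D = topological_chartD[OF chartsD[OF d(1)]]
  have Top: "open T_st" using DT.principal by (simp add: principal_bundle_def)
  \<comment> \<open>Small enough for \<open>h\<close> to be injective, to stay inside the adapted
    chart, and for \<open>G\<close> to have local sections.\<close>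
  define U where "U = N \<inter> h -` fst d \<inter> T_st"
  have U: "open U" "q0 \<in> U" "U \<subseteq> fst c0" "U \<subseteq> h -` fst d" "U \<subseteq> N" "U \<subseteq> T_st"
    using N open_preimage[OF D(1)] Top q0 d by (auto simp: U_def)
  define c where "c = (U, snd d \<circ> h)"
  have c: "c \<in> charts T" unfolding c_def
  proof (rule chartI[OF surfaces(2) c0(1) U(1,3)])
    show "snd d \<circ> h \<circ> param c0 holomorphic_on snd c0 ` U"
      using rep_holomorphic(1)[OF c0(1) d(1)] by (rule holomorphic_on_subset) (use U in auto)
    show "inj_on (snd d \<circ> h) U"
      using U D(3) injN by (auto simp: inj_on_def subset_iff)
  qed
  note C = topological_chartD[OF chartsD[OF c]]
  have fstc: "fst c = U" "snd c = snd d \<circ> h" by (simp_all add: c_def)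
  define V where "V = snd c ` U"
  have V: "open V" "V \<subseteq> snd d ` fst d" using C(2) U(4) by (auto simp: V_def fstc)
  have par: "h (param c x) = param d x" if "x \<in> V" for x
  proof -
    obtain y where y: "y \<in> U" "x = snd c y" using \<open>x \<in> V\<close> by (auto simp: V_def)
    then show ?thesis using C(4)[of y] D(4)[of "h y"] U(4) by (auto simp: fstc)
  qed
  define B where "B = (\<lambda>q. X ** A (h q))"
  have fB: "frame_on V (B \<circ> param c) (\<lambda>_. 0) (\<lambda>_. kap) (\<lambda>_. 0) t"
    by (rule frame_on_cong[OF frame_left_mult[OF frame_on_subset[OF fA V(2,1)] X]])
      (simp add: B_def par)
  have holB: "holomorphic_mat_on T U B"
    unfolding holomorphic_mat_on_def surface_holomorphic_on_def
  proof (intro allI ballI)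
    fix i j e assume e: "e \<in> T"
    have "surface_holomorphic_on T (h -` fst d) ((\<lambda>p. A p $ k $ j) \<circ> h)" for k
      using A by (intro surface_holomorphic_on_compose[OF surfaces(2,1) h _ D(1)])
        (auto simp: local_section_def holomorphic_mat_on_def)
    then have "((\<lambda>p. A p $ k $ j) \<circ> h \<circ> param e) holomorphic_on snd e ` (fst e \<inter> h -` fst d)" for k
      using e by (simp add: surface_holomorphic_on_def)
    then have "((\<lambda>p. A p $ k $ j) \<circ> h \<circ> param e) holomorphic_on snd e ` (fst e \<inter> U)" for k
      by (rule holomorphic_on_subset) (use U in auto)
    then show "(\<lambda>p. B p $ i $ j) \<circ> param e holomorphic_on snd e ` (fst e \<inter> U)"
      by (auto simp: B_def matrix_matrix_mult_def comp_def intro!: holomorphic_intros)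
  qed
  \<comment> \<open>Membership in \<open>G\<close> is tested against a local section
    \<open>B0\<close> of \<open>G\<close>. Both frames are in normal form and span the planes of
    \<open>g\<close>, so they differ by a gauge, and \<open>G\<close> is stable under
    gauges.\<close>
  have "(y, B y) \<in> G" if y: "y \<in> U" for y
  proof -
    have "\<forall>p\<in>T_st. \<exists>W A. p \<in> W \<and> local_section T G W A"
      using DT.principal by (simp add: principal_bundle_def)
    then obtain W B0 where W: "y \<in> W" "local_section T G W B0" using y U(6) by blast
    obtain p q s t' where f0: "frame_on (snd c ` (fst c \<inter> W)) (B0 \<circ> param c) p q s t'"
      using DT.section_frame[OF W(2) c] by metis
    have op: "open (snd c ` (fst c \<inter> W))" using f0 by (simp add: frame_on_def)
    have f1: "frame_on (snd c ` (fst c \<inter> W)) (B \<circ> param c) (\<lambda>_. 0) (\<lambda>_. kap) (\<lambda>_. 0) t"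
      by (rule frame_on_subset[OF fB _ op]) (auto simp: V_def fstc)
    have "\<exists>r n. r \<noteq> 0 \<and> (B \<circ> param c) (snd c y) = (B0 \<circ> param c) (snd c y) ** gauge r n"
    proof (rule frames_gauge[OF f0 f1, rule_format])
      show "snd c y \<in> snd c ` (fst c \<inter> W)" using y W by (auto simp: fstc)
      fix x assume "x \<in> snd c ` (fst c \<inter> W)"
      then obtain y' where y': "y' \<in> U" "y' \<in> W" "param c x = y'" using C(4) by (auto simp: fstc)
      have "(h y', A (h y')) \<in> F" using A y' U(4) by (auto simp: local_section_def)
      from DS.in_F(2)[OF this] have "vec.span {column 1 (B y'), column 2 (B y')} = g y'"
        unfolding B_def span_columns_mult eq by simp
      moreover have "vec.span {column 1 (B0 y'), column 2 (B0 y')} = g y'"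
        using DT.in_F(2)[of y' "B0 y'"] W(2) y' by (auto simp: local_section_def)
      ultimately show "vec.span {column 1 ((B \<circ> param c) x), column 2 ((B \<circ> param c) x)} =
          vec.span {column 1 ((B0 \<circ> param c) x), column 2 ((B0 \<circ> param c) x)}"
        by (simp add: y')
    qed
    then obtain r n where "r \<noteq> 0" "B y = B0 y ** gauge r n"
      using C(4)[of y] y by (auto simp: fstc)
    then show ?thesis using DT.in_F_gauge W by (auto simp: local_section_def)
  qed
  then have secB: "local_section T G (fst c) B"
    using U(1) holB by (simp add: local_section_def fstc)
  \<comment> \<open>A frame determines its four coefficients, so those given by
    \<open>section_frame\<close> must be the ones inherited from \<open>A\<close>.\<close>
  have \<epsilon>c: "\<epsilon> c y = t (snd c y) * kap ^ 3" if y: "y \<in> U" for y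
  proof -
    obtain p q s t' where f0: "frame_on (snd c ` (fst c \<inter> fst c)) (B \<circ> param c) p q s t'"
      and e: "\<And>y. y \<in> fst c \<inter> fst c \<Longrightarrow> \<epsilon> c y = t' (snd c y) * q (snd c y) ^ 3"
      using DT.section_frame[OF secB c] by metis
    let ?x = "snd c y"
    have x: "?x \<in> snd c ` (fst c \<inter> fst c)" "?x \<in> V" using y by (auto simp: fstc V_def)
    have b: "(B \<circ> param c) ?x \<in> Sp4"
      "has_mat_deriv (B \<circ> param c) ((B \<circ> param c) ?x ** nf (p ?x) (q ?x) (s ?x) (t' ?x)) ?x"
      using f0 x(1) unfolding frame_on_def by blast+
    have b': "has_mat_deriv (B \<circ> param c) ((B \<circ> param c) ?x ** nf 0 kap 0 (t ?x)) ?x"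
      using fB x(2) unfolding frame_on_def by blast
    have "nf (p ?x) (q ?x) (s ?x) (t' ?x) = nf 0 kap 0 (t ?x)"
      using has_mat_deriv_unique[OF b(2) b'] Sp4_cancel[OF b(1)] by blast
    then show ?thesis using e[of y] y by (simp add: nf_inject fstc)
  qed
  have der: "deriv (snd d \<circ> h \<circ> param c) (snd c q) = 1" if q: "q \<in> U" for q
  proof -
    have "((\<lambda>z. z) has_field_derivative 1) (at (snd c q))" by (rule DERIV_ident)
    then have "((snd d \<circ> h \<circ> param c) has_field_derivative 1) (at (snd c q))"
      by (rule has_field_derivative_transform_within_open[OF _ V(1)])
        (use q par D(6) V(2) in \<open>auto simp: V_def\<close>)
    then show ?thesis by (rule DERIV_imp_deriv)
  qed
  have \<delta>\<epsilon>: "\<epsilon> c q = \<delta> d (h q)" if q: "q \<in> U" for q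
  proof -
    have "h q \<in> fst d" using q U(4) by blast
    then show ?thesis using \<epsilon>c[OF q] \<delta>d[of "h q"] by (simp add: fstc)
  qed
  have evU: "\<forall>\<^sub>F q in at q0. q \<in> U" using U by (intro eventually_at_in_open')
  have adS: "adapted_chart S F curve_eta d" by (rule DS.frame_adapted[OF d(1) A fA])
  have adT: "adapted_chart T G curve_eta c"
    by (rule DT.frame_adapted[OF c secB]) (use fB in \<open>simp add: V_def fstc\<close>)
  have fl: "filterlim h (at (h q0)) (at q0)"
    by (rule filterlim_at_injective[OF N(1,2) injN])
  have ev1: "\<forall>\<^sub>F q in at q0. d\<delta> d (h q) = frak_op (\<delta> d \<circ> param d) (snd d (h q))"
    by (rule eventually_compose_filterlim[OF frak_dD(5)[OF frak_\<delta> gen_\<delta> adS d(2)] fl])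
  have ev2: "\<forall>\<^sub>F q in at q0. d\<epsilon> c q = frak_op (\<epsilon> c \<circ> param c) (snd c q)"
    using frak_dD(5)[OF frak_\<epsilon> gen_\<epsilon> adT, of q0] U(2) by (simp add: fstc)
  have fr: "frak_op (\<epsilon> c \<circ> param c) (snd c q) = frak_op (\<delta> d \<circ> param d) (snd d (h q))" if q: "q \<in> U" for q
  proof -
    have "frak_op (\<epsilon> c \<circ> param c) (snd c q) = frak_op (\<delta> d \<circ> param d) (snd c q)"
    proof (rule frak_op_cong[OF V(1)])
      show "snd c q \<in> V" using q by (auto simp: V_def)
      fix x assume x: "x \<in> V"
      have "param c x \<in> U" using x C(5)[of x] by (simp add: V_def fstc)
      then show "(\<epsilon> c \<circ> param c) x = (\<delta> d \<circ> param d) x" using \<delta>\<epsilon> par[OF x] by simp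
    qed
    then show ?thesis by (simp add: fstc)
  qed
  show ?thesis
  proof (rule that[OF c d(1)])
    show "q0 \<in> fst c" "h q0 \<in> fst d" using U d by (auto simp: fstc)
    show "\<forall>\<^sub>F q in at q0. \<delta> d (h q) * deriv (snd d \<circ> h \<circ> param c) (snd c q) ^ 4 = \<epsilon> c q"
      using evU by eventually_elim (simp add: \<delta>\<epsilon> der)
    show "\<forall>\<^sub>F q in at q0. d\<delta> d (h q) * deriv (snd d \<circ> h \<circ> param c) (snd c q) ^ 2 = d\<epsilon> c q"
      using evU ev1 ev2 by eventually_elim (simp add: fr der)
  qed
qed

text \<open>Since \<open>g\<close> is not constant, neither is \<open>h\<close>, and near each
  \<open>p\<close> it avoids the value \<open>h p\<close> except at \<open>p\<close>. Its image
  therefore avoids the discrete exceptional set of \<open>f\<close> off isolated points, and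
  \<open>pullback_local\<close> applies densely.\<close>

lemma dominated_imp_pullback:
  assumes "dominated T g S f"
  shows "\<exists>h. holomorphic_map T S h \<and> pullback_eq T S 4 h \<delta> \<epsilon> \<and> pullback_eq T S 2 h d\<delta> d\<epsilon>"
proof -
  obtain h X where h: "holomorphic_map T S h" and X: "X \<in> Sp4" and eq: "\<And>p. g p = (\<lambda>v. X *v v) ` f (h p)"
    using assms unfolding dominated_def by blast
  interpret surface_map T S h using surfaces h by unfold_locales
  have nonconst: "\<not> (\<exists>s. \<forall>q. h q = s)"
    using iso_g eq unfolding isotropic_curve_def by metis
  have dense: "\<forall>\<^sub>F q0 in at p. \<exists>c\<in>charts T. \<exists>d\<in>charts S. q0 \<in> fst c \<and> h q0 \<in> fst d \<and>
    (\<forall>\<^sub>F q in at q0. \<delta> d (h q) * deriv (snd d \<circ> h \<circ> param c) (snd c q) ^ 4 = \<epsilon> c q) \<and>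
    (\<forall>\<^sub>F q in at q0. d\<delta> d (h q) * deriv (snd d \<circ> h \<circ> param c) (snd c q) ^ 2 = d\<epsilon> c q)" for p
  proof -
    note reg = eventually_regular[OF surfaces(3) nonconst, of p]
    have "\<forall>\<^sub>F q in at p. h q \<noteq> h p" using reg by (rule eventually_mono) blast
    moreover have "h \<midarrow>p\<rightarrow> h p" using continuous by (simp add: continuous_on_def)
    ultimately have "filterlim h (at (h p)) (at p)" by (simp add: filterlim_at)
    then have "\<forall>\<^sub>F q in at p. h q \<in> S_st" by (rule eventually_compose_filterlim[OF ev_star(1)])
    with reg ev_star(2)[of p] show ?thesis
    proof eventually_elim
      case (elim q)
      then obtain c0 d0 where *: "c0 \<in> charts T" "q \<in> fst c0" "d0 \<in> charts S" "h q \<in> fst d0"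
        "deriv (snd d0 \<circ> h \<circ> param c0) (snd c0 q) \<noteq> 0" by blast
      show ?case
        by (rule pullback_local[OF h X eq elim(2,3) *]) (intro bexI conjI)
    qed
  qed
  have "pullback_eq T S 4 h \<delta> \<epsilon>"
    by (rule pullback_eq_dense[OF frak_dD(2)[OF frak_\<delta>] frak_dD(2)[OF frak_\<epsilon>]], rule eventually_mono[OF dense]) blast
  moreover have "pullback_eq T S 2 h d\<delta> d\<epsilon>"
    by (rule pullback_eq_dense[OF frak_dD(3)[OF frak_\<delta>] frak_dD(3)[OF frak_\<epsilon>]], rule eventually_mono[OF dense]) blast
  ultimately show ?thesis using h by blast
qed

text \<open>The base point moves three times: to a place where \<open>h\<close> is regular, to one
  that is mapped into the domain of \<open>F\<close>, and finally off the point where the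
  differential identities may fail. On a ball around the last one everything is holomorphic and the
  gauge can be written down.\<close>

lemma pullback_imp_dominated:
  assumes h: "holomorphic_map T S h" and pb4: "pullback_eq T S 4 h \<delta> \<epsilon>" and pb2: "pullback_eq T S 2 h d\<delta> d\<epsilon>"
  shows "dominated T g S f"
proof -
  interpret surface_map T S h using surfaces h by unfold_locales
  obtain c0 p0 where c0: "c0 \<in> charts T" "p0 \<in> fst c0" "\<epsilon> c0 p0 \<noteq> 0"
    using gen_\<epsilon> unfolding zero_differential_def by blast
  obtain d0 where d0': "d0 \<in> S" "h p0 \<in> fst d0" using atlas_covers[OF surfaces(1)] .
  have d0: "d0 \<in> charts S" using atlas_subset_charts[OF surfaces(1) d0'(1)] .
  note C0 = topological_chartD[OF chartsD[OF c0(1)]] and D0 = topological_chartD[OF chartsD[OF d0]]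
  \<comment> \<open>Coefficients take the value \<open>0\<close> at poles, so a nonzero value
    excludes a pole and the coefficient is continuous at \<open>p0\<close>.\<close>
  have ev0: "\<forall>\<^sub>F q in at p0. \<epsilon> c0 q \<noteq> 0"
  proof -
    have "(\<epsilon> c0 \<circ> param c0) nicely_meromorphic_on snd c0 ` fst c0"
      using frak_dD(2)[OF frak_\<epsilon>] c0(1) unfolding meromorphic_differential_def by blast
    moreover have v: "(\<epsilon> c0 \<circ> param c0) (snd c0 p0) \<noteq> 0" using c0 C0(4) by simp
    ultimately have "(\<epsilon> c0 \<circ> param c0) \<midarrow>snd c0 p0\<rightarrow> (\<epsilon> c0 \<circ> param c0) (snd c0 p0)"
      using c0(2) unfolding nicely_meromorphic_on_def by blast
    from tendsto_imp_eventually_ne[OF this v] show ?thesis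
      using eventually_at_chart[OF chartsD[OF c0(1)] c0(2), of "\<lambda>q. \<epsilon> c0 q \<noteq> 0"] by simp
  qed
  \<comment> \<open>Where \<open>\<epsilon>\<close> does not vanish, the pullback equation of degree
    four forces the derivative of \<open>h\<close> to be nonzero.\<close>
  define P where "P = (\<lambda>q. \<epsilon> c0 q \<noteq> 0 \<and> q \<in> T_st \<and> q \<in> fst c0 \<inter> h -` fst d0 \<and>
    \<delta> d0 (h q) * deriv (snd d0 \<circ> h \<circ> param c0) (snd c0 q) ^ 4 = \<epsilon> c0 q)"
  have P0: "\<forall>\<^sub>F q in at p0. P q"
  proof -
    have "open (fst c0 \<inter> h -` fst d0)" by (intro open_Int C0(1) open_preimage D0(1))
    then have "\<forall>\<^sub>F q in at p0. q \<in> fst c0 \<inter> h -` fst d0"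
      using c0 d0' by (intro eventually_at_in_open') auto
    moreover have "\<forall>\<^sub>F q in at p0. \<delta> d0 (h q) * deriv (snd d0 \<circ> h \<circ> param c0) (snd c0 q) ^ 4 = \<epsilon> c0 q"
      using pb4 c0 d0 d0' unfolding pullback_eq_def by blast
    ultimately show ?thesis
      using ev0 ev_star(2)[of p0] unfolding P_def by eventually_elim blast
  qed
  have reg: "deriv (snd d0 \<circ> h \<circ> param c0) (snd c0 q) \<noteq> 0" if "P q" for q
    using that by (auto simp: P_def)
  have fl: "filterlim h (at (h q)) (at q)" if "P q" for q
    by (rule regular_filterlim[OF c0(1) _ d0 _ reg[OF that]]) (use that in \<open>auto simp: P_def\<close>)
  obtain q1 where q1: "P q1" "\<forall>\<^sub>F q in at q1. P q"
    using eventually_happens'[OF surface_at_neq_bot[OF surfaces(2)] eventually_at_eventually[OF P0]] by blast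
  have "\<forall>\<^sub>F q in at q1. h q \<in> S_st"
    by (rule eventually_compose_filterlim[OF ev_star(1) fl[OF q1(1)]])
  from eventually_happens'[OF surface_at_neq_bot[OF surfaces(2)] eventually_conj[OF this eventually_at_eventually[OF q1(2)]]]
  obtain q2 where q2: "h q2 \<in> S_st" "P q2" "\<forall>\<^sub>F q in at q2. P q" by blast
  obtain c B \<tau> where c: "c \<in> charts T" "q2 \<in> fst c" and secB: "local_section T G (fst c) B"
    and fB: "frame_on (snd c ` fst c) (B \<circ> param c) (\<lambda>_. 0) (\<lambda>_. kap) (\<lambda>_. 0) \<tau>"
    and \<tau>: "\<tau> holomorphic_on snd c ` fst c" and \<epsilon>c: "\<And>y. y \<in> fst c \<Longrightarrow> \<epsilon> c y = \<tau> (snd c y) * kap ^ 3"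
    using DT.adapted_section[of q2] q2(2) unfolding P_def by metis
  obtain d A t where d: "d \<in> charts S" "h q2 \<in> fst d" and secA: "local_section S F (fst d) A"
    and fA: "frame_on (snd d ` fst d) (A \<circ> param d) (\<lambda>_. 0) (\<lambda>_. kap) (\<lambda>_. 0) t"
    and t: "t holomorphic_on snd d ` fst d" and \<delta>d: "\<And>y. y \<in> fst d \<Longrightarrow> \<delta> d y = t (snd d y) * kap ^ 3"
    using DS.adapted_section[OF q2(1)] by metis
  note C = topological_chartD[OF chartsD[OF c(1)]] and D = topological_chartD[OF chartsD[OF d(1)]]
  define H where "H = snd d \<circ> h \<circ> param c"
  define Y where "Y = \<epsilon> c \<circ> param c"
  define Z where "Z = \<delta> d \<circ> param d"
  define Good where "Good = (\<lambda>q. q \<in> fst c \<inter> h -` fst d \<and> Y (snd c q) \<noteq> 0 \<and>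
    Z (H (snd c q)) * deriv H (snd c q) ^ 4 = Y (snd c q) \<and>
    frak_op Z (H (snd c q)) * deriv H (snd c q) ^ 2 = frak_op Y (snd c q))"
  have "\<forall>\<^sub>F q in at q2. Good q"
  proof -
    have "open (fst c \<inter> h -` fst d)" by (intro open_Int C(1) open_preimage D(1))
    then have 1: "\<forall>\<^sub>F q in at q2. q \<in> fst c \<inter> h -` fst d"
      using c d by (intro eventually_at_in_open') auto
    have 2: "\<forall>\<^sub>F q in at q2. \<delta> d (h q) * deriv (snd d \<circ> h \<circ> param c) (snd c q) ^ 4 = \<epsilon> c q"
      "\<forall>\<^sub>F q in at q2. d\<delta> d (h q) * deriv (snd d \<circ> h \<circ> param c) (snd c q) ^ 2 = d\<epsilon> c q"
      using pb4 pb2 c d unfolding pullback_eq_def by blast+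
    have 3: "\<forall>\<^sub>F q in at q2. d\<delta> d (h q) = frak_op (\<delta> d \<circ> param d) (snd d (h q))"
      by (rule eventually_compose_filterlim[OF frak_dD(5)[OF frak_\<delta> gen_\<delta> DS.frame_adapted[OF d(1) secA fA] d(2)] fl[OF q2(2)]])
    have 4: "\<forall>\<^sub>F q in at q2. d\<epsilon> c q = frak_op (\<epsilon> c \<circ> param c) (snd c q)"
      by (rule frak_dD(5)[OF frak_\<epsilon> gen_\<epsilon> DT.frame_adapted[OF c(1) secB fB] c(2)])
    show ?thesis
      using 1 2 3 4 q2(3)
    proof eventually_elim
      case (elim q)
      have q: "q \<in> fst c" "h q \<in> fst d" "q \<in> fst c0" using elim(1,6) by (auto simp: P_def)
      have HH: "H (snd c q) = snd d (h q)" "Y (snd c q) = \<epsilon> c q" "Z (snd d (h q)) = \<delta> d (h q)"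
        using q C(4) D(4) by (simp_all add: H_def Y_def Z_def)
      have "\<epsilon> c0 q = \<epsilon> c q * deriv (snd c \<circ> param c0) (snd c0 q) ^ 4"
        using frak_dD(2)[OF frak_\<epsilon>] c(1) c0(1) q unfolding meromorphic_differential_def by blast
      then have ne: "\<epsilon> c q \<noteq> 0" using elim(6) by (auto simp: P_def)
      have e2: "\<delta> d (h q) * deriv H (snd c q) ^ 4 = \<epsilon> c q" unfolding H_def by (rule elim(2))
      have e3: "frak_op Z (snd d (h q)) * deriv H (snd c q) ^ 2 = frak_op Y (snd c q)"
        using elim(3) unfolding elim(4,5) H_def Y_def Z_def .
      show ?case
        unfolding Good_def HH by (intro conjI elim(1) ne e2 e3)
    qed
  qed
  then obtain N where N: "open N" "q2 \<in> N" "\<forall>q\<in>N. q \<noteq> q2 \<longrightarrow> Good q"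
    by (rule eventually_at_open)
  have "\<forall>\<^sub>F q in at q2. q \<in> N \<and> q \<noteq> q2 \<and> q \<in> fst c"
    using N(1,2) C(1) c(2) unfolding eventually_at_topological by (intro exI[of _ "N \<inter> fst c"]) auto
  then obtain q3 where q3: "q3 \<in> N" "q3 \<noteq> q2" "q3 \<in> fst c"
    using eventually_happens'[OF surface_at_neq_bot[OF surfaces(2)]] by blast
  define x3 where "x3 = snd c q3"
  have "open (N - {q2})" using N by auto
  from chart_image_open[OF chartsD[OF c(1)] this]
  have "\<exists>\<rho>>0. ball x3 \<rho> \<subseteq> snd c ` (fst c \<inter> (N - {q2}))"
    using q3 unfolding open_contains_ball x3_def by blast
  then obtain \<rho> where \<rho>: "\<rho> > 0" "ball x3 \<rho> \<subseteq> snd c ` (fst c \<inter> (N - {q2}))" by blast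
  define Bl where "Bl = ball x3 \<rho>"
  have Bl: "open Bl" "convex Bl" "x3 \<in> Bl" using \<rho> by (simp_all add: Bl_def)
  have ex: "\<exists>q. x = snd c q \<and> Good q" if "x \<in> Bl" for x
  proof -
    have "x \<in> snd c ` (fst c \<inter> (N - {q2}))" using that \<rho>(2) by (auto simp: Bl_def)
    then obtain q where "x = snd c q" "q \<in> N" "q \<noteq> q2" by blast
    then show ?thesis using N(3) by blast
  qed
  have BlV: "Bl \<subseteq> snd c ` (fst c \<inter> h -` fst d)" "Bl \<subseteq> snd c ` fst c"
    using ex unfolding Good_def by blast+
  have YZ: "Y x \<noteq> 0" "Z (H x) * deriv H x ^ 4 = Y x" "frak_op Z (H x) * deriv H x ^ 2 = frak_op Y x"
    if x: "x \<in> Bl" for x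
  proof -
    obtain q where "x = snd c q" "Good q" using ex[OF x] by blast
    then show "Y x \<noteq> 0" "Z (H x) * deriv H x ^ 4 = Y x" "frak_op Z (H x) * deriv H x ^ 2 = frak_op Y x"
      unfolding Good_def by simp_all
  qed
  have HD: "H x \<in> snd d ` fst d" if "x \<in> Bl" for x
    using BlV(1) that C(4) by (auto simp: H_def)
  have holH: "H holomorphic_on Bl"
    using rep_holomorphic(1)[OF c(1) d(1)] BlV(1) unfolding H_def by (rule holomorphic_on_subset)
  have dH: "(H has_field_derivative deriv H x) (at x)" "deriv H x \<noteq> 0" if "x \<in> Bl" for x
    using holomorphic_derivI[OF holH Bl(1) that] YZ(1,2)[OF that] by auto
  \<comment> \<open>The composition with \<open>H\<close> multiplies \<open>q\<close> by
    \<open>H'\<close> and the gauge by \<open>r\<^sup>2\<close>; keeping \<open>q = kap\<close>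
    requires \<open>r\<^sup>2 = 1 / H'\<close>. The square root exists because \<open>H'\<close> has
    no zeros on the ball.\<close>
  have "(\<lambda>x. 1 / deriv H x) holomorphic_on Bl"
    using dH(2) holomorphic_deriv[OF holH Bl(1)] by (auto intro!: holomorphic_intros)
  from contractible_imp_holomorphic_sqrt[OF this convex_imp_contractible[OF Bl(2)]] dH(2)
  obtain r where r: "r holomorphic_on Bl" "\<And>x. x \<in> Bl \<Longrightarrow> 1 / deriv H x = (r x)\<^sup>2" by auto
  have r0: "r x \<noteq> 0" if "x \<in> Bl" for x using r(2)[OF that] dH(2)[OF that] by auto
  have H': "deriv H x = 1 / (r x)\<^sup>2" if "x \<in> Bl" for x using r(2)[OF that, symmetric] by simp
  have holY: "Y holomorphic_on snd c ` fst c"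
    by (rule holomorphic_transform[of "\<lambda>x. \<tau> x * kap ^ 3"])
      (use \<epsilon>c C in \<open>auto simp: Y_def intro!: holomorphic_intros \<tau>\<close>)
  have holZ: "Z holomorphic_on snd d ` fst d"
    by (rule holomorphic_transform[of "\<lambda>x. t x * kap ^ 3"])
      (use \<delta>d D in \<open>auto simp: Z_def intro!: holomorphic_intros t\<close>)
  note dY = holomorphic_derivI[OF holY C(2)] holomorphic_derivI[OF holomorphic_deriv[OF holY C(2)] C(2)]
  note dZ = holomorphic_derivI[OF holZ D(2)] holomorphic_derivI[OF holomorphic_deriv[OF holZ D(2)] D(2)]
  note dr = holomorphic_derivI[OF r(1) Bl(1)] holomorphic_derivI[OF holomorphic_deriv[OF r(1) Bl(1)] Bl(1)]
  have r2: "deriv (deriv r) x = 0" if x: "x \<in> Bl" for x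
  proof (rule schwarzian_vanishes[OF Bl(1), where Y = Y and Z = Z and H = H and r = r
        and ?Y1.0 = "deriv Y" and ?Y2.0 = "deriv (deriv Y)" and ?Z1.0 = "deriv Z" and ?Z2.0 = "deriv (deriv Z)"
        and ?r1.0 = "deriv r" and ?r2.0 = "deriv (deriv r)"])
    show "(H has_field_derivative 1 / (r x)\<^sup>2) (at x)" if "x \<in> Bl" for x
      using dH(1)[OF that] H'[OF that] by simp
    show "(1/2 * (deriv (deriv Z) (H x) / Z (H x)) - 9/16 * ((deriv Z (H x))\<^sup>2 / (Z (H x))\<^sup>2)) * (1 / (r x)\<^sup>2)\<^sup>2 =
      1/2 * (deriv (deriv Y) x / Y x) - 9/16 * ((deriv Y x)\<^sup>2 / (Y x)\<^sup>2)" if "x \<in> Bl" for x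
      using YZ(3)[OF that] H'[OF that] by (simp only: frak_op_def)
    show "Z (H x) * (1 / (r x)\<^sup>2) ^ 4 = Y x" if "x \<in> Bl" for x
      using YZ(2)[OF that] H'[OF that] by simp
  qed (use x r0 YZ(1) dr dY dZ HD BlV(2) in auto)
  \<comment> \<open>The corner that keeps \<open>p\<close> equal to zero. Its derivative is a
    multiple of \<open>r''\<close>, so the vanishing of the Schwarzian derivative is what keeps
    \<open>s\<close> equal to zero as well.\<close>
  define n where "n = (\<lambda>x. 3 * deriv r x / kap)"
  have dn: "(n has_field_derivative 0) (at x)" if "x \<in> Bl" for x
    unfolding n_def using dr(2)[OF that, of UNIV] r2[OF that] kap(1)
    by (auto intro!: derivative_eq_intros)
  define a where "a = (\<lambda>x. (A \<circ> param d) (H x) ** gauge (r x) (n x))"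
  have fa: "frame_on Bl a (\<lambda>_. 0) (\<lambda>_. kap) (\<lambda>_. 0) \<tau>"
    unfolding frame_on_def
  proof (intro conjI ballI Bl(1) kap(1))
    fix x assume x: "x \<in> Bl"
    have A1: "(A \<circ> param d) (H x) \<in> Sp4"
      "has_mat_deriv (A \<circ> param d) ((A \<circ> param d) (H x) ** nf 0 kap 0 (t (H x))) (H x)"
      using fA HD[OF x] unfolding frame_on_def by blast+
    show "a x \<in> Sp4" unfolding a_def by (intro Sp4_mult A1 gauge_Sp4 r0 x)
    have "has_mat_deriv (\<lambda>x. (A \<circ> param d) (H x)) ((A \<circ> param d) (H x) **
        nf (deriv H x * 0) (deriv H x * kap) (deriv H x * 0) (deriv H x * t (H x))) x"
      by (rule frame_chain[OF A1(2) dH(1)[OF x]])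
    from frame_gauge[of "\<lambda>x. (A \<circ> param d) (H x)", OF A1(1) this dr(1)[OF x] r0[OF x] dn[OF x]]
    have fd: "has_mat_deriv a (a x ** nf (deriv H x * 0 + deriv r x * (1 / r x) - r x * n x * (deriv H x * kap) / 3)
        ((r x)\<^sup>2 * (deriv H x * kap))
        (4/3 * n x * (1 / r x) * (2 * (deriv H x * 0) + deriv r x * (1 / r x) - r x * n x * (deriv H x * kap) / 3) +
          deriv H x * 0 * (1 / r x)\<^sup>2 + 4/3 * 0 * (1 / r x)) (deriv H x * t (H x) * (1 / r x)^6)) x"
      unfolding a_def .
    have p0: "deriv r x * (1 / r x) - r x * n x * (deriv H x * kap) / 3 = 0"
      using r0[OF x] kap(1) by (simp add: H'[OF x] n_def power2_eq_square)
    have q0: "(r x)\<^sup>2 * (deriv H x * kap) = kap" using r0[OF x] by (simp add: H'[OF x])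
    \<comment> \<open>The chain rule contributes \<open>H'\<close> and the gauge
      \<open>(1 / r) ^ 6\<close>, together \<open>H' ^ 4\<close>; this is the factor in the pullback
      of a quartic differential.\<close>
    have t0: "deriv H x * t (H x) * (1 / r x)^6 = \<tau> x"
    proof -
      have "Z (H x) = t (H x) * kap ^ 3" "Y x = \<tau> x * kap ^ 3"
        using \<delta>d[of "param d (H x)"] \<epsilon>c[of "param c x"] D(5,6)[OF HD[OF x]] C(5,6)[of x] BlV(2) x
        by (auto simp: Z_def Y_def)
      then have "t (H x) * deriv H x ^ 4 = \<tau> x" using YZ(2)[OF x] kap(1) by simp
      then show ?thesis using r0[OF x] by (simp add: H'[OF x] power_divide flip: power_mult power_add)
    qed
    have p1: "deriv H x * 0 + deriv r x * (1 / r x) - r x * n x * (deriv H x * kap) / 3 = 0"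
      and p2: "2 * (deriv H x * 0) + deriv r x * (1 / r x) - r x * n x * (deriv H x * kap) / 3 = 0"
      using p0 by simp_all
    have s0: "4/3 * n x * (1 / r x) * 0 + deriv H x * 0 * (1 / r x)\<^sup>2 + 4/3 * 0 * (1 / r x) = 0" by simp
    show "has_mat_deriv a (a x ** nf 0 kap 0 (\<tau> x)) x"
      using fd unfolding p1 p2 q0 t0 s0 .
  qed
  have "connected Bl" using Bl(2) by (rule convex_connected)
  from frames_equal[OF fa frame_on_subset[OF fB BlV(2) Bl(1)] this Bl(3)]
  obtain X where X: "X \<in> Sp4" "\<forall>x\<in>Bl. (B \<circ> param c) x = X ** a x" by blast
  define N0 where "N0 = fst c \<inter> snd c -` Bl"
  \<comment> \<open>The gauged frame still belongs to \<open>F\<close>, so its first two columns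
    span the same plane \<open>f (h q)\<close>.\<close>
  have local: "g q = (\<lambda>v. X *v v) ` f (h q)" if q: "q \<in> N0" for q
  proof -
    have qc: "q \<in> fst c" "snd c q \<in> Bl" using q by (auto simp: N0_def)
    then have "h q \<in> fst d" using BlV(1) C(3) by (auto simp: inj_on_def)
    then have Aq: "(h q, A (h q)) \<in> F" and par: "(A \<circ> param d) (H (snd c q)) = A (h q)"
      using secA qc C(4) D(4) by (auto simp: local_section_def H_def)
    have "(q, B q) \<in> G" using secB qc by (simp add: local_section_def)
    then have "g q = vec.span {column 1 (B q), column 2 (B q)}" by (rule DT.in_F(2))
    moreover have "B q = X ** (A (h q) ** gauge (r (snd c q)) (n (snd c q)))"
      using X(2) qc C(4) par by (auto simp: a_def)
    moreover have "f (h q) = vec.span {column 1 (A (h q) ** gauge (r (snd c q)) (n (snd c q))),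
        column 2 (A (h q) ** gauge (r (snd c q)) (n (snd c q)))}"
      by (rule DS.in_F(2)[OF DS.in_F_gauge[OF Aq r0[OF qc(2)]]])
    ultimately show ?thesis by (simp add: span_columns_mult)
  qed
  have "g p = (\<lambda>v. X *v v) ` f (h p)" for p
  proof (rule planes_continuation[OF surfaces(2,1,3) _ _ _ _ h X(1), where ?N0.0 = N0])
    show "g p \<in> lagrangian_planes" "holomorphic_subspace_map T 2 g" for p
      using iso_g by (auto simp: isotropic_curve_def)
    show "f p \<in> lagrangian_planes" "holomorphic_subspace_map S 2 f" for p
      using iso_f by (auto simp: isotropic_curve_def)
    show "open N0" unfolding N0_def by (rule chart_preimage_open[OF chartsD[OF c(1)] Bl(1)])
    show "N0 \<noteq> {}" using q3(3) Bl(3) by (auto simp: N0_def x3_def)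
  qed (rule local)
  then show ?thesis unfolding dominated_def using h X(1) by blast
qed

end

theorem theorem3:
  fixes S :: "('s::t2_space) chart set" and T :: "('t::t2_space) chart set"
    and f f_sharp :: "'s \<Rightarrow> (complex^4) set" and g g_sharp :: "'t \<Rightarrow> (complex^4) set"
    and F :: "('s \<times> (complex^4^4)) set" and G :: "('t \<times> (complex^4^4)) set"
    and \<delta> d\<delta> :: "'s differential" and \<epsilon> d\<epsilon> :: "'t differential"
  assumes "isotropic_curve S f" and "isotropic_curve T g"
    and "legendre_associate S f f_sharp" and "legendre_associate T g g_sharp"
    and "canonical_reduction S f f_sharp F" and "canonical_reduction T g g_sharp G"
    and "quartic_differential S F \<delta>" and "quartic_differential T G \<epsilon>"
    and general_type: "\<not> zero_differential S \<delta>" "\<not> zero_differential T \<epsilon>"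
    and "frak_d S (- S_star S f f_sharp) F curve_eta \<delta> d\<delta>"
    and "frak_d T (- S_star T g g_sharp) G curve_eta \<epsilon> d\<epsilon>"
  shows "dominated T g S f \<longleftrightarrow>
    (\<exists>h. holomorphic_map T S h \<and> pullback_eq T S 4 h \<delta> \<epsilon> \<and> pullback_eq T S 2 h d\<delta> d\<epsilon>)"
proof -
  interpret curve_pair S T f f_sharp g g_sharp F G \<delta> d\<delta> \<epsilon> d\<epsilon>
    by (rule curve_pair.intro) (fact assms)+
  show ?thesis
    using dominated_imp_pullback pullback_imp_dominated by blast
qed

end
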